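(* For every $k=0,1,2,\dots$, the eigenspace $$\mathcal{E}^{\nu,\mu}_{\tau;k}:=\{F\in\mathcal{M}^{\nu,\mu}_\tau(\mathbb{C}):\ \mathfrak{L}^{\nu,\mu}_\tau F=B^{\nu,\mu}_\tau(2k+1)F\}$$ is a finite dimensional space, whose dimension is given explicitly by $$\dim\mathcal{E}^{\nu,\mu}_{\tau;k}=\frac{2B^{\nu,\mu}_\tau}{\pi}\,\mathrm{Area}(\mathbb{C}/\Gamma).$$
   Context: Let $\mathbf{T}=\{\lambda\in\mathbb{C}:|\lambda|=1\}$ and let $G=\mathbf{T}\rtimes\mathbb{C}$ be the group of matrices $[a,b]:=\begin{pmatrix}a&b\\0&1\end{pmatrix}$, $a\in\mathbf{T}$, $b\in\mathbb{C}$, acting on $\mathbb{C}$ by $g\cdot z=az+b$ for $g=[a,b]$. Write $\langle z,w\rangle=z\bar w$. For $\alpha\in\mathbb{R}$, set $j^\alpha(g,z)=e^{2i\alpha\,\Im\langle z,g^{-1}\cdot 0\rangle}$, $g\in G$, $z\in\mathbb{C}$. Let $\Gamma$ be a uniform lattice in $\mathbb{C}$ (discrete cocompact additive subgroup), with $\gamma\in\Gamma$ identified with $[1,\gamma]\in G$, so $\gamma\cdot z=z+\gamma$. $\mathrm{Area}(\mathbb{C}/\Gamma)$ is the Lebesgue area of a fundamental cell of $\Gamma$. Let $(\rho,\tau)$ be an equivariant pair: $\rho:G\to G$ is a group endomorphism and $\tau:\mathbb{C}\to\mathbb{C}$ is a smooth map with $\tau(g\cdot z)=\rho(g)\cdot\tau(z)$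 for all $g\in G$, $z\in\mathbb{C}$. Let $\nu,\mu>0$ be real numbers. The space $\mathcal{M}^{\nu,\mu}_\tau(\mathbb{C})$ of mixed $\Gamma$-automorphic forms of type $(\nu,\mu)$ with respect to $(\rho,\tau)$ is the space of all $\mathcal{C}^\infty$ functions $F:\mathbb{C}\to\mathbb{C}$ with $F(z+\gamma)=j^{-\nu}(\gamma,z)\,j^{-\mu}(\rho(\gamma),\tau(z))\,F(z)$ for all $\gamma\in\Gamma$, $z\in\mathbb{C}$. Set $S^{\nu,\mu}_\tau(z)=\nu z+\mu\big(\tau\frac{\partial\bar\tau}{\partial\bar z}-\bar\tau\frac{\partial\tau}{\partial\bar z}\big)$. The function $B^{\nu,\mu}_\tau=\nu+\mu\big(|\frac{\partial\tau}{\partial z}|^2-|\frac{\partial\tau}{\partial\bar z}|^2\big)$ is a real constant on $\mathbb{C}$. With $\Delta=4\frac{\partial^2}{\partial z\partial\bar z}$, the magnetic Schrödinger operator is $$\mathfrak{L}^{\nu,\mu}_\tau=-\frac{\partial^2}{\partial z\partial\bar z}-\Big(S^{\nu,\mu}_\tau\frac{\partial}{\partial z}-\overline{S^{\nu,\mu}_\tau}\frac{\partial}{\partial\bar z}\Big)+|S^{\nu,\mu}_\tau|^2-\frac{\mu}{4}(\tau\Delta\bar\tau-\bar\tau\Delta\tau).$$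
   Formalization: The dimension formula is stated only for B > 0 and when a nonzero mixed automorphic form exists; it can fail otherwise (if B·Area is not in πZ all forms vanish; for B < 0 the right side is negative; for B = 0 the dimension can be 1). Finite dimension holds in all cases. *)

theory Defs
  imports
    "HOL-Analysis.Analysis"
    "HOL-Algebra.Group"
    "HOL-Library.Function_Algebras"
begin

section \<open>Smooth functions and Wirtinger derivatives on the complex plane\<close>

text \<open>\<open>C^n\<close> in the real sense: all iterated directional derivatives up to order \<open>n\<close> exist,
  as total derivatives, and are continuous.\<close>

primrec C_times :: "nat \<Rightarrow> (complex \<Rightarrow> complex) \<Rightarrow> bool" where
  "C_times 0 f \<longleftrightarrow> continuous_on UNIV f"
| "C_times (Suc n) f \<longleftrightarrow>
     (\<forall>z. f differentiable (at z)) \<and> (\<forall>v. C_times n (\<lambda>z. frechet_derivative f (at z) v))"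

definition smooth :: "(complex \<Rightarrow> complex) \<Rightarrow> bool" where
  "smooth f \<longleftrightarrow> (\<forall>n. C_times n f)"

definition d_z :: "(complex \<Rightarrow> complex) \<Rightarrow> complex \<Rightarrow> complex" where
  "d_z f z = (frechet_derivative f (at z) 1 - \<i> * frechet_derivative f (at z) \<i>) / 2"

definition d_zbar :: "(complex \<Rightarrow> complex) \<Rightarrow> complex \<Rightarrow> complex" where
  "d_zbar f z = (frechet_derivative f (at z) 1 + \<i> * frechet_derivative f (at z) \<i>) / 2"

definition Laplace :: "(complex \<Rightarrow> complex) \<Rightarrow> complex \<Rightarrow> complex" where
  "Laplace f z = 4 * d_z (d_zbar f) z"

section \<open>The group of rigid motions of the complex plane\<close>

text \<open>The pair \<open>(a, b)\<close> stands for the matrix with rows \<open>(a, b)\<close> and \<open>(0, 1)\<close>; the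
  multiplication is matrix multiplication.\<close>

definition motion_group :: "(complex \<times> complex) monoid" where
  "motion_group =
     \<lparr>carrier = {(a, b). cmod a = 1},
      mult = (\<lambda>(a, b) (c, d). (a * c, a * d + b)),
      one = (1, 0)\<rparr>"

lemma group_motion_group: "group motion_group"
proof (rule groupI)
  fix x assume "x \<in> carrier motion_group"
  then obtain a b where x: "x = (a, b)" "cmod a = 1"
    by (auto simp: motion_group_def)
  then have "a \<noteq> 0"
    by auto
  then have "(inverse a, - (inverse a * b)) \<otimes>\<^bsub>motion_group\<^esub> x = \<one>\<^bsub>motion_group\<^esub>"
    by (simp add: x motion_group_def)
  moreover have "(inverse a, - (inverse a * b)) \<in> carrier motion_group"
    by (simp add: x motion_group_def norm_inverse)
  ultimately show "\<exists>y\<in>carrier motion_group. y \<otimes>\<^bsub>motion_group\<^esub> x = \<one>\<^bsub>motion_group\<^esub>"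
    by blast
qed (auto simp: motion_group_def norm_mult algebra_simps)

definition motion_act :: "complex \<times> complex \<Rightarrow> complex \<Rightarrow> complex" where
  "motion_act g z = fst g * z + snd g"

definition herm :: "complex \<Rightarrow> complex \<Rightarrow> complex" where
  "herm z w = z * cnj w"

definition j_factor :: "real \<Rightarrow> complex \<times> complex \<Rightarrow> complex \<Rightarrow> complex" where
  "j_factor \<alpha> g z =
     exp (2 * \<i> * of_real \<alpha> * of_real (Im (herm z (motion_act (inv\<^bsub>motion_group\<^esub> g) 0))))"

definition equivariant_pair ::
  "(complex \<times> complex \<Rightarrow> complex \<times> complex) \<Rightarrow> (complex \<Rightarrow> complex) \<Rightarrow> bool" where
  "equivariant_pair \<rho> \<tau> \<longleftrightarrow>
     \<rho> \<in> hom motion_group motion_group \<and> smooth \<tau> \<and>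
     (\<forall>g\<in>carrier motion_group. \<forall>z. \<tau> (motion_act g z) = motion_act (\<rho> g) (\<tau> z))"

section \<open>Uniform lattices\<close>

definition coset_of :: "complex set \<Rightarrow> complex \<Rightarrow> complex set" where
  "coset_of \<Gamma> z = (\<lambda>\<gamma>. z + \<gamma>) ` \<Gamma>"

definition quotient_top :: "complex set \<Rightarrow> complex set topology" where
  "quotient_top \<Gamma> = topology (\<lambda>U. U \<subseteq> range (coset_of \<Gamma>) \<and> open (coset_of \<Gamma> -` U))"

lemma openin_quotient_top:
  "openin (quotient_top \<Gamma>) U \<longleftrightarrow> U \<subseteq> range (coset_of \<Gamma>) \<and> open (coset_of \<Gamma> -` U)"
proof -
  have "istopology (\<lambda>U. U \<subseteq> range (coset_of \<Gamma>) \<and> open (coset_of \<Gamma> -` U))"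
    unfolding istopology_def by (auto simp: vimage_Union intro!: open_Int)
  then show ?thesis
    by (simp add: quotient_top_def topology_inverse')
qed

definition uniform_lattice :: "complex set \<Rightarrow> bool" where
  "uniform_lattice \<Gamma> \<longleftrightarrow>
     0 \<in> \<Gamma> \<and> (\<forall>x\<in>\<Gamma>. \<forall>y\<in>\<Gamma>. x - y \<in> \<Gamma>) \<and> discrete \<Gamma> \<and> compact_space (quotient_top \<Gamma>)"

definition fundamental_cell :: "complex set \<Rightarrow> complex set \<Rightarrow> bool" where
  "fundamental_cell \<Gamma> D \<longleftrightarrow>
     (\<exists>\<omega>1 \<omega>2. (\<forall>s t. of_real s * \<omega>1 + of_real t * \<omega>2 = 0 \<longrightarrow> s = 0 \<and> t = 0) \<and>
        \<Gamma> = {of_int m * \<omega>1 + of_int n * \<omega>2 | m n. True} \<and>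
        D = {of_real s * \<omega>1 + of_real t * \<omega>2 | s t. 0 \<le> s \<and> s < 1 \<and> 0 \<le> t \<and> t < 1})"

text \<open>The area does not depend on the cell chosen.\<close>

definition lattice_area :: "complex set \<Rightarrow> real" where
  "lattice_area \<Gamma> = measure lebesgue (SOME D. fundamental_cell \<Gamma> D)"

section \<open>Mixed automorphic forms and the magnetic Schroedinger operator\<close>

definition mixed_forms ::
  "complex set \<Rightarrow> (complex \<times> complex \<Rightarrow> complex \<times> complex) \<Rightarrow> (complex \<Rightarrow> complex)
    \<Rightarrow> real \<Rightarrow> real \<Rightarrow> (complex \<Rightarrow> complex) set" where
  "mixed_forms \<Gamma> \<rho> \<tau> \<nu> \<mu> =
     {F. smooth F \<and>
         (\<forall>\<gamma>\<in>\<Gamma>. \<forall>z. F (z + \<gamma>) =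
            j_factor (- \<nu>) (1, \<gamma>) z * j_factor (- \<mu>) (\<rho> (1, \<gamma>)) (\<tau> z) * F z)}"

definition S_fun :: "(complex \<Rightarrow> complex) \<Rightarrow> real \<Rightarrow> real \<Rightarrow> complex \<Rightarrow> complex" where
  "S_fun \<tau> \<nu> \<mu> z =
     of_real \<nu> * z
     + of_real \<mu> * (\<tau> z * d_zbar (\<lambda>w. cnj (\<tau> w)) z - cnj (\<tau> z) * d_zbar \<tau> z)"

definition B_fun :: "(complex \<Rightarrow> complex) \<Rightarrow> real \<Rightarrow> real \<Rightarrow> complex \<Rightarrow> real" where
  "B_fun \<tau> \<nu> \<mu> z = \<nu> + \<mu> * ((cmod (d_z \<tau> z))\<^sup>2 - (cmod (d_zbar \<tau> z))\<^sup>2)"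

definition magnetic_op ::
  "(complex \<Rightarrow> complex) \<Rightarrow> real \<Rightarrow> real \<Rightarrow> (complex \<Rightarrow> complex) \<Rightarrow> complex \<Rightarrow> complex" where
  "magnetic_op \<tau> \<nu> \<mu> F z =
     - d_z (d_zbar F) z
     - (S_fun \<tau> \<nu> \<mu> z * d_z F z - cnj (S_fun \<tau> \<nu> \<mu> z) * d_zbar F z)
     + of_real ((cmod (S_fun \<tau> \<nu> \<mu> z))\<^sup>2) * F z
     - of_real (\<mu> / 4) * (\<tau> z * Laplace (\<lambda>w. cnj (\<tau> w)) z - cnj (\<tau> z) * Laplace \<tau> z) * F z"

definition mixed_eigenspace ::
  "complex set \<Rightarrow> (complex \<times> complex \<Rightarrow> complex \<times> complex) \<Rightarrow> (complex \<Rightarrow> complex)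
    \<Rightarrow> real \<Rightarrow> real \<Rightarrow> nat \<Rightarrow> (complex \<Rightarrow> complex) set" where
  "mixed_eigenspace \<Gamma> \<rho> \<tau> \<nu> \<mu> k =
     {F \<in> mixed_forms \<Gamma> \<rho> \<tau> \<nu> \<mu>.
        \<forall>z. magnetic_op \<tau> \<nu> \<mu> F z = of_real (B_fun \<tau> \<nu> \<mu> z * (2 * real k + 1)) * F z}"

section \<open>The complex vector space of functions on the plane\<close>

definition fun_scale :: "complex \<Rightarrow> (complex \<Rightarrow> complex) \<Rightarrow> complex \<Rightarrow> complex" where
  "fun_scale c F = (\<lambda>z. c * F z)"

interpretation cfun: vector_space fun_scale
  by unfold_locales (auto simp: fun_scale_def fun_eq_iff algebra_simps)

text \<open>\<open>cfun.dim\<close> alone does not express finiteness: it is \<open>0\<close> on infinite-dimensional spaces.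
  The condition below also says that \<open>V\<close> is a linear subspace.\<close>

definition fin_dim_space :: "(complex \<Rightarrow> complex) set \<Rightarrow> bool" where
  "fin_dim_space V \<longleftrightarrow> (\<exists>S. finite S \<and> cfun.span S = V)"

end

theory Submission
  imports Defs "HOL-Complex_Analysis.Complex_Analysis"
begin

text \<open>
An equivariant map is affine, \<open>\<tau> z = \<tau> 0 + p z + q (cnj z)\<close>: rotations by \<open>-1\<close> force \<open>\<rho>\<close> to send
translations to translations (\<open>equivariant_pair_translation\<close>), so the derivative of \<open>\<tau>\<close> is constant
(\<open>equivariant_map_affine\<close>). Hence \<open>B\<close> is a constant, \<open>S z = B z + c\<close>, the Laplacians of \<open>\<tau>\<close> vanish, and the
product of the two automorphy factors is \<open>exp (2 \<i> Im (S z * cnj \<gamma>))\<close>. The mixed forms are therefore the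
sections of a line bundle with constant curvature on the torus, and the operator is its Landau
Hamiltonian \<open>L\<close>.

Put \<open>A = d_zbar + S\<close> and \<open>A* = - d_z + cnj S\<close>. Then \<open>A* A = L - B\<close> and \<open>A A* = L + B\<close>, so \<open>A*\<close> raises and \<open>A\<close>
lowers the eigenvalue by \<open>2 B\<close>. For \<open>B > 0\<close> the two are mutually inverse up to a nonzero scalar between
consecutive levels, so all levels have the dimension of level \<open>0\<close>. At a point where \<open>|F|\<^sup>2\<close> is maximal its
Laplacian is at most \<open>0\<close>, and this shows that \<open>L\<close> has no negative eigenvalue on sections
(\<open>hamiltonian_no_negative_eigenvalue\<close>). Consequently level \<open>0\<close> is the kernel of \<open>A\<close>: if \<open>F\<close> lies in level \<open>0\<close>,
then \<open>A F\<close> has eigenvalue \<open>-B\<close>.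

A nonzero section forces \<open>B\<close> times the area of a cell to be \<open>\<pi> n\<close> with an integer \<open>n\<close> (\<open>flux_quantized\<close>). In the
coordinate in which the lattice is \<open>\<int> + t \<int>\<close>, division by a Gaussian turns the kernel of \<open>A\<close> into the
entire functions with \<open>\<theta> (w + 1) = \<theta> w\<close> and \<open>\<theta> (w + t) = exp (- \<pi> \<i> N (2 w + t)) \<theta> w\<close>, where \<open>N = 2 n\<close>
(\<open>lowest_level_eq_of_theta_image\<close>). The second law ties the \<open>m\<close>-th Fourier coefficient to the one of
index \<open>m + N\<close>, so \<open>N\<close> consecutive coefficients can be prescribed and they determine \<open>\<theta>\<close>
(\<open>theta_space_basis\<close>). The dimension is thus \<open>N\<close>, that is, \<open>2 B / \<pi>\<close> times the area.

Finite dimension also has to be shown for \<open>B \<le> 0\<close>. For \<open>B < 0\<close> every level is an eigenspace for a negative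
eigenvalue of \<open>L\<close>, hence zero; for \<open>B = 0\<close> a unitary gauge change turns the forms into bounded harmonic
functions, and Liouville's theorem leaves at most one dimension (\<open>landau_level_zero_field\<close>).
\<close>

section \<open>Smooth functions and Wirtinger calculus\<close>

abbreviation dir_deriv :: "complex \<Rightarrow> (complex \<Rightarrow> complex) \<Rightarrow> complex \<Rightarrow> complex" where
  "dir_deriv v f \<equiv> \<lambda>z. frechet_derivative f (at z) v"

lemma smooth_has_derivative:
  assumes "smooth f"
  shows "(f has_derivative frechet_derivative f (at z)) (at z)"
proof -
  have "C_times (Suc 0) f"
    using assms unfolding smooth_def by blast
  then show ?thesis
    by (simp add: frechet_derivative_works [symmetric])
qed

lemma smooth_dir_deriv: "smooth f \<Longrightarrow> smooth (dir_deriv v f)"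
  unfolding smooth_def by (metis C_times.simps(2))

lemma smooth_continuous: "smooth f \<Longrightarrow> continuous_on S f"
  by (metis C_times.simps(1) continuous_on_subset smooth_def subset_UNIV)

lemma dir_deriv_eq: "(\<And>z. (f has_derivative D z) (at z)) \<Longrightarrow> dir_deriv v f = (\<lambda>z. D z v)"
  using frechet_derivative_at by metis

lemma C_times_const [simp]: "C_times n (\<lambda>z. c)"
  by (induction n arbitrary: c) (auto simp: frechet_derivative_const)

lemma C_times_Suc_D: "C_times (Suc n) f \<Longrightarrow> C_times n f"
proof (induction n arbitrary: f)
  case 0
  then show ?case
    by (auto intro!: continuous_at_imp_continuous_on differentiable_imp_continuous_within)
next
  case (Suc n)
  then show ?case
    using C_times.simps(2) by blast
qed

lemma frechet_works:
  "f differentiable (at z) \<Longrightarrow> (f has_derivative frechet_derivative f (at z)) (at z)"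
  using frechet_derivative_works by blast

lemma C_times_add: "C_times n f \<Longrightarrow> C_times n g \<Longrightarrow> C_times n (\<lambda>z. f z + g z)"
proof (induction n arbitrary: f g)
  case 0
  then show ?case by (auto intro: continuous_intros)
next
  case (Suc n)
  have "dir_deriv v (\<lambda>z. f z + g z) = (\<lambda>z. dir_deriv v f z + dir_deriv v g z)" for v
    using Suc.prems by (intro dir_deriv_eq has_derivative_add frechet_works) auto
  then show ?case
    using Suc by (auto intro!: derivative_intros)
qed

lemma C_times_mult: "C_times n f \<Longrightarrow> C_times n g \<Longrightarrow> C_times n (\<lambda>z. f z * g z)"
proof (induction n arbitrary: f g)
  case 0
  then show ?case by (auto intro: continuous_intros)
next
  case (Suc n)
  have "dir_deriv v (\<lambda>z. f z * g z) = (\<lambda>z. f z * dir_deriv v g z + dir_deriv v f z * g z)" for v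
    using Suc.prems by (intro dir_deriv_eq has_derivative_mult frechet_works) auto
  moreover have "C_times n (\<lambda>z. f z * dir_deriv v g z + dir_deriv v f z * g z)" for v
    using Suc.prems C_times_Suc_D by (intro C_times_add Suc.IH) auto
  ultimately show ?case
    using Suc.prems by auto
qed

lemma C_times_cnj: "C_times n f \<Longrightarrow> C_times n (\<lambda>z. cnj (f z))"
proof (induction n arbitrary: f)
  case 0
  then show ?case by (auto intro: continuous_intros)
next
  case (Suc n)
  have der: "((\<lambda>z. cnj (f z)) has_derivative (\<lambda>v. cnj (frechet_derivative f (at z) v))) (at z)" for z
    using Suc.prems by (intro derivative_intros frechet_works) auto
  then have "dir_deriv v (\<lambda>z. cnj (f z)) = (\<lambda>z. cnj (dir_deriv v f z))" for v
    by (rule dir_deriv_eq)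
  moreover have "(\<lambda>z. cnj (f z)) differentiable at z" for z
    using der differentiable_def by blast
  ultimately show ?case
    using Suc by auto
qed

lemma C_times_linear:
  assumes "bounded_linear f" shows "C_times n f"
proof (cases n)
  case 0
  then show ?thesis
    using assms by (simp add: linear_continuous_on)
next
  case (Suc m)
  have der: "(f has_derivative f) (at z)" for z
    using assms by (rule bounded_linear_imp_has_derivative)
  then have "dir_deriv v f = (\<lambda>z. f v)" for v
    by (rule dir_deriv_eq)
  then show ?thesis
    using Suc der by (auto simp: differentiable_def)
qed

text \<open>The outer function is an arbitrary entire function because the induction replaces it by its derivative;
the exponential and the theta functions are the instances of interest.\<close>

lemma C_times_holomorphic_compose:
  "h holomorphic_on UNIV \<Longrightarrow> C_times n f \<Longrightarrow> C_times n (\<lambda>z. h (f z))"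
proof (induction n arbitrary: h f)
  case 0
  then show ?case
    by (auto intro: continuous_on_compose2[where g=h and t=UNIV] holomorphic_on_imp_continuous_on)
next
  case (Suc n)
  have der: "((\<lambda>z. h (f z)) has_derivative (\<lambda>v. deriv h (f z) * frechet_derivative f (at z) v)) (at z)"
    for z
  proof (rule has_derivative_compose[where f=f and g=h and g'="\<lambda>x. deriv h (f z) * x"])
    show "(f has_derivative frechet_derivative f (at z)) (at z)"
      using Suc.prems(2) by (simp add: frechet_works)
    show "(h has_derivative (\<lambda>x. deriv h (f z) * x)) (at (f z))"
      using Suc.prems(1) by (simp add: holomorphic_derivI has_field_derivative_imp_has_derivative)
  qed
  then have "dir_deriv v (\<lambda>z. h (f z)) = (\<lambda>z. deriv h (f z) * dir_deriv v f z)" for v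
    by (rule dir_deriv_eq)
  moreover have "C_times n (\<lambda>z. deriv h (f z) * dir_deriv v f z)" for v
  proof (rule C_times_mult[OF Suc.IH[of "deriv h" f]])
    show "deriv h holomorphic_on UNIV"
      using Suc.prems(1) by (simp add: holomorphic_deriv)
    show "C_times n f"
      using Suc.prems(2) by (rule C_times_Suc_D)
    show "C_times n (dir_deriv v f)"
      using Suc.prems(2) by simp
  qed
  moreover have "(\<lambda>z. h (f z)) differentiable at z" for z
    using der differentiable_def by blast
  ultimately show ?case
    by simp
qed

named_theorems smooth_intros

lemma smooth_const [smooth_intros]: "smooth (\<lambda>z. c)"
  by (simp add: smooth_def)

lemma smooth_add [smooth_intros]: "smooth f \<Longrightarrow> smooth g \<Longrightarrow> smooth (\<lambda>z. f z + g z)"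
  by (simp add: smooth_def C_times_add)

lemma smooth_mult [smooth_intros]: "smooth f \<Longrightarrow> smooth g \<Longrightarrow> smooth (\<lambda>z. f z * g z)"
  by (simp add: smooth_def C_times_mult)

lemma smooth_cnj [smooth_intros]: "smooth f \<Longrightarrow> smooth (\<lambda>z. cnj (f z))"
  by (simp add: smooth_def C_times_cnj)

lemma smooth_ident [smooth_intros]: "smooth (\<lambda>z. z)"
  by (simp add: smooth_def C_times_linear)

lemma smooth_holomorphic_compose:
  "h holomorphic_on UNIV \<Longrightarrow> smooth f \<Longrightarrow> smooth (\<lambda>z. h (f z))"
  by (simp add: smooth_def C_times_holomorphic_compose)

lemma smooth_exp [smooth_intros]: "smooth f \<Longrightarrow> smooth (\<lambda>z. exp (f z))"
  by (rule smooth_holomorphic_compose[OF holomorphic_on_exp])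

lemma smooth_minus [smooth_intros]: "smooth f \<Longrightarrow> smooth (\<lambda>z. - f z)"
  using smooth_mult[OF smooth_const[of "-1"]] by simp

lemma smooth_diff [smooth_intros]: "smooth f \<Longrightarrow> smooth g \<Longrightarrow> smooth (\<lambda>z. f z - g z)"
  using smooth_add[of f "\<lambda>z. - g z"] smooth_minus[of g] by simp

lemma smooth_d_z [smooth_intros]: "smooth f \<Longrightarrow> smooth (d_z f)"
proof -
  assume "smooth f"
  then have "smooth (\<lambda>z. (dir_deriv 1 f z - \<i> * dir_deriv \<i> f z) * (1/2))"
    by (intro smooth_intros smooth_dir_deriv)
  then show ?thesis by (simp add: d_z_def[abs_def])
qed

lemma smooth_d_zbar [smooth_intros]: "smooth f \<Longrightarrow> smooth (d_zbar f)"
proof -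
  assume "smooth f"
  then have "smooth (\<lambda>z. (dir_deriv 1 f z + \<i> * dir_deriv \<i> f z) * (1/2))"
    by (intro smooth_intros smooth_dir_deriv)
  then show ?thesis by (simp add: d_zbar_def[abs_def])
qed

lemma wirtinger_has_derivative:
  assumes "(f has_derivative D) (at z)"
  shows "d_z f z = (D 1 - \<i> * D \<i>) / 2" "d_zbar f z = (D 1 + \<i> * D \<i>) / 2"
  using frechet_derivative_at[OF assms] by (simp_all add: d_z_def d_zbar_def)

lemma wirtinger_const: "d_z (\<lambda>z. c) z = 0" "d_zbar (\<lambda>z. c) z = 0"
  by (simp_all add: d_z_def d_zbar_def frechet_derivative_const)

lemma wirtinger_ident: "d_z (\<lambda>z. z) z = 1" "d_zbar (\<lambda>z. z) z = 0"
  by (simp_all add: wirtinger_has_derivative[OF has_derivative_ident])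

lemma wirtinger_add:
  assumes "smooth f" "smooth g"
  shows "d_z (\<lambda>z. f z + g z) z = d_z f z + d_z g z"
    "d_zbar (\<lambda>z. f z + g z) z = d_zbar f z + d_zbar g z"
  by (subst wirtinger_has_derivative[OF has_derivative_add[OF assms[THEN smooth_has_derivative], of z]], simp add: d_z_def d_zbar_def field_simps)+

lemma wirtinger_mult:
  assumes "smooth f" "smooth g"
  shows "d_z (\<lambda>z. f z * g z) z = f z * d_z g z + d_z f z * g z"
    "d_zbar (\<lambda>z. f z * g z) z = f z * d_zbar g z + d_zbar f z * g z"
  by (subst wirtinger_has_derivative[OF has_derivative_mult[OF assms[THEN smooth_has_derivative], of z]], simp add: d_z_def d_zbar_def field_simps)+

lemma wirtinger_cnj:
  assumes "smooth f"
  shows "d_z (\<lambda>z. cnj (f z)) z = cnj (d_zbar f z)"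
    "d_zbar (\<lambda>z. cnj (f z)) z = cnj (d_z f z)"
  by (subst wirtinger_has_derivative[OF has_derivative_cnj[OF smooth_has_derivative[OF assms, of z]]], simp add: d_z_def d_zbar_def field_simps)+

lemma wirtinger_holomorphic_compose:
  assumes "h holomorphic_on UNIV" "smooth f"
  shows "d_z (\<lambda>z. h (f z)) z = deriv h (f z) * d_z f z"
    "d_zbar (\<lambda>z. h (f z)) z = deriv h (f z) * d_zbar f z"
proof -
  have "(h has_derivative (\<lambda>x. deriv h (f z) * x)) (at (f z))"
    using assms(1) by (simp add: holomorphic_derivI has_field_derivative_imp_has_derivative)
  then have *: "((\<lambda>z. h (f z)) has_derivative (\<lambda>v. deriv h (f z) * frechet_derivative f (at z) v)) (at z)"
    by (rule has_derivative_compose[OF smooth_has_derivative[OF assms(2)]])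
  show "d_z (\<lambda>z. h (f z)) z = deriv h (f z) * d_z f z"
    "d_zbar (\<lambda>z. h (f z)) z = deriv h (f z) * d_zbar f z"
    using wirtinger_has_derivative[OF *]
    by (simp_all add: d_z_def d_zbar_def field_simps)
qed

lemma wirtinger_exp:
  assumes "smooth f"
  shows "d_z (\<lambda>z. exp (f z)) z = exp (f z) * d_z f z"
    "d_zbar (\<lambda>z. exp (f z)) z = exp (f z) * d_zbar f z"
  using wirtinger_holomorphic_compose[OF holomorphic_on_exp assms, of z]
  by (simp_all add: DERIV_imp_deriv[OF DERIV_exp])

lemma wirtinger_minus:
  assumes "smooth f"
  shows "d_z (\<lambda>z. - f z) z = - d_z f z" "d_zbar (\<lambda>z. - f z) z = - d_zbar f z"
  using wirtinger_mult[OF smooth_const[of "-1"] assms, of z] by (simp_all add: wirtinger_const)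

lemma wirtinger_diff:
  assumes "smooth f" "smooth g"
  shows "d_z (\<lambda>z. f z - g z) z = d_z f z - d_z g z"
    "d_zbar (\<lambda>z. f z - g z) z = d_zbar f z - d_zbar g z"
  using wirtinger_add[OF assms(1) smooth_minus[OF assms(2)], of z] assms
  by (simp_all add: wirtinger_minus)

lemmas wirtinger_simps = wirtinger_const wirtinger_ident wirtinger_add wirtinger_mult
  wirtinger_cnj wirtinger_exp wirtinger_minus wirtinger_diff

lemma wirtinger_translate:
  "d_z (\<lambda>z. f (z + c)) z = d_z f (z + c)" "d_zbar (\<lambda>z. f (z + c)) z = d_zbar f (z + c)"
  if "smooth f"
proof -
  have "((\<lambda>z. f (z + c)) has_derivative (\<lambda>v. frechet_derivative f (at (z + c)) v)) (at z)"
    by (rule has_derivative_compose[OF _ smooth_has_derivative[OF that], where f="\<lambda>z. z + c"])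
       (auto intro!: derivative_eq_intros)
  from wirtinger_has_derivative[OF this]
  show "d_z (\<lambda>z. f (z + c)) z = d_z f (z + c)" "d_zbar (\<lambda>z. f (z + c)) z = d_zbar f (z + c)"
    by (simp_all add: d_z_def d_zbar_def)
qed

text \<open>The vanishing of \<open>d_zbar\<close> is the Cauchy--Riemann equation: it makes the real derivative complex linear.\<close>

lemma d_zbar_zero_imp_holomorphic:
  assumes "smooth f" "\<And>z. d_zbar f z = 0"
  shows "f holomorphic_on UNIV"
proof (clarsimp simp: holomorphic_on_def)
  fix z
  let ?D = "frechet_derivative f (at z)"
  have D: "(f has_derivative ?D) (at z)"
    using assms(1) by (rule smooth_has_derivative)
  have lin: "linear ?D"
    using D has_derivative_bounded_linear bounded_linear.linear by blast
  have "?D 1 + \<i> * ?D \<i> = 0"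
    using assms(2)[of z] by (simp add: d_zbar_def)
  then have "?D 1 = - (\<i> * ?D \<i>)"
    by (simp add: add_eq_0_iff2)
  then have i: "?D \<i> = \<i> * ?D 1"
    by simp
  have "?D v = ?D 1 * v" for v
  proof -
    have "?D v = ?D (Re v *\<^sub>R 1 + Im v *\<^sub>R \<i>)"
      by (rule arg_cong[where f="?D"]) (simp add: complex_eq_iff)
    also have "\<dots> = Re v *\<^sub>R ?D 1 + Im v *\<^sub>R ?D \<i>"
      by (simp only: linear_add[OF lin] linear_scale[OF lin])
    also have "\<dots> = ?D 1 * (of_real (Re v) + \<i> * of_real (Im v))"
      unfolding i by (simp add: scaleR_conv_of_real algebra_simps)
    also have "\<dots> = ?D 1 * v"
      using complex_eq[of v] by simp
    finally show ?thesis .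
  qed
  then have "?D = (*) (?D 1)" by (rule ext)
  then have "(f has_field_derivative ?D 1) (at z)"
    using D by (simp add: has_field_derivative_def)
  then show "f field_differentiable at z"
    by (auto simp: field_differentiable_def)
qed

section \<open>Symmetry of second derivatives and the maximum principle\<close>

lemma has_vector_derivative_along_line:
  assumes "smooth f"
  shows "((\<lambda>x::real. f (z + of_real x * u)) has_vector_derivative dir_deriv u f (z + of_real x * u))
    (at x within S)"
proof -
  have lin: "linear (frechet_derivative f (at (z + of_real x * u)))"
    using smooth_has_derivative[OF assms] has_derivative_bounded_linear bounded_linear.linear by blast
  have "((\<lambda>x::real. f (z + of_real x * u)) has_derivative
      (\<lambda>y. frechet_derivative f (at (z + of_real x * u)) (of_real y * u))) (at x within S)"
    by (rule has_derivative_compose[OF _ smooth_has_derivative[OF assms],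
        where f="\<lambda>x::real. z + of_real x * u"]) (auto intro!: derivative_eq_intros)
  then show ?thesis
    using linear_scale[OF lin] by (simp add: has_vector_derivative_def scaleR_conv_of_real)
qed

lemma norm_diff_le_by_derivative_bound:
  fixes h :: "real \<Rightarrow> complex"
  assumes "\<And>x. (h has_vector_derivative h' x) (at x)"
    and "\<And>x. 0 < x \<Longrightarrow> x < s \<Longrightarrow> norm (h' x) \<le> K" and "0 < s"
  shows "norm (h s - h 0) \<le> K * s"
proof -
  have "norm (h s - h 0) \<le> K * s - K * 0"
  proof (rule differentiable_bound_general[where f'=h' and \<phi>="\<lambda>x. K * x" and \<phi>'="\<lambda>x. K"])
    show "continuous_on {0..s} h"
      by (rule continuous_at_imp_continuous_on) (use assms(1) has_vector_derivative_continuous in blast)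
    show "((\<lambda>x. K * x) has_vector_derivative K) (at x)" for x
      by (auto intro!: derivative_eq_intros simp: has_vector_derivative_def)
  qed (use assms in \<open>auto intro!: continuous_intros\<close>)
  then show ?thesis by simp
qed

text \<open>The mean value inequality is applied once in direction \<open>u\<close> and once in direction \<open>v\<close>, so continuity of the one
mixed derivative is all that enters. The second difference on the left is symmetric in \<open>u\<close> and \<open>v\<close>, and
this makes mixed derivatives commute.\<close>

lemma second_difference_estimate:
  assumes f: "smooth f" and "\<epsilon> > 0"
  shows "\<exists>\<delta>>0. \<forall>s::real. 0 < s \<and> s < \<delta> \<longrightarrow>
    norm (f (z + of_real s * u + of_real s * v) - f (z + of_real s * u) - f (z + of_real s * v) + f z
      - of_real (s\<^sup>2) * dir_deriv v (dir_deriv u f) z) \<le> \<epsilon> * s\<^sup>2"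
proof -
  define m where "m = dir_deriv v (dir_deriv u f) z"
  have fu: "smooth (dir_deriv u f)" and "continuous_on UNIV (dir_deriv v (dir_deriv u f))"
    using f by (auto intro: smooth_dir_deriv smooth_continuous)
  then have "isCont (dir_deriv v (dir_deriv u f)) z"
    by (simp add: continuous_on_eq_continuous_at)
  then obtain d where d: "d > 0"
    "\<And>w. dist w z < d \<Longrightarrow> dist (dir_deriv v (dir_deriv u f) w) m < \<epsilon>"
    unfolding continuous_at_eps_delta m_def using \<open>\<epsilon> > 0\<close> by meson
  \<comment> \<open>Points \<open>z + x u + y v\<close> with \<open>0 \<le> x, y \<le> s\<close> lie within \<open>s K\<close> of \<open>z\<close>; the summand \<open>1\<close> keeps \<open>K\<close> positive.\<close>
  define K where "K = norm u + norm v + 1"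
  have K: "K > 0" by (simp add: K_def add_nonneg_pos)
  have est: "norm (f (z + of_real s * u + of_real s * v) - f (z + of_real s * u)
      - f (z + of_real s * v) + f z - of_real (s\<^sup>2) * m) \<le> \<epsilon> * s\<^sup>2"
    if s: "0 < s" "s < d / K" for s :: real
  proof -
    have sK: "s * K < d"
      using s K by (simp add: pos_less_divide_eq)
    have inner: "norm (dir_deriv u f (z + of_real s * v + of_real x * u)
        - dir_deriv u f (z + of_real x * u) - of_real s * m) \<le> \<epsilon> * s"
      if x: "0 < x" "x < s" for x :: real
    proof -
      define h where "h = (\<lambda>y::real. dir_deriv u f ((z + of_real x * u) + of_real y * v) - of_real y * m)"
      have "norm (h s - h 0) \<le> \<epsilon> * s"
      proof (rule norm_diff_le_by_derivative_bound)
        show "(h has_vector_derivative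
            dir_deriv v (dir_deriv u f) ((z + of_real x * u) + of_real y * v) - m) (at y)" for y
          unfolding h_def
          by (intro has_vector_derivative_diff has_vector_derivative_along_line fu)
             (auto intro!: derivative_eq_intros simp: has_vector_derivative_def scaleR_conv_of_real)
        show "norm (dir_deriv v (dir_deriv u f) ((z + of_real x * u) + of_real y * v) - m) \<le> \<epsilon>"
          if y: "0 < y" "y < s" for y
        proof -
          have "norm (of_real x * u + of_real y * v) \<le> s * norm u + s * norm v"
            using x y by (intro norm_triangle_mono) (auto simp: norm_mult intro!: mult_right_mono)
          also have "\<dots> \<le> s * K"
            using s by (simp add: K_def algebra_simps)
          finally have "dist (z + of_real x * u + of_real y * v) z < d"
            using sK by (simp add: dist_norm algebra_simps)
          then show ?thesis
            using d(2) by (simp add: dist_norm less_imp_le)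
        qed
      qed (use s in auto)
      then show ?thesis by (simp add: h_def algebra_simps)
    qed
    define g where "g = (\<lambda>x::real. f ((z + of_real s * v) + of_real x * u) - f (z + of_real x * u)
      - of_real x * (of_real s * m))"
    have "norm (g s - g 0) \<le> (\<epsilon> * s) * s"
    proof (rule norm_diff_le_by_derivative_bound)
      show "(g has_vector_derivative dir_deriv u f ((z + of_real s * v) + of_real x * u)
          - dir_deriv u f (z + of_real x * u) - of_real s * m) (at x)" for x
        unfolding g_def
        by (intro has_vector_derivative_diff has_vector_derivative_along_line f)
           (auto intro!: derivative_eq_intros simp: has_vector_derivative_def scaleR_conv_of_real)
    qed (use s inner in auto)
    then show ?thesis by (simp add: g_def power2_eq_square algebra_simps)
  qed
  show ?thesis
    using est d(1) K by (intro exI[of _ "d / K"]) (auto simp: m_def)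
qed

lemma dir_deriv_commute:
  assumes f: "smooth f"
  shows "dir_deriv v (dir_deriv u f) z = dir_deriv u (dir_deriv v f) z"
proof (rule ccontr)
  define a where "a = dir_deriv v (dir_deriv u f) z"
  define b where "b = dir_deriv u (dir_deriv v f) z"
  define e where "e = norm (a - b) / 4"
  assume "\<not> ?thesis"
  then have e: "e > 0" by (simp add: e_def a_def b_def)
  obtain d1 where d1: "d1 > 0" "\<And>s::real. 0 < s \<Longrightarrow> s < d1 \<Longrightarrow>
    norm (f (z + of_real s * u + of_real s * v) - f (z + of_real s * u) - f (z + of_real s * v) + f z
      - of_real (s\<^sup>2) * a) \<le> e * s\<^sup>2"
    using second_difference_estimate[OF f e, of z u v] unfolding a_def by blast
  obtain d2 where d2: "d2 > 0" "\<And>s::real. 0 < s \<Longrightarrow> s < d2 \<Longrightarrow>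
    norm (f (z + of_real s * v + of_real s * u) - f (z + of_real s * v) - f (z + of_real s * u) + f z
      - of_real (s\<^sup>2) * b) \<le> e * s\<^sup>2"
    using second_difference_estimate[OF f e, of z v u] unfolding b_def by blast
  define s where "s = min d1 d2 / 2"
  have s: "0 < s" "s < d1" "s < d2"
    using d1 d2 by (auto simp: s_def)
  define w where "w = f (z + of_real s * u + of_real s * v) - f (z + of_real s * u) - f (z + of_real s * v) + f z"
  have "norm (w - of_real (s\<^sup>2) * a) \<le> e * s\<^sup>2"
    using d1(2)[of s] s unfolding w_def by blast
  moreover have "norm (w - of_real (s\<^sup>2) * b) \<le> e * s\<^sup>2"
    using d2(2)[of s] s unfolding w_def by (simp add: algebra_simps)
  ultimately have "norm ((w - of_real (s\<^sup>2) * b) - (w - of_real (s\<^sup>2) * a)) \<le> e * s\<^sup>2 + e * s\<^sup>2"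
    by (meson norm_triangle_le_diff add_mono add.commute order_trans norm_triangle_ineq4)
  also have "(w - of_real (s\<^sup>2) * b) - (w - of_real (s\<^sup>2) * a) = of_real (s\<^sup>2) * (a - b)"
    by (simp add: algebra_simps)
  finally have "s\<^sup>2 * norm (a - b) \<le> s\<^sup>2 * (2 * e)"
    by (simp only: norm_mult norm_power norm_of_real) (simp add: algebra_simps)
  then have "norm (a - b) \<le> 2 * e"
    using s by (simp add: mult_le_cancel_left_pos)
  then show False
    using e by (simp add: e_def)
qed

lemma d_z_conv: "d_z f = (\<lambda>z. (1 / 2) * dir_deriv 1 f z + (- \<i> / 2) * dir_deriv \<i> f z)"
  by (simp add: fun_eq_iff d_z_def field_simps)

lemma d_zbar_conv: "d_zbar f = (\<lambda>z. (1 / 2) * dir_deriv 1 f z + (\<i> / 2) * dir_deriv \<i> f z)"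
  by (simp add: fun_eq_iff d_zbar_def field_simps)

lemma dir_deriv_wirtinger:
  assumes "smooth f"
  shows "dir_deriv v (d_z f) = d_z (dir_deriv v f)" "dir_deriv v (d_zbar f) = d_zbar (dir_deriv v f)"
proof -
  have *: "dir_deriv v (\<lambda>z. (1 / 2) * dir_deriv 1 f z + c * dir_deriv \<i> f z)
    = (\<lambda>z. (1 / 2) * dir_deriv 1 (dir_deriv v f) z + c * dir_deriv \<i> (dir_deriv v f) z)" for c
  proof -
    have "dir_deriv v (\<lambda>z. (1 / 2) * dir_deriv 1 f z + c * dir_deriv \<i> f z)
      = (\<lambda>z. (1 / 2) * dir_deriv v (dir_deriv 1 f) z + c * dir_deriv v (dir_deriv \<i> f) z)"
      by (rule dir_deriv_eq) (intro has_derivative_add has_derivative_mult_right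
          smooth_has_derivative smooth_dir_deriv assms)
    then show ?thesis
      using dir_deriv_commute[OF assms, of v] by simp
  qed
  show "dir_deriv v (d_z f) = d_z (dir_deriv v f)" "dir_deriv v (d_zbar f) = d_zbar (dir_deriv v f)"
    unfolding d_z_conv d_zbar_conv * by (rule refl)+
qed

text \<open>Needed to read off the sign of \<open>d_z d_zbar\<close> at a maximum from one-dimensional second derivatives.\<close>

lemma d_z_d_zbar:
  assumes "smooth f"
  shows "d_z (d_zbar f) z = (dir_deriv 1 (dir_deriv 1 f) z + dir_deriv \<i> (dir_deriv \<i> f) z) / 4"
proof -
  have "d_z (d_zbar f) z = (d_zbar (dir_deriv 1 f) z - \<i> * d_zbar (dir_deriv \<i> f) z) / 2"
    unfolding d_z_def[of "d_zbar f"] using dir_deriv_wirtinger(2)[OF assms] by metis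
  also have "\<dots> = (dir_deriv 1 (dir_deriv 1 f) z + dir_deriv \<i> (dir_deriv \<i> f) z) / 4"
    using dir_deriv_commute[OF assms, where u=1 and v="\<i>" and z=z] by (simp add: d_zbar_def field_simps)
  finally show ?thesis .
qed

lemma d_zbar_d_z:
  assumes "smooth f"
  shows "d_zbar (d_z f) z = d_z (d_zbar f) z"
proof -
  have "d_zbar (d_z f) z = (d_z (dir_deriv 1 f) z + \<i> * d_z (dir_deriv \<i> f) z) / 2"
    unfolding d_zbar_def[of "d_z f"] using dir_deriv_wirtinger(1)[OF assms] by metis
  also have "\<dots> = (dir_deriv 1 (dir_deriv 1 f) z + dir_deriv \<i> (dir_deriv \<i> f) z) / 4"
    using dir_deriv_commute[OF assms, where u=1 and v="\<i>" and z=z] by (simp add: d_z_def field_simps)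
  finally show ?thesis
    unfolding d_z_d_zbar[OF assms] .
qed

lemma second_derivative_nonpos_at_max:
  fixes g :: "real \<Rightarrow> real"
  assumes g: "\<And>x. (g has_real_derivative g' x) (at x)"
    and l: "(g' has_real_derivative l) (at 0)" and max: "\<And>x. g x \<le> g 0"
  shows "l \<le> 0"
proof (rule ccontr)
  assume "\<not> l \<le> 0"
  have "g' 0 = 0"
    using DERIV_local_max[OF g[of 0], of 1] max by auto
  then obtain d where d: "d > 0" "\<And>h. 0 < h \<Longrightarrow> h < d \<Longrightarrow> g' h > 0"
    using DERIV_pos_inc_right[OF l] \<open>\<not> l \<le> 0\<close> by auto
  have "g 0 < g (d / 2)"
    by (rule DERIV_pos_imp_increasing_open[where f=g])
       (use d g in \<open>auto intro!: DERIV_isCont continuous_at_imp_continuous_on\<close>, (meson g d(2) | fastforce)+)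
  then show False
    using max[of "d / 2"] by simp
qed

lemma d_z_d_zbar_nonpos_at_max:
  assumes u: "smooth u" and max: "\<And>z. Re (u z) \<le> Re (u z0)"
  shows "Re (d_z (d_zbar u) z0) \<le> 0"
proof -
  have "Re (dir_deriv v (dir_deriv v u) z0) \<le> 0" for v
  proof (rule second_derivative_nonpos_at_max)
    have *: "((\<lambda>x. Re (f (z0 + of_real x * v))) has_real_derivative Re (dir_deriv v f (z0 + of_real x * v))) (at x)"
      if "smooth f" for f x
      using bounded_linear.has_vector_derivative[OF bounded_linear_Re has_vector_derivative_along_line[OF that]]
      by (simp add: has_real_derivative_iff_has_vector_derivative)
    show "((\<lambda>x. Re (u (z0 + of_real x * v))) has_real_derivative Re (dir_deriv v u (z0 + of_real x * v))) (at x)" for x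
      using u by (rule *)
    show "((\<lambda>x. Re (dir_deriv v u (z0 + of_real x * v))) has_real_derivative Re (dir_deriv v (dir_deriv v u) z0)) (at 0)"
      using *[OF smooth_dir_deriv[OF u, of v], of 0] by simp
  qed (use max in auto)
  from this[of 1] this[of \<i>] show ?thesis
    by (simp add: d_z_d_zbar[OF u])
qed

lemma bounded_d_zbar_zero_imp_constant:
  assumes "smooth f" "\<And>z. d_zbar f z = 0" "bounded (range f)"
  obtains c where "\<And>z. f z = c"
  using Liouville_theorem[OF d_zbar_zero_imp_holomorphic[OF assms(1,2)] assms(3)]
  by (auto simp: constant_on_def)

section \<open>Plane lattices and the area of a cell\<close>

no_notation fps_nth (infixl \<open>$\<close> 75)

text \<open>Cramer's rule: \<open>Im (cnj a * b)\<close> is the determinant of the pair \<open>a\<close>, \<open>b\<close> of plane vectors.\<close>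

lemma real_coordinates:
  assumes "Im (cnj a * b) \<noteq> 0"
  shows "z = of_real (Im (cnj z * b) / Im (cnj a * b)) * a + of_real (Im (cnj a * z) / Im (cnj a * b)) * b"
proof -
  have "of_real (Im (cnj a * b)) * z = of_real (Im (cnj z * b)) * a + of_real (Im (cnj a * z)) * b"
    by (simp add: complex_eq_iff algebra_simps)
  moreover have "w = of_real (p / d) * a + of_real (q / d) * b"
    if "of_real d * w = of_real p * a + of_real q * b" "d \<noteq> 0" for w and p q d :: real
  proof -
    have "w = (of_real p * a + of_real q * b) / of_real d"
      using that by (metis nonzero_mult_div_cancel_left of_real_eq_0_iff)
    then show ?thesis by (simp add: add_divide_distrib)
  qed
  ultimately show ?thesis
    using assms by blast
qed

lemma real_independent_iff:
  "(\<forall>s t. of_real s * a + of_real t * b = 0 \<longrightarrow> s = 0 \<and> t = 0) \<longleftrightarrow> Im (cnj a * b) \<noteq> 0"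
proof
  assume ind: "\<forall>s t. of_real s * a + of_real t * b = 0 \<longrightarrow> s = 0 \<and> t = (0::real)"
  show "Im (cnj a * b) \<noteq> 0"
  proof
    assume "Im (cnj a * b) = 0"
    then have eq: "Re a * Im b = Im a * Re b" by (simp add: algebra_simps)
    have "of_real (Re b) * a + of_real (- Re a) * b = 0" "of_real (Im b) * a + of_real (- Im a) * b = 0"
      using eq by (simp_all add: complex_eq_iff algebra_simps)
    with ind have "Re a = 0" "Im a = 0"
      by (metis neg_equal_0_iff_equal)+
    then have "of_real 1 * a + of_real 0 * b = 0" by (simp add: complex_eq_iff)
    with ind show False by (metis zero_neq_one)
  qed
next
  assume ne: "Im (cnj a * b) \<noteq> 0"
  show "\<forall>s t. of_real s * a + of_real t * b = 0 \<longrightarrow> s = 0 \<and> t = (0::real)"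
  proof (intro allI impI)
    fix s t :: real
    assume eq: "of_real s * a + of_real t * b = 0"
    have "t * Im (cnj a * b) = Im (cnj a * (of_real s * a + of_real t * b))"
      "s * Im (cnj a * b) = Im (cnj (of_real s * a + of_real t * b) * b)"
      by (simp_all add: algebra_simps)
    then have "t * Im (cnj a * b) = 0" "s * Im (cnj a * b) = 0"
      unfolding eq by simp_all
    with ne show "s = 0 \<and> t = 0"
      by (simp only: mult_eq_0_iff) simp
  qed
qed

lemma additive_subgroup_of_int_mult:
  fixes \<Gamma> :: "complex set"
  assumes "0 \<in> \<Gamma>" "\<forall>x\<in>\<Gamma>. \<forall>y\<in>\<Gamma>. x - y \<in> \<Gamma>" "x \<in> \<Gamma>"
  shows "of_int m * x \<in> \<Gamma>"
proof (induction m rule: int_induct[where k=0])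
  case base
  then show ?case using assms by simp
next
  case (step1 i)
  have "of_int i * x - (0 - x) \<in> \<Gamma>"
    using assms step1 by blast
  then show ?case by (simp add: algebra_simps)
next
  case (step2 i)
  then have "of_int i * x - x \<in> \<Gamma>"
    using assms by blast
  then show ?case by (simp add: algebra_simps)
qed

text \<open>In a group, isolation of the origin is a uniform statement: any two elements are at least a fixed distance
apart, so only finitely many lie in a given ball.\<close>

lemma discrete_subgroup_has_shortest:
  fixes \<Gamma> P :: "complex set"
  assumes grp: "0 \<in> \<Gamma>" "\<forall>x\<in>\<Gamma>. \<forall>y\<in>\<Gamma>. x - y \<in> \<Gamma>"
    and "discrete \<Gamma>" and P: "P \<subseteq> \<Gamma>" "P \<noteq> {}"
  shows "\<exists>x\<in>P. \<forall>y\<in>P. norm x \<le> norm y"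
proof -
  have "0 isolated_in \<Gamma>"
    using assms by (simp add: discrete_def)
  then obtain T where T: "open T" "T \<inter> \<Gamma> = {0}"
    by (auto simp: isolated_in_def)
  then obtain e where e: "e > 0" "ball 0 e \<subseteq> T"
    by (metis Int_iff insertI1 open_contains_ball)
  have "uniform_discrete \<Gamma>"
    unfolding uniform_discrete_def
  proof (intro exI[of _ e] conjI ballI impI)
    fix x y assume "x \<in> \<Gamma>" "y \<in> \<Gamma>" "dist x y < e"
    then have "x - y \<in> T \<inter> \<Gamma>"
      using e grp by (auto simp: dist_norm norm_minus_commute subset_iff)
    then show "x = y" using T by simp
  qed (use e in auto)
  obtain x0 where x0: "x0 \<in> P" using P by blast
  define Q where "Q = {y \<in> P. norm y \<le> norm x0}"
  have "uniform_discrete Q"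
    using \<open>uniform_discrete \<Gamma>\<close> P unfolding uniform_discrete_def Q_def by blast
  moreover have "bounded Q"
    by (rule boundedI[of _ "norm x0"]) (simp add: Q_def)
  ultimately have "finite Q"
    by (simp add: uniform_discrete_finite_iff [symmetric])
  moreover have "Q \<noteq> {}" using x0 by (auto simp: Q_def)
  ultimately have "arg_min_on norm Q \<in> Q" "\<And>y. y \<in> Q \<Longrightarrow> norm (arg_min_on norm Q) \<le> norm y"
    by (simp_all add: arg_min_if_finite(1) arg_min_least)
  then show ?thesis
    by (intro bexI[of _ "arg_min_on norm Q"]) (force simp: Q_def)+
qed

text \<open>If \<open>\<Gamma>\<close> were orthogonal to \<open>v\<close>, the function \<open>Re (z * cnj v)\<close> would descend to the quotient, where it would be
continuous and unbounded; its sublevel sets \<open>W n\<close> contradict compactness.\<close>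

lemma uniform_lattice_not_in_line:
  assumes \<Gamma>: "uniform_lattice \<Gamma>" and "v \<noteq> 0"
  obtains \<gamma> where "\<gamma> \<in> \<Gamma>" "Re (\<gamma> * cnj v) \<noteq> 0"
proof (rule ccontr)
  assume "\<not> thesis"
  with that have perp: "\<And>\<gamma>. \<gamma> \<in> \<Gamma> \<Longrightarrow> Re (\<gamma> * cnj v) = 0" by blast
  define W where "W = (\<lambda>n::nat. {z. \<bar>Re (z * cnj v)\<bar> < real n})"
  have sat: "coset_of \<Gamma> z \<in> coset_of \<Gamma> ` W n \<longleftrightarrow> z \<in> W n" for z n
  proof
    assume "coset_of \<Gamma> z \<in> coset_of \<Gamma> ` W n"
    then obtain z' where z': "z' \<in> W n" "coset_of \<Gamma> z = coset_of \<Gamma> z'" by blast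
    have "z \<in> coset_of \<Gamma> z"
      using \<Gamma> by (force simp: coset_of_def uniform_lattice_def)
    then obtain \<gamma> where "\<gamma> \<in> \<Gamma>" "z = z' + \<gamma>"
      using z' by (auto simp: coset_of_def)
    then show "z \<in> W n"
      using z' perp[of \<gamma>] by (simp add: W_def algebra_simps)
  qed auto
  have "openin (quotient_top \<Gamma>) (coset_of \<Gamma> ` W n)" for n
  proof -
    have "coset_of \<Gamma> -` (coset_of \<Gamma> ` W n) = W n"
      using sat by auto
    moreover have "open (W n)"
      unfolding W_def by (intro open_Collect_less continuous_intros)
    ultimately show ?thesis
      by (auto simp: openin_quotient_top)
  qed
  moreover have "topspace (quotient_top \<Gamma>) \<subseteq> (\<Union>n. coset_of \<Gamma> ` W n)"
  proof
    fix U assume "U \<in> topspace (quotient_top \<Gamma>)"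
    then obtain z where z: "U = coset_of \<Gamma> z"
      by (metis (no_types, lifting) openin_quotient_top openin_topspace rangeE subsetD)
    obtain n :: nat where "\<bar>Re (z * cnj v)\<bar> < real n"
      using reals_Archimedean2 by blast
    then show "U \<in> (\<Union>n. coset_of \<Gamma> ` W n)"
      using z by (auto simp: W_def)
  qed
  moreover have "compactin (quotient_top \<Gamma>) (topspace (quotient_top \<Gamma>))"
    using \<Gamma> by (simp add: uniform_lattice_def compact_space_def)
  ultimately obtain \<F> where \<F>: "finite \<F>" "\<F> \<subseteq> range (\<lambda>n. coset_of \<Gamma> ` W n)"
    "topspace (quotient_top \<Gamma>) \<subseteq> \<Union>\<F>"
    unfolding compactin_def by (metis (no_types, lifting) rangeE)
  then obtain I where I: "finite I" "\<F> = (\<lambda>n. coset_of \<Gamma> ` W n) ` I"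
    by (meson finite_subset_image)
  obtain N where N: "\<And>n. n \<in> I \<Longrightarrow> n \<le> N"
    using I(1) by (meson finite_nat_set_iff_bounded_le)
  define z where "z = of_real (real N / (norm v)\<^sup>2) * v"
  have "coset_of \<Gamma> -` range (coset_of \<Gamma>) = UNIV"
    by auto
  then have "openin (quotient_top \<Gamma>) (range (coset_of \<Gamma>))"
    by (simp add: openin_quotient_top)
  then have "coset_of \<Gamma> z \<in> topspace (quotient_top \<Gamma>)"
    using openin_subset by blast
  then have "coset_of \<Gamma> z \<in> (\<Union>n\<in>I. coset_of \<Gamma> ` W n)"
    using \<F>(3) I(2) by blast
  then obtain n where n: "n \<in> I" "z \<in> W n"
    unfolding UN_iff sat by blast
  have "z * cnj v = of_real (real N)"
    using \<open>v \<noteq> 0\<close> by (simp add: z_def complex_norm_square [symmetric] mult.assoc del: of_real_power)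
  then have "Re (z * cnj v) = real N"
    by (simp only: Re_complex_of_real)
  then show False
    using n(2) N[OF n(1)] unfolding W_def mem_Collect_eq by simp
qed

text \<open>Reduction theory: a shortest nonzero vector \<open>a\<close>, together with a shortest vector \<open>b\<close> off the line of \<open>a\<close>,
generates. Subtracting the nearest integral combination from a lattice vector leaves coordinates of size at most
\<open>1/2\<close>, and such a vector is too short to be anything but \<open>0\<close>.\<close>

lemma uniform_lattice_has_cell:
  assumes \<Gamma>: "uniform_lattice \<Gamma>"
  shows "\<exists>D. fundamental_cell \<Gamma> D"
proof -
  have grp: "0 \<in> \<Gamma>" "\<forall>x\<in>\<Gamma>. \<forall>y\<in>\<Gamma>. x - y \<in> \<Gamma>" and disc: "discrete \<Gamma>"
    using \<Gamma> by (auto simp: uniform_lattice_def)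
  note mult = additive_subgroup_of_int_mult[OF grp]
  obtain \<gamma>1 where \<gamma>1: "\<gamma>1 \<in> \<Gamma>" "Re (\<gamma>1 * cnj 1) \<noteq> 0"
    by (rule uniform_lattice_not_in_line[OF \<Gamma> one_neq_zero])
  then have "\<Gamma> - {0} \<noteq> {}" by auto
  then obtain a where a: "a \<in> \<Gamma>" "a \<noteq> 0" and a_min: "\<And>y. y \<in> \<Gamma> \<Longrightarrow> y \<noteq> 0 \<Longrightarrow> norm a \<le> norm y"
    using discrete_subgroup_has_shortest[OF grp disc, of "\<Gamma> - {0}"] by auto
  have "\<i> * a \<noteq> 0"
    using a by simp
  then obtain \<gamma>2 where \<gamma>2: "\<gamma>2 \<in> \<Gamma>" "Re (\<gamma>2 * cnj (\<i> * a)) \<noteq> 0"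
    by (rule uniform_lattice_not_in_line[OF \<Gamma>])
  then have "{x \<in> \<Gamma>. Im (cnj a * x) \<noteq> 0} \<noteq> {}"
    by (auto simp: algebra_simps)
  then obtain b where b: "b \<in> \<Gamma>" "Im (cnj a * b) \<noteq> 0"
    and b_min: "\<And>y. y \<in> \<Gamma> \<Longrightarrow> Im (cnj a * y) \<noteq> 0 \<Longrightarrow> norm b \<le> norm y"
    using discrete_subgroup_has_shortest[OF grp disc, of "{x \<in> \<Gamma>. Im (cnj a * x) \<noteq> 0}"]
    by (auto simp del: complex_cnj_cnj times_complex.sel)
  have "norm a \<le> norm b"
    using b by (intro a_min) auto
  \<comment> \<open>Strict because \<open>a\<close> and \<open>b\<close> are not parallel; this makes the reduced vector below strictly shorter than \<open>b\<close>.\<close>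
  have angle: "\<bar>Re (cnj a * b)\<bar> < (norm b)\<^sup>2"
  proof -
    have "(Re (cnj a * b))\<^sup>2 < (norm (cnj a * b))\<^sup>2"
      using b by (simp add: cmod_power2)
    then have "\<bar>Re (cnj a * b)\<bar> < norm (cnj a * b)"
      by (metis abs_le_square_iff abs_norm_cancel not_less)
    also have "\<dots> \<le> norm b * norm b"
      using \<open>norm a \<le> norm b\<close> by (simp add: norm_mult mult_right_mono)
    finally show ?thesis by (simp add: power2_eq_square)
  qed
  have span: "\<exists>m n. x = of_int m * a + of_int n * b" if x: "x \<in> \<Gamma>" for x
  proof -
    define s where "s = Im (cnj x * b) / Im (cnj a * b)"
    define t where "t = Im (cnj a * x) / Im (cnj a * b)"
    define s' where "s' = s - of_int (round s)"
    define t' where "t' = t - of_int (round t)"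
    define y where "y = x - of_int (round s) * a - of_int (round t) * b"
    have xst: "x = of_real s * a + of_real t * b"
      unfolding s_def t_def by (rule real_coordinates[OF b(2)])
    have y: "y = of_real s' * a + of_real t' * b"
      unfolding y_def s'_def t'_def by (subst xst) (simp add: algebra_simps)
    have "y \<in> \<Gamma>"
      unfolding y_def by (intro grp(2)[rule_format] x mult a b)
    have s't': "\<bar>s'\<bar> \<le> 1/2" "\<bar>t'\<bar> \<le> 1/2"
      unfolding s'_def t'_def using of_int_round_abs_le by (metis abs_minus_commute)+
    \<comment> \<open>Otherwise \<open>y\<close> is off the line of \<open>a\<close> and shorter than \<open>b\<close>.\<close>
    have "t' = 0"
    proof (rule ccontr)
      assume "t' \<noteq> 0"
      moreover have "Im (cnj a * y) = t' * Im (cnj a * b)"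
        unfolding y by (simp add: algebra_simps)
      ultimately have "norm b \<le> norm y"
        using b_min[OF \<open>y \<in> \<Gamma>\<close>] b by simp
      then have "(norm b)\<^sup>2 \<le> (norm y)\<^sup>2"
        by (simp add: power_mono)
      also have "(norm y)\<^sup>2 = s'\<^sup>2 * (norm a)\<^sup>2 + t'\<^sup>2 * (norm b)\<^sup>2 + 2 * (s' * t') * Re (cnj a * b)"
        unfolding y cmod_power2 by (simp add: power2_eq_square algebra_simps)
      also have "\<dots> \<le> (1/4) * (norm b)\<^sup>2 + (1/4) * (norm b)\<^sup>2 + (1/2) * \<bar>Re (cnj a * b)\<bar>"
      proof -
        have sq: "s'\<^sup>2 \<le> 1/4" "t'\<^sup>2 \<le> 1/4"
          using power_mono[OF s't'(1), of 2] power_mono[OF s't'(2), of 2] by (simp_all add: power2_eq_square)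
        have ab: "(norm a)\<^sup>2 \<le> (norm b)\<^sup>2"
          using \<open>norm a \<le> norm b\<close> by (simp add: power_mono)
        have "\<bar>s'\<bar> * \<bar>t'\<bar> \<le> (1/2) * (1/2)"
          by (intro mult_mono s't') auto
        then have "2 * (\<bar>s'\<bar> * \<bar>t'\<bar>) * \<bar>Re (cnj a * b)\<bar> \<le> (1/2) * \<bar>Re (cnj a * b)\<bar>"
          by (intro mult_right_mono) auto
        moreover have "2 * (s' * t') * Re (cnj a * b) \<le> 2 * (\<bar>s'\<bar> * \<bar>t'\<bar>) * \<bar>Re (cnj a * b)\<bar>"
          using abs_ge_self[of "2 * (s' * t') * Re (cnj a * b)"] by (simp only: abs_mult abs_numeral)
        moreover have "s'\<^sup>2 * (norm a)\<^sup>2 \<le> (1/4) * (norm b)\<^sup>2"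
          using sq ab by (intro mult_mono) auto
        moreover have "t'\<^sup>2 * (norm b)\<^sup>2 \<le> (1/4) * (norm b)\<^sup>2"
          using sq by (intro mult_right_mono) auto
        ultimately show ?thesis by linarith
      qed
      also have "\<dots> < (norm b)\<^sup>2"
        using angle by simp
      finally show False by simp
    qed
    have "y = 0"
    proof (rule ccontr)
      assume "y \<noteq> 0"
      then have "norm a \<le> norm y"
        using a_min \<open>y \<in> \<Gamma>\<close> by blast
      also have "\<dots> = \<bar>s'\<bar> * norm a"
        by (simp add: y \<open>t' = 0\<close> norm_mult)
      also have "\<dots> \<le> (1/2) * norm a"
        using s't' by (intro mult_right_mono) auto
      finally show False using a by simp
    qed
    then have "x = of_int (round s) * a + of_int (round t) * b"
      by (simp add: y_def algebra_simps)
    then show ?thesis by blast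
  qed
  have mem: "of_int m * a + of_int n * b \<in> \<Gamma>" for m n
  proof -
    have "of_int m * a - of_int (- n) * b \<in> \<Gamma>"
      using grp(2) mult[OF a(1)] mult[OF b(1)] by blast
    then show ?thesis by simp
  qed
  have "\<Gamma> = {of_int m * a + of_int n * b | m n. True}"
    using span mem by auto
  moreover have "\<forall>s t. of_real s * a + of_real t * b = 0 \<longrightarrow> s = 0 \<and> t = (0::real)"
    using b by (simp add: real_independent_iff)
  ultimately show ?thesis
    unfolding fundamental_cell_def by blast
qed

text \<open>The determinant formula for the measure of a linear image lives on \<open>real ^ 2\<close>; this identification carries it
over to the complex plane.\<close>

definition plane_of_vec :: "real ^ 2 \<Rightarrow> complex" where
  "plane_of_vec x = Complex (x $ 1) (x $ 2)"

lemma plane_of_vec_measurable: "plane_of_vec \<in> borel_measurable borel"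
  unfolding plane_of_vec_def Complex_eq
  by (intro borel_measurable_continuous_onI continuous_intros)

lemma lborel_complex_eq_distr: "(lborel :: complex measure) = distr lborel borel plane_of_vec"
proof (rule lborel_eqI)
  fix l u :: complex
  assume le: "\<And>b. b \<in> Basis \<Longrightarrow> l \<bullet> b \<le> u \<bullet> b"
  from le[of 1] le[of \<i>] have le': "Re l \<le> Re u" "Im l \<le> Im u"
    by (simp_all add: Basis_complex_def)
  define l' u' :: "real^2" where "l' = vector [Re l, Im l]" and "u' = vector [Re u, Im u]"
  have pre: "plane_of_vec -` box l u = box l' u'"
    by (auto simp: plane_of_vec_def mem_box_cart forall_2 l'_def u'_def in_box_complex_iff)
  have "emeasure (distr lborel borel plane_of_vec) (box l u) = emeasure lborel (box l' u')"
    using plane_of_vec_measurable by (simp add: emeasure_distr pre)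
  also have "\<dots> = emeasure lborel (cbox l' u')"
    using le' by (subst emeasure_lborel_box_eq, subst emeasure_lborel_cbox_eq) simp
  also have "\<dots> = ennreal (measure lborel (cbox l' u'))"
    by (rule emeasure_eq_ennreal_measure) (use emeasure_lborel_cbox_finite[of l' u'] in simp)
  also have "measure lborel (cbox l' u') = (Re u - Re l) * (Im u - Im l)"
    using le' by (subst content_cbox_cart) (simp_all add: interval_ne_empty_cart forall_2 UNIV_2 l'_def u'_def)
  finally show "emeasure (distr lborel borel plane_of_vec) (box l u) = (\<Prod>b\<in>Basis. (u - l) \<bullet> b)"
    by (simp add: Basis_complex_def)
qed simp

lemma measure_parallelogram:
  assumes ab: "Im (cnj a * b) \<noteq> 0"
  defines "D \<equiv> {of_real s * a + of_real t * b | s t. 0 \<le> s \<and> s < 1 \<and> 0 \<le> t \<and> t < 1}"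
  shows "measure lebesgue D = \<bar>Im (cnj a * b)\<bar>"
proof -
  define T :: "real^2 \<Rightarrow> real^2" where
    "T x = vector [x $ 1 * Re a + x $ 2 * Re b, x $ 1 * Im a + x $ 2 * Im b]" for x
  define Q :: "(real^2) set" where "Q = {x. 0 \<le> x $ 1 \<and> x $ 1 < 1 \<and> 0 \<le> x $ 2 \<and> x $ 2 < 1}"
  have T: "plane_of_vec (T x) = of_real (x $ 1) * a + of_real (x $ 2) * b" for x
    by (simp add: plane_of_vec_def T_def complex_eq_iff)
  have linT: "linear T"
    by (rule linearI) (simp_all add: T_def vec_eq_iff forall_2 algebra_simps)
  have inj: "plane_of_vec x = plane_of_vec y \<longleftrightarrow> x = y" for x y
    by (simp add: plane_of_vec_def vec_eq_iff forall_2)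
  have D_pre: "plane_of_vec -` D = T ` Q"
  proof (intro equalityI subsetI)
    fix x assume "x \<in> plane_of_vec -` D"
    then obtain s t where st: "plane_of_vec x = of_real s * a + of_real t * b" "0 \<le> s" "s < 1" "0 \<le> t" "t < 1"
      by (auto simp: D_def)
    have "plane_of_vec x = plane_of_vec (T (vector [s, t]))"
      by (simp add: T st)
    then have "x = T (vector [s, t])" by (simp add: inj)
    then show "x \<in> T ` Q" using st by (auto simp: Q_def)
  next
    fix y assume "y \<in> T ` Q"
    then obtain x where "y = T x" "x \<in> Q" by blast
    then show "y \<in> plane_of_vec -` D"
      unfolding \<open>y = T x\<close> D_def Q_def vimage_eq mem_Collect_eq T by blast
  qed
  have D_eq: "D = {z. 0 \<le> Im (cnj z * b) / Im (cnj a * b) \<and> Im (cnj z * b) / Im (cnj a * b) < 1 \<and>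
     0 \<le> Im (cnj a * z) / Im (cnj a * b) \<and> Im (cnj a * z) / Im (cnj a * b) < 1}" (is "D = ?D'")
  proof (intro equalityI subsetI)
    fix z assume "z \<in> ?D'"
    then show "z \<in> D"
      using real_coordinates[OF ab, of z] unfolding D_def by blast
  next
    fix z assume "z \<in> D"
    then obtain s t where z: "z = of_real s * a + of_real t * b" "0 \<le> s" "s < 1" "0 \<le> t" "t < 1"
      by (auto simp: D_def)
    have "Im (cnj a * z) = t * Im (cnj a * b)" "Im (cnj z * b) = s * Im (cnj a * b)"
      by (simp_all add: z(1) algebra_simps)
    then have "Im (cnj a * z) / Im (cnj a * b) = t" "Im (cnj z * b) / Im (cnj a * b) = s"
      using ab by (metis nonzero_mult_div_cancel_right)+
    then show "z \<in> ?D'"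
      unfolding mem_Collect_eq using z by simp
  qed
  have D_borel: "D \<in> sets borel"
  proof -
    have [measurable]: "(\<lambda>z. Im (cnj z * b) / Im (cnj a * b)) \<in> borel_measurable borel"
      "(\<lambda>z. Im (cnj a * z) / Im (cnj a * b)) \<in> borel_measurable borel"
      by (intro borel_measurable_continuous_onI continuous_intros ballI ab)+
    have "{z \<in> space borel. 0 \<le> Im (cnj z * b) / Im (cnj a * b) \<and> Im (cnj z * b) / Im (cnj a * b) < 1 \<and>
     0 \<le> Im (cnj a * z) / Im (cnj a * b) \<and> Im (cnj a * z) / Im (cnj a * b) < 1} \<in> sets borel"
      by measurable
    then show ?thesis
      unfolding D_eq by simp
  qed
  have Q_meas: "Q \<in> sets borel"
    unfolding Q_def by measurable
  have Qbox: "box 0 1 \<subseteq> Q" "Q \<subseteq> cbox 0 1"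
    by (auto simp: Q_def mem_box_cart forall_2)
  have c: "measure lebesgue (cbox 0 (1::real^2)) = 1" "measure lebesgue (box 0 (1::real^2)) = 1"
  proof -
    have "measure lborel (cbox 0 (1::real^2)) = 1"
      by (simp add: content_cbox_if_cart interval_eq_empty_cart)
    moreover have "measure lborel (box 0 (1::real^2)) = measure lborel (cbox 0 (1::real^2))"
      by (simp only: measure_lborel_box_eq measure_lborel_cbox_eq)
    ultimately show "measure lebesgue (cbox 0 (1::real^2)) = 1" "measure lebesgue (box 0 (1::real^2)) = 1"
      by simp_all
  qed
  have Q_lm: "Q \<in> lmeasurable"
  proof (rule bounded_set_imp_lmeasurable)
    show "bounded Q"
      using Qbox(2) bounded_cbox bounded_subset by blast
    show "Q \<in> sets lebesgue"
      using Q_meas by simp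
  qed
  have "measure lebesgue Q = 1"
  proof (rule antisym)
    show "measure lebesgue Q \<le> 1"
      using measure_mono_fmeasurable[OF Qbox(2), of lebesgue] Q_lm c by (simp add: fmeasurableD)
    show "1 \<le> measure lebesgue Q"
      using measure_mono_fmeasurable[OF Qbox(1), of lebesgue] Q_lm c by simp
  qed
  then have TQ: "measure lebesgue (T ` Q) = \<bar>det (matrix T)\<bar>"
    using measure_linear_image[OF linT Q_lm] by simp
  have det: "det (matrix T) = Im (cnj a * b)"
    by (simp add: det_2 matrix_def T_def axis_def algebra_simps)
  have "measure lebesgue D = measure lborel D"
    using D_borel by simp
  also have "\<dots> = measure lborel (plane_of_vec -` D)"
    using plane_of_vec_measurable D_borel by (subst lborel_complex_eq_distr) (simp add: measure_distr)
  also have "\<dots> = measure lebesgue (T ` Q)"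
  proof -
    have "plane_of_vec -` D \<in> sets borel"
      using measurable_sets[OF plane_of_vec_measurable D_borel] by simp
    then show ?thesis by (simp add: D_pre)
  qed
  finally show ?thesis
    using TQ det by simp
qed

text \<open>The chosen cell comes with some basis; exchanging the two vectors makes it positively oriented, and
the area is then its determinant.\<close>

lemma lattice_oriented_basis:
  assumes "uniform_lattice \<Gamma>"
  obtains a b where "Im (cnj a * b) > 0" "\<Gamma> = {of_int m * a + of_int n * b | m n. True}"
    "lattice_area \<Gamma> = Im (cnj a * b)"
proof -
  have "fundamental_cell \<Gamma> (SOME D. fundamental_cell \<Gamma> D)"
    using uniform_lattice_has_cell[OF assms] by (rule someI_ex)
  then obtain a b where ab: "Im (cnj a * b) \<noteq> 0" "\<Gamma> = {of_int m * a + of_int n * b | m n. True}"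
    and D: "(SOME D. fundamental_cell \<Gamma> D) = {of_real s * a + of_real t * b | s t. 0 \<le> s \<and> s < 1 \<and> 0 \<le> t \<and> t < 1}"
    unfolding fundamental_cell_def real_independent_iff by blast
  have area: "lattice_area \<Gamma> = \<bar>Im (cnj a * b)\<bar>"
    unfolding lattice_area_def D by (rule measure_parallelogram[OF ab(1)])
  show ?thesis
  proof (cases "Im (cnj a * b) > 0")
    case True
    with ab area that show ?thesis by simp
  next
    case False
    have "\<Gamma> = {of_int m * b + of_int n * a | m n. True}"
      unfolding ab(2) by (metis (no_types, opaque_lifting) add.commute)
    then show ?thesis
      using that[of b a] False ab area by (simp add: algebra_simps)
  qed
qed

section \<open>Fourier series of periodic entire functions\<close>

text \<open>The characters of the circle of length \<open>1\<close>, extended to entire functions.\<close>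

definition fchar :: "int \<Rightarrow> complex \<Rightarrow> complex" where
  "fchar m w = exp (2 * of_real pi * \<i> * of_int m * w)"

lemma fchar_add: "fchar (m + n) w = fchar m w * fchar n w" "fchar m (w + v) = fchar m w * fchar m v"
  unfolding fchar_def exp_add [symmetric] by (auto intro!: arg_cong[of _ _ exp] simp: algebra_simps)

lemma fchar_0 [simp]: "fchar 0 w = 1"
  by (simp add: fchar_def)

lemma fchar_1 [simp]: "fchar m 1 = 1"
  using exp_integer_2pi[of "of_int m"] by (simp add: fchar_def mult_ac)

lemma fchar_at_0 [simp]: "fchar m 0 = 1"
  by (simp add: fchar_def)

lemma fchar_holomorphic [holomorphic_intros]:
  "f holomorphic_on S \<Longrightarrow> (\<lambda>w. fchar m (f w)) holomorphic_on S"
  unfolding fchar_def by (intro holomorphic_intros)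

lemma fchar_continuous [continuous_intros]:
  fixes f :: "'a::topological_space \<Rightarrow> complex"
  shows "continuous_on S f \<Longrightarrow> continuous_on S (\<lambda>x. fchar m (f x))"
  unfolding fchar_def by (intro continuous_intros)

lemma norm_fchar: "norm (fchar m w) = exp (- 2 * pi * of_int m * Im w)"
  by (simp add: fchar_def norm_exp_eq_Re)

definition fourier_coeff :: "(complex \<Rightarrow> complex) \<Rightarrow> int \<Rightarrow> complex" where
  "fourier_coeff f m = integral {0..1} (\<lambda>x::real. f (of_real x) * fchar (- m) (of_real x))"

text \<open>With a primitive \<open>P\<close>, the integral is \<open>P (a + 1) - P a\<close>, whose derivative in \<open>a\<close> vanishes by periodicity.
The shift may be complex, as in a change of contour.\<close>

lemma periodic_integral_shift:
  fixes f :: "complex \<Rightarrow> complex"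
  assumes f: "f holomorphic_on UNIV" and per: "\<And>w. f (w + 1) = f w"
  shows "integral {0..1} (\<lambda>x::real. f (a + of_real x)) = integral {0..1} (\<lambda>x::real. f (of_real x))"
proof -
  obtain P where P: "\<And>w. (P has_field_derivative f w) (at w)"
    using holomorphic_convex_primitive'[OF convex_UNIV open_UNIV f] by auto
  have int: "integral {0..1} (\<lambda>x::real. f (b + of_real x)) = P (b + 1) - P b" for b
  proof -
    have "((\<lambda>x::real. f (b + of_real x)) has_integral P (b + of_real 1) - P (b + of_real 0)) {0..1}"
    proof (rule fundamental_theorem_of_calculus)
      fix x :: real
      have "((\<lambda>w. P (b + w)) has_field_derivative f (b + of_real x) * 1) (at (of_real x))"
        by (rule DERIV_chain2[OF P]) (auto intro!: derivative_eq_intros)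
      then have "((\<lambda>w. P (b + w)) has_field_derivative f (b + of_real x)) (at (of_real x))"
        by simp
      then show "((\<lambda>x. P (b + of_real x)) has_vector_derivative f (b + of_real x)) (at x within {0..1})"
        using has_vector_derivative_real_field by blast
    qed simp
    then show ?thesis by (simp add: integral_unique)
  qed
  have "((\<lambda>b. P (b + 1) - P b) has_field_derivative 0) (at b within UNIV)" for b
  proof -
    have "((\<lambda>b. P (b + 1)) has_field_derivative f (b + 1) * 1) (at b)"
      by (rule DERIV_chain2[OF P]) (auto intro!: derivative_eq_intros)
    from DERIV_diff[OF this P[of b]] show ?thesis
      by (simp add: per)
  qed
  then obtain c where "\<And>b. P (b + 1) - P b = c"
    using has_field_derivative_zero_constant[OF convex_UNIV, of "\<lambda>b. P (b + 1) - P b"] by auto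
  then have "P (a + 1) - P a = P (0 + 1) - P 0" by metis
  then show ?thesis
    using int[of a] int[of 0] by simp
qed

definition orthogonal_to_fchars :: "(real \<Rightarrow> complex) \<Rightarrow> bool" where
  "orthogonal_to_fchars F \<longleftrightarrow> continuous_on {0..1} F \<and>
     (\<forall>m. integral {0..1} (\<lambda>x. F x * fchar m (of_real x)) = 0)"

lemma orthogonal_to_fchars_has_integral:
  assumes "orthogonal_to_fchars F"
  shows "((\<lambda>x. F x * fchar m (of_real x)) has_integral 0) {0..1}"
proof -
  have "continuous_on {0..1} (\<lambda>x. F x * fchar m (of_real x))"
    using assms by (intro continuous_intros) (simp_all add: orthogonal_to_fchars_def)
  then have "((\<lambda>x. F x * fchar m (of_real x)) has_integral
      integral {0..1} (\<lambda>x. F x * fchar m (of_real x))) {0..1}"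
    by (intro integrable_integral integrable_continuous_real)
  then show ?thesis
    using assms by (simp add: orthogonal_to_fchars_def)
qed

lemma orthogonal_to_fcharsI:
  assumes "continuous_on {0..1} F"
    and "\<And>m. ((\<lambda>x. F x * fchar m (of_real x)) has_integral 0) {0..1}"
  shows "orthogonal_to_fchars F"
  using assms by (simp add: orthogonal_to_fchars_def integral_unique)

text \<open>Multiplication by \<open>fchar 1\<close> or \<open>fchar (- 1)\<close> only permutes the orthogonality conditions.\<close>

lemma orthogonal_to_fchars_trig:
  assumes "orthogonal_to_fchars F"
  shows "orthogonal_to_fchars (\<lambda>x. F x * (a + b * fchar 1 (of_real x) + c * fchar (- 1) (of_real x)))"
proof (rule orthogonal_to_fcharsI)
  have "continuous_on {0..1} F"
    using assms by (simp add: orthogonal_to_fchars_def)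
  then show "continuous_on {0..1} (\<lambda>x. F x * (a + b * fchar 1 (of_real x) + c * fchar (- 1) (of_real x)))"
    by (intro continuous_intros)
  fix m
  have "((\<lambda>x. a * (F x * fchar m (of_real x)) + b * (F x * fchar (1 + m) (of_real x))
      + c * (F x * fchar (- 1 + m) (of_real x))) has_integral (a * 0 + b * 0 + c * 0)) {0..1}"
    by (intro has_integral_add has_integral_mult_right orthogonal_to_fchars_has_integral assms)
  moreover have "F x * (a + b * fchar 1 (of_real x) + c * fchar (- 1) (of_real x)) * fchar m (of_real x)
    = a * (F x * fchar m (of_real x)) + b * (F x * fchar (1 + m) (of_real x))
      + c * (F x * fchar (- 1 + m) (of_real x))" for x
    unfolding fchar_add by (simp add: algebra_simps)
  ultimately show "((\<lambda>x. F x * (a + b * fchar 1 (of_real x) + c * fchar (- 1) (of_real x)) * fchar m (of_real x))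
      has_integral 0) {0..1}"
    by simp
qed

lemma orthogonal_to_fchars_add:
  assumes "orthogonal_to_fchars F" "orthogonal_to_fchars G"
  shows "orthogonal_to_fchars (\<lambda>x. F x + c * G x)"
proof (rule orthogonal_to_fcharsI)
  show "continuous_on {0..1} (\<lambda>x. F x + c * G x)"
    using assms by (intro continuous_intros) (simp_all add: orthogonal_to_fchars_def)
  fix m
  have "((\<lambda>x. F x * fchar m (of_real x) + c * (G x * fchar m (of_real x))) has_integral (0 + c * 0)) {0..1}"
    by (intro has_integral_add has_integral_mult_right orthogonal_to_fchars_has_integral assms)
  then show "((\<lambda>x. (F x + c * G x) * fchar m (of_real x)) has_integral 0) {0..1}"
    by (simp add: algebra_simps)
qed

text \<open>The quantifier over \<open>F\<close> is what makes products work: the second factor acts on a function that is already known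
to be orthogonal to all characters. A linear function on the circle is a combination of \<open>fchar 1\<close> and
\<open>fchar (- 1)\<close>.\<close>

lemma orthogonal_to_fchars_mult_polynomial:
  assumes "real_polynomial_function p" "orthogonal_to_fchars F"
  shows "orthogonal_to_fchars (\<lambda>x. F x * of_real (p (fchar 1 (of_real x))))"
  using assms
proof (induction arbitrary: F rule: real_polynomial_function.induct)
  case (linear f)
  define \<alpha> \<beta> where "\<alpha> = (f 1 - \<i> * f \<i>) / 2" and "\<beta> = (f 1 + \<i> * f \<i>) / 2"
  have "of_real (f z) = \<alpha> * z + \<beta> * cnj z" for z
  proof -
    have "f z = f (Re z *\<^sub>R 1 + Im z *\<^sub>R \<i>)"
      by (rule arg_cong[of _ _ f]) (simp add: complex_eq_iff)
    also have "\<dots> = Re z * f 1 + Im z * f \<i>"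
      using linear(1) by (simp only: bounded_linear.linear linear_add linear_scale real_scaleR_def)
    finally have "f z = Re z * f 1 + Im z * f \<i>" .
    then show ?thesis
      by (simp add: complex_eq_iff field_simps \<alpha>_def \<beta>_def)
  qed
  moreover have "cnj (fchar 1 (of_real x)) = fchar (- 1) (of_real x)" for x
    by (simp add: fchar_def exp_cnj)
  ultimately have "of_real (f (fchar 1 (of_real x))) = 0 + \<alpha> * fchar 1 (of_real x) + \<beta> * fchar (- 1) (of_real x)" for x
    by simp
  with orthogonal_to_fchars_trig[OF linear(2), of 0 \<alpha> \<beta>] show ?case
    by (simp only:)
next
  case (const c)
  then show ?case
    using orthogonal_to_fchars_trig[of F "of_real c" 0 0] by simp
next
  case (add f g)
  from orthogonal_to_fchars_add[OF add.IH(1)[OF add.prems] add.IH(2)[OF add.prems], of 1]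
  show ?case by (simp add: algebra_simps)
next
  case (mult f g)
  from mult.IH(2)[OF mult.IH(1)[OF mult.prems]]
  show ?case by (simp add: mult_ac)
qed

text \<open>The function on the circle is \<open>f\<close> composed with a logarithm. Across the cut of \<open>Ln\<close> one uses the branch
\<open>Ln (- z)\<close> shifted by half a period, which gives the same values because \<open>f\<close> is periodic.\<close>

lemma periodic_descends_to_circle:
  fixes f :: "complex \<Rightarrow> complex"
  assumes f: "continuous_on UNIV f" and per: "\<And>w. f (w + 1) = f w"
  obtains h where "continuous_on (sphere 0 1) h" "\<And>x::real. h (fchar 1 (of_real x)) = f (of_real x)"
proof -
  define L where "L = (\<lambda>z. Ln z / (2 * of_real pi * \<i>))"
  define h where "h = (\<lambda>z. f (L z))"
  have per_int: "f (w + of_int k) = f w" for w k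
  proof (induction k rule: int_induct[where k=0])
    case (step1 i)
    then show ?case using per[of "w + of_int i"] by (simp add: algebra_simps)
  next
    case (step2 i)
    then show ?case using per[of "w + of_int (i - 1)"] by (simp add: algebra_simps)
  qed simp
  have same: "f v = f w" if "fchar 1 v = fchar 1 w" for v w
  proof -
    have "exp (2 * of_real pi * \<i> * v) = exp (2 * of_real pi * \<i> * w)"
      using that by (simp add: fchar_def)
    then obtain n :: int where "2 * of_real pi * \<i> * v = 2 * of_real pi * \<i> * w + of_real (of_int (2 * n) * pi) * \<i>"
      unfolding exp_eq by blast
    then have "2 * of_real pi * \<i> * v = 2 * of_real pi * \<i> * (w + of_int n)"
      by (simp add: algebra_simps)
    then have "v = w + of_int n" by simp
    then show ?thesis using per_int by simp
  qed
  have charL: "fchar 1 (L z) = z" if "z \<noteq> 0" for z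
    using that by (simp add: fchar_def L_def)
  have h: "h (fchar 1 w) = f w" for w
    unfolding h_def by (rule same, rule charL) (simp add: fchar_def)
  have "isCont h z" if z: "z \<in> sphere 0 1" for z
  proof (cases "z \<in> \<real>\<^sub>\<le>\<^sub>0")
    case False
    then have "isCont L z"
      unfolding L_def by (auto intro!: continuous_intros)
    then show ?thesis
      unfolding h_def by (rule isCont_o2) (use f in \<open>simp add: continuous_on_eq_continuous_at\<close>)
  next
    case True
    have "z \<noteq> 0" using z by auto
    with True have nz: "- z \<notin> \<real>\<^sub>\<le>\<^sub>0"
      by (auto simp: complex_nonpos_Reals_iff complex_eq_iff)
    have eq: "h u = f (L (- u) + 1/2)" if "u \<noteq> 0" for u
      unfolding h_def
    proof (rule same)
      have "fchar 1 (1/2) = -1" by (simp add: fchar_def)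
      then show "fchar 1 (L u) = fchar 1 (L (- u) + 1/2)"
        using that by (simp add: fchar_add charL)
    qed
    have "isCont (\<lambda>u. L (- u) + 1/2) z"
      unfolding L_def using nz by (auto intro!: continuous_intros)
    then have "isCont (\<lambda>u. f (L (- u) + 1/2)) z"
      by (rule isCont_o2) (use f in \<open>simp add: continuous_on_eq_continuous_at\<close>)
    moreover have "eventually (\<lambda>u. h u = f (L (- u) + 1/2)) (nhds z)"
      by (rule eventually_mono[OF t1_space_nhds[OF \<open>z \<noteq> 0\<close>]]) (rule eq)
    ultimately show ?thesis
      by (simp add: isCont_cong)
  qed
  then have "continuous_on (sphere 0 1) h"
    by (simp add: continuous_at_imp_continuous_on)
  with h that show ?thesis by blast
qed

text \<open>By Stone--Weierstrass, polynomials in the real coordinates of the circle approximate the conjugate of \<open>\<theta>\<close>.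
Such polynomials times \<open>\<theta>\<close> integrate to \<open>0\<close>, so the integral of \<open>|\<theta>|\<^sup>2\<close> over a period is arbitrarily small.
Hence \<open>\<theta>\<close> vanishes on a segment, and by analytic continuation everywhere.\<close>

lemma periodic_fourier_unique:
  assumes hol: "\<theta> holomorphic_on UNIV" and per: "\<And>w. \<theta> (w + 1) = \<theta> w"
    and zero: "\<And>m. fourier_coeff \<theta> m = 0"
  shows "\<theta> w = 0"
proof -
  have cont: "continuous_on UNIV \<theta>"
    using hol holomorphic_on_imp_continuous_on by blast
  define F where "F = (\<lambda>x::real. \<theta> (of_real x))"
  have contF: "continuous_on {0..1} F"
    unfolding F_def by (rule continuous_on_compose2[OF cont]) (auto intro!: continuous_intros)
  have "orthogonal_to_fchars F"
    unfolding orthogonal_to_fchars_def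
  proof (intro conjI allI contF)
    fix m show "integral {0..1} (\<lambda>x. F x * fchar m (of_real x)) = 0"
      using zero[of "- m"] by (simp add: fourier_coeff_def F_def)
  qed
  obtain h where h: "continuous_on (sphere 0 1) h" "\<And>x::real. h (fchar 1 (of_real x)) = \<theta> (of_real x)"
    using periodic_descends_to_circle[OF cont per] by blast
  have "bounded (F ` {0..1})"
    by (rule compact_imp_bounded[OF compact_continuous_image[OF contF]]) simp
  then obtain M where "\<forall>z\<in>F ` {0..1}. norm z \<le> M"
    unfolding bounded_iff by blast
  then have M: "\<And>x. x \<in> {0..1} \<Longrightarrow> norm (F x) \<le> M"
    by blast
  have M0: "M \<ge> 0"
    by (rule order_trans[OF norm_ge_zero M[of 0]]) simp
  define I where "I = integral {0..1} (\<lambda>x. (norm (F x))\<^sup>2)"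
  have I0: "I \<ge> 0"
    unfolding I_def by (rule integral_nonneg) (auto intro!: integrable_continuous_real continuous_intros contF)
  have "I \<le> e" if e: "e > 0" for e
  proof -
    \<comment> \<open>The summand \<open>1\<close> covers the case \<open>M = 0\<close>.\<close>
    define d where "d = e / (M + 1)"
    have d: "d > 0" "d * M \<le> e"
      using e M0 by (simp_all add: d_def field_simps)
    have "continuous_on (sphere 0 1) (\<lambda>z. cnj (h z))"
      by (intro continuous_intros h)
    from Stone_Weierstrass_polynomial_function[OF compact_sphere this d(1)]
    obtain g where g: "polynomial_function g" "\<And>z. z \<in> sphere 0 1 \<Longrightarrow> norm (cnj (h z) - g z) < d"
      by blast
    have re: "real_polynomial_function (\<lambda>z. Re (g z))" "real_polynomial_function (\<lambda>z. Im (g z))"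
      using g(1)[unfolded polynomial_function_def, rule_format, OF bounded_linear_Re]
        g(1)[unfolded polynomial_function_def, rule_format, OF bounded_linear_Im]
      by (simp_all add: o_def)
    have "orthogonal_to_fchars (\<lambda>x. F x * of_real (Re (g (fchar 1 (of_real x)))) + \<i> * (F x * of_real (Im (g (fchar 1 (of_real x))))))"
      by (intro orthogonal_to_fchars_add orthogonal_to_fchars_mult_polynomial[OF re(1)]
          orthogonal_to_fchars_mult_polynomial[OF re(2)] \<open>orthogonal_to_fchars F\<close>)
    moreover have "F x * of_real (Re (g (fchar 1 (of_real x)))) + \<i> * (F x * of_real (Im (g (fchar 1 (of_real x)))))
      = F x * g (fchar 1 (of_real x))" for x
    proof -
      have "g (fchar 1 (of_real x)) = of_real (Re (g (fchar 1 (of_real x)))) + \<i> * of_real (Im (g (fchar 1 (of_real x))))"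
        by (rule complex_eq)
      then have "F x * g (fchar 1 (of_real x)) =
        F x * (of_real (Re (g (fchar 1 (of_real x)))) + \<i> * of_real (Im (g (fchar 1 (of_real x)))))"
        by (rule arg_cong)
      then show ?thesis
        by (simp add: algebra_simps)
    qed
    ultimately have orth: "orthogonal_to_fchars (\<lambda>x. F x * g (fchar 1 (of_real x)))"
      by simp
    then have "integral {0..1} (\<lambda>x. F x * g (fchar 1 (of_real x)) * fchar 0 (of_real x)) = 0"
      unfolding orthogonal_to_fchars_def by blast
    then have g0: "integral {0..1} (\<lambda>x. F x * g (fchar 1 (of_real x))) = 0"
      by simp
    have contg: "continuous_on {0..1} (\<lambda>x. F x * g (fchar 1 (of_real x)))"
      using orth by (simp add: orthogonal_to_fchars_def)
    have "complex_of_real I = integral {0..1} (\<lambda>x. complex_of_real ((norm (F x))\<^sup>2))"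
      unfolding I_def
      using integral_linear[OF integrable_continuous_real bounded_linear_of_real[where 'a=complex], of 0 1 "\<lambda>x. (norm (F x))\<^sup>2"]
      by (simp add: o_def continuous_intros contF del: of_real_power)
    also have "\<dots> = integral {0..1} (\<lambda>x. F x * cnj (F x)) - 0"
      by (simp only: complex_norm_square diff_0_right)
    also have "\<dots> = integral {0..1} (\<lambda>x. F x * cnj (F x) - F x * g (fchar 1 (of_real x)))"
      unfolding g0[symmetric] by (rule integral_diff[symmetric])
        (intro integrable_continuous_real contg continuous_intros contF)+
    finally have "complex_of_real I = integral {0..1} (\<lambda>x. F x * cnj (F x) - F x * g (fchar 1 (of_real x)))" .
    moreover have "norm (integral {0..1} (\<lambda>x. F x * cnj (F x) - F x * g (fchar 1 (of_real x)))) \<le> (M * d) * (1 - 0)"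
    proof (rule integral_bound)
      show "continuous_on {0..1} (\<lambda>x. F x * cnj (F x) - F x * g (fchar 1 (of_real x)))"
        by (intro continuous_intros contg contF)
      fix x :: real assume x: "x \<in> {0..1}"
      have "fchar 1 (of_real x) \<in> sphere 0 1"
        by (simp add: norm_fchar)
      then have "norm (cnj (F x) - g (fchar 1 (of_real x))) \<le> d"
        using g(2)[of "fchar 1 (of_real x)"] by (simp add: F_def h(2) less_imp_le)
      then have "norm (F x) * norm (cnj (F x) - g (fchar 1 (of_real x))) \<le> M * d"
        using M[OF x] M0 by (intro mult_mono) auto
      then show "norm (F x * cnj (F x) - F x * g (fchar 1 (of_real x))) \<le> M * d"
        by (simp add: norm_mult flip: right_diff_distrib)
    qed simp
    ultimately have "\<bar>I\<bar> \<le> M * d"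
      by (metis diff_0_right mult.right_neutral norm_of_real)
    then show ?thesis using d by (simp add: mult.commute)
  qed
  then have "I = 0"
    using I0 field_le_epsilon[of I 0] by simp
  then have F0: "F x = 0" if "x \<in> {0..1}" for x
  proof -
    have "continuous_on {0..1} (\<lambda>x. (norm (F x))\<^sup>2)"
      by (intro continuous_intros contF)
    then have "\<forall>x\<in>{0..1}. (norm (F x))\<^sup>2 = 0"
      using \<open>I = 0\<close> integral_eq_0_iff[of 0 1 "\<lambda>x. (norm (F x))\<^sup>2"] unfolding I_def by simp
    with that show ?thesis by simp
  qed
  have lim: "(0::complex) islimpt of_real ` {0..1}"
    unfolding islimpt_approachable
  proof (intro allI impI)
    fix e :: real assume "e > 0"
    define x where "x = min 1 (e / 2)"
    have "0 < x" "x \<le> 1" "x < e"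
      using \<open>e > 0\<close> by (auto simp: x_def)
    then show "\<exists>x'\<in>complex_of_real ` {0..1}. x' \<noteq> 0 \<and> dist x' 0 < e"
      by (intro bexI[of _ "complex_of_real x"]) auto
  qed
  show ?thesis
  proof (rule analytic_continuation[OF hol open_UNIV connected_UNIV subset_UNIV UNIV_I lim _ UNIV_I])
    fix z :: complex assume "z \<in> of_real ` {0..1}"
    then show "\<theta> z = 0"
      using F0 by (auto simp: F_def)
  qed
qed

lemma summable_on_exp_minus_abs_int: "(\<lambda>m::int. exp (- \<bar>of_int m\<bar> :: real)) summable_on UNIV"
proof -
  have "summable (\<lambda>n. norm (exp (-1::real) ^ n))"
    by (simp add: norm_power summable_geometric)
  then have geom: "(\<lambda>n::nat. exp (- real n)) summable_on UNIV"
    using norm_summable_imp_summable_on[of "\<lambda>n. exp (-1::real) ^ n"]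
    by (simp flip: exp_of_nat_mult)
  have "(\<lambda>m::int. exp (- \<bar>of_int m\<bar> :: real)) summable_on range int"
    using geom by (subst summable_on_reindex) (simp_all add: o_def)
  moreover have "(\<lambda>m::int. exp (- \<bar>of_int m\<bar> :: real)) summable_on range (\<lambda>n. - int n)"
    using geom by (subst summable_on_reindex) (simp_all add: o_def inj_on_def)
  ultimately have "(\<lambda>m::int. exp (- \<bar>of_int m\<bar> :: real)) summable_on (range int \<union> range (\<lambda>n. - int n))"
    by (rule summable_on_union)
  moreover have "range int \<union> range (\<lambda>n. - int n) = UNIV"
    by (auto simp: image_iff) (metis int_cases2)
  ultimately show ?thesis by simp
qed

text \<open>Completing the square bounds the terms by a multiple of \<open>exp (- |m|)\<close>.\<close>

lemma summable_on_gaussian_int: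
  assumes \<delta>: "\<delta> > 0"
  shows "(\<lambda>m::int. exp (- \<delta> * (of_int m)\<^sup>2 + K * \<bar>of_int m\<bar>) :: real) summable_on UNIV"
proof (rule summable_on_comparison_test)
  \<comment> \<open>The maximum of \<open>- \<delta> x\<^sup>2 + (K + 1) x\<close>.\<close>
  define C where "C = (K + 1)\<^sup>2 / (4 * \<delta>)"
  show "(\<lambda>m::int. exp C * exp (- \<bar>of_int m\<bar> :: real)) summable_on UNIV"
    by (intro summable_on_cmult_right summable_on_exp_minus_abs_int)
  fix m :: int
  define x where "x = \<bar>real_of_int m\<bar>"
  have "0 \<le> \<delta> * (x - (K + 1) / (2 * \<delta>))\<^sup>2"
    using \<delta> by simp
  also have "\<dots> = \<delta> * x\<^sup>2 - (K + 1) * x + C"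
    using \<delta> by (simp add: C_def power2_eq_square field_simps)
  finally have "- \<delta> * x\<^sup>2 + K * x \<le> C - x"
    by (simp add: algebra_simps)
  then show "exp (- \<delta> * (of_int m)\<^sup>2 + K * \<bar>of_int m\<bar>) \<le> exp C * exp (- \<bar>of_int m\<bar> :: real)"
    by (simp add: x_def flip: exp_add)
qed simp

definition fourier_series :: "(int \<Rightarrow> complex) \<Rightarrow> complex \<Rightarrow> complex" where
  "fourier_series a w = (\<Sum>\<^sub>\<infinity>m. a m * fchar m w)"

text \<open>Coefficients that decay faster than every exponential give an entire function, by uniform convergence on
horizontal strips.\<close>

context
  fixes a :: "int \<Rightarrow> complex"
  assumes decay: "\<And>R. (\<lambda>m. norm (a m) * exp (R * \<bar>of_int m\<bar>)) summable_on UNIV"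
begin

lemma fourier_term_bound:
  assumes "\<bar>Im w\<bar> \<le> R"
  shows "norm (a m * fchar m w) \<le> norm (a m) * exp (2 * pi * R * \<bar>of_int m\<bar>)"
proof -
  have "- 2 * pi * of_int m * Im w \<le> \<bar>- 2 * pi * of_int m * Im w\<bar>"
    by (rule abs_ge_self)
  also have "\<dots> = 2 * pi * \<bar>Im w\<bar> * \<bar>of_int m\<bar>"
    by (simp add: abs_mult mult_ac)
  also have "\<dots> \<le> 2 * pi * R * \<bar>of_int m\<bar>"
    using assms by (intro mult_right_mono mult_left_mono) auto
  finally show ?thesis
    by (simp add: norm_mult norm_fchar mult_left_mono)
qed

lemma fourier_series_uniform_limit:
  assumes "\<And>w. w \<in> S \<Longrightarrow> \<bar>Im w\<bar> \<le> R"
  shows "uniform_limit S (\<lambda>X w. \<Sum>m\<in>X. a m * fchar m w) (fourier_series a) (finite_subsets_at_top UNIV)"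
  unfolding fourier_series_def
  by (rule Weierstrass_m_test_general[OF _ decay[of "2 * pi * R"]])
     (use assms fourier_term_bound in blast)

lemma fourier_series_holomorphic: "fourier_series a holomorphic_on UNIV"
proof -
  have "fourier_series a holomorphic_on ball 0 r" for r
  proof (rule holomorphic_uniform_limit)
    show "uniform_limit (cball 0 r) (\<lambda>X w. \<Sum>m\<in>X. a m * fchar m w) (fourier_series a) (finite_subsets_at_top UNIV)"
    proof (rule fourier_series_uniform_limit)
      fix w :: complex assume "w \<in> cball 0 r"
      then show "\<bar>Im w\<bar> \<le> r"
        using abs_Im_le_cmod[of w] by simp
    qed
    show "\<forall>\<^sub>F X in finite_subsets_at_top UNIV. continuous_on (cball 0 r) (\<lambda>w. \<Sum>m\<in>X. a m * fchar m w) \<and>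
        (\<lambda>w. \<Sum>m\<in>X. a m * fchar m w) holomorphic_on ball 0 r"
      by (intro always_eventually allI conjI continuous_intros holomorphic_intros)
  qed simp_all
  then have "fourier_series a field_differentiable at w" for w
    by (rule holomorphic_on_imp_differentiable_at[where s="ball 0 (norm w + 1)"]) simp_all
  then show ?thesis
    by (simp add: holomorphic_on_def)
qed

lemma fourier_series_periodic: "fourier_series a (w + 1) = fourier_series a w"
  by (simp add: fourier_series_def fchar_add)

lemma fourier_coeff_fourier_series: "fourier_coeff (fourier_series a) n = a n"
proof -
  have sum_eq: "fourier_series a w * fchar (- n) w = (\<Sum>\<^sub>\<infinity>m. a m * fchar (m - n) w)" for w
    unfolding fourier_series_def
    by (subst infsum_cmult_left' [symmetric]) (simp add: fchar_add(1)[of _ "- n", simplified] mult_ac)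
  have ul: "uniform_limit {0..1} (\<lambda>X (x::real). \<Sum>m\<in>X. a m * fchar (m - n) (of_real x))
    (\<lambda>x. fourier_series a (of_real x) * fchar (- n) (of_real x)) (finite_subsets_at_top UNIV)"
    unfolding sum_eq
    by (rule Weierstrass_m_test_general[OF _ decay[of 0]]) (simp add: norm_mult norm_fchar)
  obtain I J where I: "\<And>X. ((\<lambda>x::real. \<Sum>m\<in>X. a m * fchar (m - n) (of_real x)) has_integral I X) {0..1}"
    and J: "((\<lambda>x. fourier_series a (of_real x) * fchar (- n) (of_real x)) has_integral J) {0..1}"
    and lim: "(I \<longlongrightarrow> J) (finite_subsets_at_top UNIV)"
    by (rule uniform_limit_integral[OF ul]) (auto intro!: continuous_intros)
  have fchar_int: "((\<lambda>x::real. fchar k (of_real x)) has_integral (if k = 0 then 1 else 0)) {0..1}" for k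
  proof (cases "k = 0")
    case True
    then show ?thesis
      using has_integral_const_real[of "1::complex" 0 1] by simp
  next
    case False
    define c where "c = 2 * of_real pi * \<i> * of_int k"
    have c: "c \<noteq> 0" using False by (simp add: c_def)
    have "((\<lambda>x::real. fchar k (of_real x)) has_integral (fchar k (of_real 1) / c - fchar k (of_real 0) / c)) {0..1}"
    proof (rule fundamental_theorem_of_calculus)
      fix x :: real
      have "((\<lambda>w. fchar k w / c) has_field_derivative fchar k (of_real x)) (at (of_real x))"
        unfolding fchar_def c_def[symmetric] using c by (auto intro!: derivative_eq_intros)
      then show "((\<lambda>x. fchar k (of_real x) / c) has_vector_derivative fchar k (of_real x)) (at x within {0..1})"
        by (rule has_vector_derivative_real_field)
    qed simp
    then show ?thesis
      using False by simp
  qed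
  have "I X = (\<Sum>m\<in>X. a m * (if m - n = 0 then 1 else 0))" if "finite X" for X
    by (rule has_integral_unique[OF I]) (intro has_integral_sum that has_integral_mult_right fchar_int)
  moreover have "(\<Sum>m\<in>X. a m * (if m - n = 0 then 1 else 0)) = a n" if "finite X" "n \<in> X" for X
  proof -
    have "(\<Sum>m\<in>X. a m * (if m - n = 0 then 1 else 0)) = (\<Sum>m\<in>X. if n = m then a m else 0)"
      by (intro sum.cong) auto
    then show ?thesis using that by (simp add: sum.delta)
  qed
  ultimately have "\<forall>\<^sub>F X in finite_subsets_at_top UNIV. I X = a n"
    unfolding eventually_finite_subsets_at_top by (intro exI[of _ "{n}"]) auto
  then have "J = a n"
    using lim tendsto_unique[OF _ lim] tendsto_eventually by (metis finite_subsets_at_top_neq_bot)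
  then show ?thesis
    using J by (simp add: fourier_coeff_def integral_unique)
qed

end

lemma fourier_coeff_linear:
  assumes "f holomorphic_on UNIV" "g holomorphic_on UNIV"
  shows "fourier_coeff (\<lambda>w. f w + c * g w) m = fourier_coeff f m + c * fourier_coeff g m"
proof -
  have int: "((\<lambda>x::real. h (of_real x) * fchar (- m) (of_real x)) has_integral fourier_coeff h m) {0..1}"
    if "h holomorphic_on UNIV" for h
  proof -
    have "continuous_on {0..1} (\<lambda>x::real. h (of_real x))"
      by (rule continuous_on_compose2[OF holomorphic_on_imp_continuous_on[OF that]])
         (auto intro!: continuous_intros)
    then show ?thesis
      unfolding fourier_coeff_def
      by (intro integrable_integral integrable_continuous_real continuous_intros)
  qed
  have "((\<lambda>x::real. f (of_real x) * fchar (- m) (of_real x) + c * (g (of_real x) * fchar (- m) (of_real x)))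
      has_integral fourier_coeff f m + c * fourier_coeff g m) {0..1}"
    by (intro has_integral_add has_integral_mult_right int assms)
  then have "((\<lambda>x::real. (f (of_real x) + c * g (of_real x)) * fchar (- m) (of_real x))
      has_integral fourier_coeff f m + c * fourier_coeff g m) {0..1}"
    by (simp add: algebra_simps)
  then show ?thesis
    unfolding fourier_coeff_def by (rule integral_unique)
qed

section \<open>Theta functions\<close>

text \<open>Theta functions of degree \<open>N\<close> for the lattice \<open>\<int> + t \<int>\<close>, in the normalisation in which the factor of
automorphy has no additional character.\<close>

definition theta_space :: "nat \<Rightarrow> complex \<Rightarrow> (complex \<Rightarrow> complex) set" where
  "theta_space N t = {\<theta>. \<theta> holomorphic_on UNIV \<and> (\<forall>w. \<theta> (w + 1) = \<theta> w) \<and>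
     (\<forall>w. \<theta> (w + t) = exp (- of_real pi * \<i> * of_nat N * (2 * w + t)) * \<theta> w)}"

text \<open>Moving the segment of integration by the quasi-period \<open>t\<close> does not change the integral, but multiplies the
integrand by a constant and by a character of index \<open>- N\<close>.\<close>

lemma theta_fourier_coeff_step:
  assumes \<theta>: "\<theta> \<in> theta_space N t"
  shows "fourier_coeff \<theta> m =
    exp (- of_real pi * \<i> * t * (of_nat N + 2 * of_int m)) * fourier_coeff \<theta> (m + int N)"
proof -
  have hol: "\<theta> holomorphic_on UNIV" and per: "\<And>w. \<theta> (w + 1) = \<theta> w"
    and qp: "\<And>w. \<theta> (w + t) = exp (- of_real pi * \<i> * of_nat N * (2 * w + t)) * \<theta> w"
    using \<theta> by (auto simp: theta_space_def)
  define g where "g = (\<lambda>w. \<theta> w * fchar (- m) w)"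
  have "fourier_coeff \<theta> m = integral {0..1} (\<lambda>x::real. g (of_real x))"
    by (simp add: fourier_coeff_def g_def)
  also have "\<dots> = integral {0..1} (\<lambda>x::real. g (t + of_real x))"
    by (rule periodic_integral_shift [symmetric])
       (use hol per in \<open>auto simp: g_def fchar_add intro!: holomorphic_intros\<close>)
  also have "(\<lambda>x::real. g (t + of_real x)) =
    (\<lambda>x. exp (- of_real pi * \<i> * t * (of_nat N + 2 * of_int m)) * (\<theta> (of_real x) * fchar (- (m + int N)) (of_real x)))"
  proof
    fix x :: real
    have "g (t + of_real x) = exp (- of_real pi * \<i> * of_nat N * (2 * of_real x + t)) * \<theta> (of_real x) * fchar (- m) (of_real x + t)"
      by (simp add: g_def qp add.commute[of t])
    also have "\<dots> = exp (- of_real pi * \<i> * of_nat N * (2 * of_real x + t)) *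
        exp (2 * of_real pi * \<i> * of_int (- m) * (of_real x + t)) * \<theta> (of_real x)"
      unfolding fchar_def by (simp only: mult_ac)
    also have "exp (- of_real pi * \<i> * of_nat N * (2 * of_real x + t)) *
        exp (2 * of_real pi * \<i> * of_int (- m) * (of_real x + t)) =
      exp (- of_real pi * \<i> * t * (of_nat N + 2 * of_int m)) * exp (2 * of_real pi * \<i> * of_int (- (m + int N)) * of_real x)"
      unfolding exp_add [symmetric] by (rule arg_cong[of _ _ exp]) (simp add: algebra_simps)
    finally show "g (t + of_real x) = exp (- of_real pi * \<i> * t * (of_nat N + 2 * of_int m)) * (\<theta> (of_real x) * fchar (- (m + int N)) (of_real x))"
      unfolding fchar_def by (simp only: mult_ac)
  qed
  also have "integral {0..1} (\<lambda>x::real. exp (- of_real pi * \<i> * t * (of_nat N + 2 * of_int m)) * (\<theta> (of_real x) * fchar (- (m + int N)) (of_real x)))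
    = exp (- of_real pi * \<i> * t * (of_nat N + 2 * of_int m)) * fourier_coeff \<theta> (m + int N)"
    unfolding fourier_coeff_def by (rule integral_mult_right)
  finally show ?thesis .
qed

lemma theta_fourier_coeffs_vanish:
  assumes \<theta>: "\<theta> \<in> theta_space N t" and N: "N > 0"
    and zero: "\<And>j. j < N \<Longrightarrow> fourier_coeff \<theta> (int j) = 0"
  shows "fourier_coeff \<theta> m = 0"
proof -
  have step: "fourier_coeff \<theta> m = 0 \<longleftrightarrow> fourier_coeff \<theta> (m + int N) = 0" for m
    by (subst theta_fourier_coeff_step[OF \<theta>]) simp
  have all: "fourier_coeff \<theta> (r + int N * k) = 0 \<longleftrightarrow> fourier_coeff \<theta> r = 0" for r k
  proof (induction k rule: int_induct[where k=0])
    case (step1 i)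
    then show ?case
      using step[of "r + int N * i"] by (simp add: algebra_simps)
  next
    case (step2 i)
    then show ?case
      using step[of "r + int N * (i - 1)"] by (simp add: algebra_simps)
  qed simp
  have "fourier_coeff \<theta> (m mod int N) = 0"
    using zero[of "nat (m mod int N)"] N by (simp add: nat_less_iff)
  then show ?thesis
    using all[of "m mod int N" "m div int N"] by simp
qed

text \<open>The solution of the recursion for the Fourier coefficients that is supported on the residue class of \<open>j\<close>.\<close>

definition theta_coeff :: "nat \<Rightarrow> complex \<Rightarrow> nat \<Rightarrow> int \<Rightarrow> complex" where
  "theta_coeff N t j m =
     (if m mod int N = int j then exp (of_real pi * \<i> * t * (of_int m)\<^sup>2 / of_nat N) else 0)"

lemma theta_coeff_decay:
  assumes "N > 0" "Im t > 0"
  shows "(\<lambda>m. norm (theta_coeff N t j m) * exp (R * \<bar>of_int m\<bar>)) summable_on UNIV"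
proof (rule summable_on_comparison_test)
  have "pi * Im t / real N > 0"
    using assms by simp
  then show "(\<lambda>m::int. exp (- (pi * Im t / real N) * (of_int m)\<^sup>2 + R * \<bar>of_int m\<bar>)) summable_on UNIV"
    by (rule summable_on_gaussian_int)
  fix m :: int
  have "norm (exp (of_real pi * \<i> * t * (of_int m)\<^sup>2 / of_nat N)) = exp (- (pi * Im t / real N) * (of_int m)\<^sup>2)"
  proof -
    have "of_real pi * \<i> * t * (of_int m)\<^sup>2 / of_nat N = of_real (pi * (of_int m)\<^sup>2 / real N) * (\<i> * t)"
      by simp
    then have "Re (of_real pi * \<i> * t * (of_int m)\<^sup>2 / of_nat N) = - (pi * Im t / real N) * (of_int m)\<^sup>2"
      by (simp only: Re_complex_of_real times_complex.sel Im_complex_of_real) simp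
    then show ?thesis by (simp add: norm_exp_eq_Re)
  qed
  then show "norm (theta_coeff N t j m) * exp (R * \<bar>of_int m\<bar>)
      \<le> exp (- (pi * Im t / real N) * (of_int m)\<^sup>2 + R * \<bar>of_int m\<bar>)"
    unfolding exp_add by (simp add: theta_coeff_def)
qed simp

lemma theta_coeff_step:
  assumes "N > 0"
  shows "theta_coeff N t j m * fchar m t =
    exp (- of_real pi * \<i> * of_nat N * t) * theta_coeff N t j (m + int N)"
proof -
  have "of_real pi * \<i> * t * (of_int m)\<^sup>2 / of_nat N + 2 * of_real pi * \<i> * of_int m * t =
    - of_real pi * \<i> * of_nat N * t + of_real pi * \<i> * t * (of_int (m + int N))\<^sup>2 / of_nat N"
    using assms by (simp add: field_simps power2_eq_square)
  then show ?thesis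
    unfolding theta_coeff_def fchar_def by (simp add: exp_add [symmetric])
qed

lemma theta_series_in_theta_space:
  assumes "N > 0" "Im t > 0"
  shows "fourier_series (theta_coeff N t j) \<in> theta_space N t"
proof -
  note decay = theta_coeff_decay[OF assms, of j]
  have "fourier_series (theta_coeff N t j) (w + t) =
    exp (- of_real pi * \<i> * of_nat N * (2 * w + t)) * fourier_series (theta_coeff N t j) w" for w
  proof -
    let ?a = "theta_coeff N t j"
    have "?a m * fchar m (w + t) = exp (- of_real pi * \<i> * of_nat N * (2 * w + t)) * (?a (m + int N) * fchar (m + int N) w)" for m
    proof -
      have "?a m * fchar m (w + t) = (?a m * fchar m t) * fchar m w"
        by (simp add: fchar_add)
      also have "\<dots> = exp (- of_real pi * \<i> * of_nat N * t) * ?a (m + int N) * (fchar (- int N) w * fchar (m + int N) w)"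
        by (simp add: theta_coeff_step[OF assms(1)] flip: fchar_add)
      also have "exp (- of_real pi * \<i> * of_nat N * t) * ?a (m + int N) * (fchar (- int N) w * fchar (m + int N) w)
        = (exp (- of_real pi * \<i> * of_nat N * t) * fchar (- int N) w) * (?a (m + int N) * fchar (m + int N) w)"
        by (simp only: mult_ac)
      also have "exp (- of_real pi * \<i> * of_nat N * t) * fchar (- int N) w = exp (- of_real pi * \<i> * of_nat N * (2 * w + t))"
        unfolding fchar_def exp_add [symmetric] by (rule arg_cong[of _ _ exp]) (simp add: algebra_simps)
      finally show ?thesis .
    qed
    then have "fourier_series ?a (w + t) =
      (\<Sum>\<^sub>\<infinity>m. exp (- of_real pi * \<i> * of_nat N * (2 * w + t)) * (?a (m + int N) * fchar (m + int N) w))"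
      by (simp add: fourier_series_def)
    also have "\<dots> = exp (- of_real pi * \<i> * of_nat N * (2 * w + t)) * (\<Sum>\<^sub>\<infinity>m. ?a (m + int N) * fchar (m + int N) w)"
      by (rule infsum_cmult_right')
    also have "(\<Sum>\<^sub>\<infinity>m. ?a (m + int N) * fchar (m + int N) w) = fourier_series ?a w"
      unfolding fourier_series_def
      by (rule infsum_reindex_bij_betw[where g="\<lambda>m. m + int N" and f="\<lambda>m. ?a m * fchar m w"])
         (rule bij_betw_byWitness[where f'="\<lambda>m. m - int N"], auto)
    finally show ?thesis .
  qed
  then show ?thesis
    using fourier_series_holomorphic[OF decay] fourier_series_periodic[OF decay]
    by (simp add: theta_space_def)
qed

lemma theta_space_add_mult:
  "f \<in> theta_space N t \<Longrightarrow> g \<in> theta_space N t \<Longrightarrow> (\<lambda>w. f w + c * g w) \<in> theta_space N t"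
  by (auto simp: theta_space_def algebra_simps intro!: holomorphic_intros)

lemma theta_space_linear_combination:
  fixes n :: nat
  assumes "\<And>j. j < n \<Longrightarrow> f j \<in> theta_space N t"
  shows "(\<lambda>w. \<Sum>j<n. c j * f j w) \<in> theta_space N t \<and>
    fourier_coeff (\<lambda>w. \<Sum>j<n. c j * f j w) m = (\<Sum>j<n. c j * fourier_coeff (f j) m)"
  using assms
proof (induction n)
  case 0
  then show ?case by (simp add: theta_space_def fourier_coeff_def)
next
  case (Suc n)
  then have IH: "(\<lambda>w. \<Sum>j<n. c j * f j w) \<in> theta_space N t"
    "fourier_coeff (\<lambda>w. \<Sum>j<n. c j * f j w) m = (\<Sum>j<n. c j * fourier_coeff (f j) m)"
    and fn: "f n \<in> theta_space N t"
    by auto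
  then show ?case
    using theta_space_add_mult[OF IH(1) fn, of "c n"]
      fourier_coeff_linear[of "\<lambda>w. \<Sum>j<n. c j * f j w" "f n" "c n" m]
    by (simp add: theta_space_def)
qed

text \<open>The \<open>N\<close> coefficients of index \<open>0, \<dots>, N - 1\<close> are coordinates: they detect \<open>0\<close> by the recursion and Fourier
uniqueness, and the \<open>N\<close> theta series, each supported on one residue class, realise them independently.\<close>

theorem theta_space_basis:
  assumes N: "N > 0" and t: "Im t > 0"
  obtains f where "\<And>j. j < N \<Longrightarrow> f j \<in> theta_space N t"
    and "\<And>\<theta>. \<theta> \<in> theta_space N t \<Longrightarrow> \<exists>c. \<theta> = (\<lambda>w. \<Sum>j<N. c j * f j w)"
    and "\<And>c. (\<And>w. (\<Sum>j<N. c j * f j w) = 0) \<Longrightarrow> \<forall>j<N. c j = 0"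
proof
  let ?f = "\<lambda>j. fourier_series (theta_coeff N t j)"
  have f: "?f j \<in> theta_space N t" for j
    by (rule theta_series_in_theta_space[OF N t])
  define e where "e j = exp (of_real pi * \<i> * t * (of_nat j)\<^sup>2 / of_nat N)" for j
  have e: "e j \<noteq> 0" for j by (simp add: e_def)
  have coeff: "fourier_coeff (\<lambda>w. \<Sum>j<N. c j * ?f j w) (int i) = c i * e i" if "i < N" for c i
  proof -
    have "fourier_coeff (\<lambda>w. \<Sum>j<N. c j * ?f j w) (int i) = (\<Sum>j<N. c j * theta_coeff N t j (int i))"
      using theta_space_linear_combination[of N ?f N t c "int i"] f
      by (simp add: fourier_coeff_fourier_series[OF theta_coeff_decay[OF N t]])
    also have "\<dots> = (\<Sum>j<N. if j = i then c i * e i else 0)"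
      using that by (intro sum.cong) (auto simp: theta_coeff_def e_def zmod_int[symmetric])
    finally show ?thesis using that by simp
  qed
  show "?f j \<in> theta_space N t" for j by (rule f)
  show "\<exists>c. \<theta> = (\<lambda>w. \<Sum>j<N. c j * ?f j w)" if \<theta>: "\<theta> \<in> theta_space N t" for \<theta>
  proof -
    define c where "c j = fourier_coeff \<theta> (int j) / e j" for j
    define g where "g = (\<lambda>w. \<Sum>j<N. c j * ?f j w)"
    have g: "g \<in> theta_space N t"
      unfolding g_def using theta_space_linear_combination[of N ?f] f by blast
    have d: "(\<lambda>w. \<theta> w + (- 1) * g w) \<in> theta_space N t"
      by (rule theta_space_add_mult[OF \<theta> g])
    have "fourier_coeff (\<lambda>w. \<theta> w + (- 1) * g w) (int i) = 0" if "i < N" for i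
      using \<theta> g coeff[OF that, of c] e
      by (subst fourier_coeff_linear) (auto simp: theta_space_def g_def c_def)
    then have "fourier_coeff (\<lambda>w. \<theta> w + (- 1) * g w) m = 0" for m
      using theta_fourier_coeffs_vanish[OF d N] by blast
    moreover have "(\<lambda>w. \<theta> w + (- 1) * g w) holomorphic_on UNIV"
      "\<And>w. \<theta> (w + 1) + (- 1) * g (w + 1) = \<theta> w + (- 1) * g w"
      using d by (auto simp: theta_space_def)
    ultimately have "\<theta> w + (- 1) * g w = 0" for w
      using periodic_fourier_unique[of "\<lambda>w. \<theta> w + (- 1) * g w" w] by blast
    then have "\<theta> = g" by (simp add: fun_eq_iff)
    then show ?thesis unfolding g_def by blast
  qed
  show "\<forall>j<N. c j = 0" if "\<And>w. (\<Sum>j<N. c j * ?f j w) = 0" for c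
  proof (intro allI impI)
    fix i assume i: "i < N"
    have "c i * e i = fourier_coeff (\<lambda>w. 0) (int i)"
      using coeff[OF i, of c] by (simp add: that)
    then show "c i = 0"
      using e by (simp add: fourier_coeff_def)
  qed
qed

section \<open>Bases of function spaces\<close>

text \<open>A basis is a family indexed by numbers, so that its image under an operator is again such a family, with no
separate argument that the images are distinct.\<close>

definition is_basis :: "(complex \<Rightarrow> complex) set \<Rightarrow> nat \<Rightarrow> (nat \<Rightarrow> complex \<Rightarrow> complex) \<Rightarrow> bool" where
  "is_basis V N f \<longleftrightarrow> V = {\<lambda>z. \<Sum>j<N. u j * f j z | u. True} \<and>
     (\<forall>u. (\<forall>z. (\<Sum>j<N. u j * f j z) = 0) \<longrightarrow> (\<forall>j<N. u j = 0))"

lemma sum_fun_scale_apply: "(\<Sum>x\<in>A. fun_scale (u x) (g x)) z = (\<Sum>x\<in>A. u x * g x z)"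
  by (induction A rule: infinite_finite_induct) (simp_all add: fun_scale_def)

lemma is_basis_imp_dim:
  assumes "is_basis V N f"
  shows "fin_dim_space V" "cfun.dim V = N"
proof -
  have V: "V = {\<lambda>z. \<Sum>j<N. u j * f j z | u. True}"
    and ind: "\<And>u. (\<And>z. (\<Sum>j<N. u j * f j z) = 0) \<Longrightarrow> \<forall>j<N. u j = 0"
    using assms unfolding is_basis_def by blast+
  have inj: "inj_on f {..<N}"
  proof (rule inj_onI, rule ccontr)
    fix i j assume ij: "i \<in> {..<N}" "j \<in> {..<N}" "f i = f j" "i \<noteq> j"
    define u where "u = (\<lambda>k. if k = i then 1 else if k = j then - 1 else (0::complex))"
    have "(\<Sum>k<N. u k * f k z) = 0" for z
    proof -
      have "(\<Sum>k<N. u k * f k z) = (\<Sum>k<N. (if k = i then f i z else 0) - (if k = j then f j z else 0))"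
        using ij(4) by (intro sum.cong) (auto simp: u_def)
      then show ?thesis using ij by (simp add: sum_subtractf)
    qed
    from ind[OF this] ij(1) show False by (auto simp: u_def)
  qed
  define Bs where "Bs = f ` {..<N}"
  have fin: "finite Bs" by (simp add: Bs_def)
  have reindex: "(\<Sum>v\<in>Bs. fun_scale (u v) v) = (\<lambda>z. \<Sum>j<N. u (f j) * f j z)" for u
  proof
    fix z
    have "(\<Sum>v\<in>Bs. fun_scale (u v) v) z = (\<Sum>v\<in>Bs. u v * v z)"
      by (rule sum_fun_scale_apply)
    also have "\<dots> = (\<Sum>j<N. u (f j) * f j z)"
      unfolding Bs_def by (rule sum.reindex_cong[OF inj]) auto
    finally show "(\<Sum>v\<in>Bs. fun_scale (u v) v) z = (\<Sum>j<N. u (f j) * f j z)" .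
  qed
  have span: "cfun.span Bs = V"
  proof -
    have "cfun.span Bs = range (\<lambda>u. \<Sum>v\<in>Bs. fun_scale (u v) v)"
      by (rule cfun.span_finite[OF fin])
    also have "\<dots> = range (\<lambda>u z. \<Sum>j<N. u (f j) * f j z)"
      by (simp only: reindex)
    also have "\<dots> = V"
    proof (intro equalityI subsetI)
      fix F assume "F \<in> V"
      then obtain u where u: "F = (\<lambda>z. \<Sum>j<N. u j * f j z)" using V by auto
      have "F = (\<lambda>z. \<Sum>j<N. u (the_inv_into {..<N} f (f j)) * f j z)"
        unfolding u by (intro ext sum.cong) (auto simp: the_inv_into_f_f[OF inj])
      then show "F \<in> range (\<lambda>u z. \<Sum>j<N. u (f j) * f j z)"
        by (intro image_eqI[of _ _ "\<lambda>v. u (the_inv_into {..<N} f v)"]) auto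
    qed (use V in auto)
    finally show ?thesis .
  qed
  have indep: "cfun.independent Bs"
    unfolding cfun.dependent_finite[OF fin]
  proof clarify
    fix u v assume v: "v \<in> Bs" "u v \<noteq> 0" and "(\<Sum>v\<in>Bs. fun_scale (u v) v) = 0"
    then have "(\<Sum>j<N. u (f j) * f j z) = 0" for z
      using fun_cong[OF reindex[of u], of z] by simp
    from ind[OF this] v show False by (auto simp: Bs_def)
  qed
  show "fin_dim_space V"
    using span fin unfolding fin_dim_space_def by blast
  have "cfun.dim V = card Bs"
    using cfun.dim_span_eq_card_independent[OF indep] by (simp add: span)
  then show "cfun.dim V = N"
    by (simp add: Bs_def card_image[OF inj])
qed

text \<open>Linearity is required only on the combinations of the given basis, since the operators in question involve
derivatives and are not linear on arbitrary functions.\<close>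

lemma is_basis_transfer:
  assumes V: "is_basis V N f"
    and lin: "\<And>u. T (\<lambda>z. \<Sum>j<N. u j * f j z) = (\<lambda>z. \<Sum>j<N. u j * T (f j) z)"
    and inj: "\<And>F. F \<in> V \<Longrightarrow> (\<forall>z. T F z = 0) \<Longrightarrow> (\<forall>z. F z = 0)"
  shows "is_basis (T ` V) N (\<lambda>j. T (f j))"
  unfolding is_basis_def
proof (intro conjI allI impI)
  have Veq: "V = {\<lambda>z. \<Sum>j<N. u j * f j z | u. True}"
    using V unfolding is_basis_def by blast
  then have "V = range (\<lambda>u z. \<Sum>j<N. u j * f j z)" by auto
  then have "T ` V = range (\<lambda>u. T (\<lambda>z. \<Sum>j<N. u j * f j z))"
    by (simp add: image_image)
  then show "T ` V = {\<lambda>z. \<Sum>j<N. u j * T (f j) z | u. True}"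
    unfolding lin by auto
  fix u j assume z: "\<forall>z. (\<Sum>j<N. u j * T (f j) z) = 0" and j: "j < N"
  have "(\<lambda>z. \<Sum>j<N. u j * f j z) \<in> V" using Veq by blast
  moreover have "\<forall>z. T (\<lambda>z. \<Sum>j<N. u j * f j z) z = 0"
    unfolding lin using z by blast
  ultimately have "\<forall>z. (\<Sum>j<N. u j * f j z) = 0" by (rule inj)
  then show "u j = 0" using V j unfolding is_basis_def by blast
qed

lemma is_basis_mem:
  assumes "is_basis V N f" "i < N"
  shows "f i \<in> V"
proof -
  have "f i = (\<lambda>z. \<Sum>j<N. (if j = i then 1 else 0) * f j z)"
    using assms(2) by (simp add: fun_eq_iff if_distrib[of "\<lambda>x. x * _"] cong: if_cong)
  moreover have "V = {\<lambda>z. \<Sum>j<N. u j * f j z | u. True}"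
    using assms(1) unfolding is_basis_def by (rule conjunct1)
  ultimately show ?thesis
    by (simp only:) (rule CollectI, intro exI conjI TrueI, rule refl)
qed

section \<open>Ladder operators in a constant magnetic field\<close>

text \<open>A constant magnetic field of strength \<open>B\<close> on the plane; the offset \<open>c\<close> records the choice of origin.\<close>

locale magnetic_field =
  fixes B :: real and c :: complex
begin

definition S :: "complex \<Rightarrow> complex" where
  "S z = of_real B * z + c"

text \<open>The exponent equals \<open>2 \<i> Im (S z * cnj \<gamma>)\<close>; written as a difference, it can be differentiated by the Wirtinger
rules.\<close>

definition multiplier :: "complex \<Rightarrow> complex \<Rightarrow> complex" where
  "multiplier \<gamma> z = exp (S z * cnj \<gamma> - cnj (S z) * \<gamma>)"

definition lower :: "(complex \<Rightarrow> complex) \<Rightarrow> complex \<Rightarrow> complex" where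
  "lower F z = d_zbar F z + S z * F z"

definition raise :: "(complex \<Rightarrow> complex) \<Rightarrow> complex \<Rightarrow> complex" where
  "raise F z = cnj (S z) * F z - d_z F z"

definition hamiltonian :: "(complex \<Rightarrow> complex) \<Rightarrow> complex \<Rightarrow> complex" where
  "hamiltonian F z = - d_z (d_zbar F) z - (S z * d_z F z - cnj (S z) * d_zbar F z)
     + of_real ((cmod (S z))\<^sup>2) * F z"

lemma smooth_S [smooth_intros]: "smooth S"
  unfolding S_def[abs_def] by (intro smooth_intros)

lemma d_S: "d_z S z = of_real B" "d_zbar S z = 0"
  unfolding S_def[abs_def] by (simp_all add: wirtinger_simps smooth_intros)

lemma smooth_lower [smooth_intros]: "smooth F \<Longrightarrow> smooth (lower F)"
  unfolding lower_def[abs_def] by (intro smooth_intros)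

lemma smooth_raise [smooth_intros]: "smooth F \<Longrightarrow> smooth (raise F)"
  unfolding raise_def[abs_def] by (intro smooth_intros)

lemma lower_scale: "smooth F \<Longrightarrow> lower (\<lambda>z. a * F z) z = a * lower F z"
  by (simp add: lower_def wirtinger_mult wirtinger_const smooth_intros algebra_simps)

lemma raise_scale: "smooth F \<Longrightarrow> raise (\<lambda>z. a * F z) z = a * raise F z"
  by (simp add: raise_def wirtinger_mult wirtinger_const smooth_intros algebra_simps)

lemma raise_add:
  "smooth F \<Longrightarrow> smooth G \<Longrightarrow> raise (\<lambda>z. F z + G z) z = raise F z + raise G z"
  by (simp add: raise_def wirtinger_add algebra_simps)

lemma raise_lower:
  assumes F: "smooth F"
  shows "raise (lower F) z = hamiltonian F z - of_real B * F z"
proof -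
  have "d_z (lower F) z = d_z (d_zbar F) z + (S z * d_z F z + of_real B * F z)"
    unfolding lower_def[abs_def]
    by (simp add: wirtinger_add wirtinger_mult F smooth_intros d_S)
  then show ?thesis
    unfolding raise_def hamiltonian_def complex_norm_square
    by (simp add: lower_def algebra_simps)
qed

lemma lower_raise:
  assumes F: "smooth F"
  shows "lower (raise F) z = hamiltonian F z + of_real B * F z"
proof -
  have "d_zbar (raise F) z = (cnj (S z) * d_zbar F z + of_real B * F z) - d_zbar (d_z F) z"
    unfolding raise_def[abs_def]
    by (simp add: wirtinger_diff wirtinger_mult wirtinger_cnj F smooth_intros d_S)
  then show ?thesis
    unfolding lower_def hamiltonian_def complex_norm_square d_zbar_d_z[OF F]
    by (simp add: raise_def algebra_simps)
qed

text \<open>A Weitzenboeck formula: for the connection with covariant derivatives \<open>- raise\<close> and \<open>lower\<close> the function \<open>|F|\<^sup>2\<close> is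
differentiated by the Leibniz rule, and the terms with second derivatives of \<open>F\<close> combine to the Hamiltonian.\<close>

lemma d_z_d_zbar_norm_square:
  assumes F: "smooth F"
  shows "d_z (d_zbar (\<lambda>z. F z * cnj (F z))) z =
    of_real ((cmod (raise F z))\<^sup>2 + (cmod (lower F z))\<^sup>2) - 2 * of_real (Re (hamiltonian F z * cnj (F z)))"
proof -
  have "d_zbar (\<lambda>z. F z * cnj (F z)) = (\<lambda>z. F z * cnj (d_z F z) + d_zbar F z * cnj (F z))"
    by (rule ext) (simp add: wirtinger_mult wirtinger_cnj F smooth_intros)
  then have "d_z (d_zbar (\<lambda>z. F z * cnj (F z))) z =
      F z * cnj (d_z (d_zbar F) z) + d_z F z * cnj (d_z F z)
      + (d_zbar F z * cnj (d_zbar F z) + d_z (d_zbar F) z * cnj (F z))"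
    by (simp add: wirtinger_add wirtinger_mult wirtinger_cnj F smooth_intros d_zbar_d_z)
  also have "\<dots> = raise F z * cnj (raise F z) + lower F z * cnj (lower F z)
      - (hamiltonian F z * cnj (F z) + cnj (hamiltonian F z * cnj (F z)))"
    unfolding raise_def lower_def hamiltonian_def complex_norm_square
    by (simp add: algebra_simps)
  also have "\<dots> = of_real ((cmod (raise F z))\<^sup>2 + (cmod (lower F z))\<^sup>2) - 2 * of_real (Re (hamiltonian F z * cnj (F z)))"
    by (simp only: complex_norm_square[symmetric] complex_add_cnj of_real_add of_real_mult of_real_numeral)
  finally show ?thesis .
qed

lemma norm_multiplier: "norm (multiplier \<gamma> z) = 1"
  by (simp add: multiplier_def norm_exp_eq_Re algebra_simps)

lemma multiplier_add:
  "multiplier (\<gamma> + \<delta>) z = multiplier \<gamma> z * multiplier \<delta> z"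
  by (simp add: multiplier_def algebra_simps flip: exp_add)

text \<open>The constant factor is the cocycle by which translations, corrected by their multipliers, fail to compose
additively.\<close>

lemma multiplier_shift:
  "multiplier \<delta> (z + \<gamma>) = exp (of_real B * (\<gamma> * cnj \<delta> - cnj \<gamma> * \<delta>)) * multiplier \<delta> z"
  unfolding multiplier_def exp_add [symmetric]
  by (rule arg_cong[of _ _ exp]) (simp add: S_def algebra_simps)

lemma multiplier_0 [simp]: "multiplier 0 z = 1"
  by (simp add: multiplier_def)

definition quasi_periods :: "(complex \<Rightarrow> complex) \<Rightarrow> complex set" where
  "quasi_periods F = {\<gamma>. \<forall>z. F (z + \<gamma>) = multiplier \<gamma> z * F z}"

lemma quasi_periods_add:
  assumes "\<gamma> \<in> quasi_periods F" "\<delta> \<in> quasi_periods F"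
    and "exp (of_real B * (\<gamma> * cnj \<delta> - cnj \<gamma> * \<delta>)) = 1"
  shows "\<gamma> + \<delta> \<in> quasi_periods F"
  unfolding quasi_periods_def
proof (clarify)
  fix z
  have "F (z + (\<gamma> + \<delta>)) = F ((z + \<gamma>) + \<delta>)"
    by (simp add: add.assoc)
  also have "\<dots> = multiplier \<delta> (z + \<gamma>) * (multiplier \<gamma> z * F z)"
    using assms(1,2) unfolding quasi_periods_def by simp
  also have "\<dots> = multiplier (\<gamma> + \<delta>) z * F z"
    by (simp add: multiplier_shift assms(3) multiplier_add)
  finally show "F (z + (\<gamma> + \<delta>)) = multiplier (\<gamma> + \<delta>) z * F z" .
qed

lemma quasi_periods_minus:
  assumes "\<gamma> \<in> quasi_periods F"
  shows "- \<gamma> \<in> quasi_periods F"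
  unfolding quasi_periods_def
proof (clarify)
  fix z
  have "F z = F ((z - \<gamma>) + \<gamma>)" by simp
  also have "\<dots> = multiplier \<gamma> (z + (- \<gamma>)) * F (z - \<gamma>)"
    using assms unfolding quasi_periods_def mem_Collect_eq by (metis diff_conv_add_uminus)
  also have "\<dots> = multiplier \<gamma> z * F (z - \<gamma>)"
  proof -
    have "multiplier \<gamma> (z + (- \<gamma>)) = multiplier \<gamma> z"
      by (simp only: multiplier_shift) (simp add: algebra_simps)
    then show ?thesis by simp
  qed
  finally have "multiplier (- \<gamma>) z * F z = multiplier (- \<gamma> + \<gamma>) z * F (z - \<gamma>)"
    unfolding multiplier_add by simp
  then show "F (z + - \<gamma>) = multiplier (- \<gamma>) z * F z"
    by simp
qed

text \<open>The derivative of the multiplier cancels against the change of \<open>S\<close> under translation.\<close>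

lemma quasi_periods_lower:
  assumes F: "smooth F" and "\<gamma> \<in> quasi_periods F"
  shows "\<gamma> \<in> quasi_periods (lower F)"
  unfolding quasi_periods_def
proof (clarify)
  fix z
  have m: "smooth (multiplier \<gamma>)" "d_zbar (multiplier \<gamma>) z = multiplier \<gamma> z * (- (of_real B * \<gamma>))"
    unfolding multiplier_def[abs_def]
    by (simp_all add: smooth_intros wirtinger_exp wirtinger_diff wirtinger_mult wirtinger_cnj wirtinger_const d_S)
  have eq: "(\<lambda>z. F (z + \<gamma>)) = (\<lambda>z. multiplier \<gamma> z * F z)"
    using assms(2) by (simp add: quasi_periods_def)
  have "d_zbar F (z + \<gamma>) = d_zbar (\<lambda>z. F (z + \<gamma>)) z"
    using wirtinger_translate[OF F] by simp
  also have "\<dots> = multiplier \<gamma> z * d_zbar F z - multiplier \<gamma> z * of_real B * \<gamma> * F z"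
    unfolding eq by (simp add: wirtinger_mult m F)
  finally show "lower F (z + \<gamma>) = multiplier \<gamma> z * lower F z"
    using fun_cong[OF eq, of z] by (simp add: lower_def S_def algebra_simps)
qed

lemma quasi_periods_raise:
  assumes F: "smooth F" and "\<gamma> \<in> quasi_periods F"
  shows "\<gamma> \<in> quasi_periods (raise F)"
  unfolding quasi_periods_def
proof (clarify)
  fix z
  have m: "smooth (multiplier \<gamma>)" "d_z (multiplier \<gamma>) z = multiplier \<gamma> z * (of_real B * cnj \<gamma>)"
    unfolding multiplier_def[abs_def]
    by (simp_all add: smooth_intros wirtinger_exp wirtinger_diff wirtinger_mult wirtinger_cnj wirtinger_const d_S)
  have eq: "(\<lambda>z. F (z + \<gamma>)) = (\<lambda>z. multiplier \<gamma> z * F z)"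
    using assms(2) by (simp add: quasi_periods_def)
  have "d_z F (z + \<gamma>) = d_z (\<lambda>z. F (z + \<gamma>)) z"
    using wirtinger_translate[OF F] by simp
  also have "\<dots> = multiplier \<gamma> z * d_z F z + multiplier \<gamma> z * of_real B * cnj \<gamma> * F z"
    unfolding eq by (simp add: wirtinger_mult m F)
  finally show "raise F (z + \<gamma>) = multiplier \<gamma> z * raise F z"
    using fun_cong[OF eq, of z] by (simp add: raise_def S_def algebra_simps)
qed

end

section \<open>Landau levels on a torus\<close>

locale magnetic_torus = magnetic_field +
  fixes \<omega>1 \<omega>2 :: complex
  assumes oriented: "Im (cnj \<omega>1 * \<omega>2) > 0"
begin

definition lattice :: "complex set" where
  "lattice = {of_int m * \<omega>1 + of_int n * \<omega>2 | m n. True}"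

definition sections :: "(complex \<Rightarrow> complex) set" where
  "sections = {F. smooth F \<and> lattice \<subseteq> quasi_periods F}"

definition landau_level :: "nat \<Rightarrow> (complex \<Rightarrow> complex) set" where
  "landau_level k = {F \<in> sections. \<forall>z. hamiltonian F z = of_real (B * (2 * real k + 1)) * F z}"

lemma sections_smooth: "F \<in> sections \<Longrightarrow> smooth F"
  by (simp add: sections_def)

lemma sections_lower: "F \<in> sections \<Longrightarrow> lower F \<in> sections"
  using quasi_periods_lower smooth_lower by (auto simp: sections_def)

lemma sections_raise: "F \<in> sections \<Longrightarrow> raise F \<in> sections"
  using quasi_periods_raise smooth_raise by (auto simp: sections_def)

text \<open>The multipliers have modulus \<open>1\<close>, so \<open>|F|\<close> is periodic and attains its maximum on a closed cell.\<close>

lemma section_norm_attains_max: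
  assumes F: "F \<in> sections"
  obtains z0 where "\<And>z. norm (F z) \<le> norm (F z0)"
proof -
  have per: "norm (F (z + \<gamma>)) = norm (F z)" if "\<gamma> \<in> lattice" for z \<gamma>
    using F that by (auto simp: sections_def quasi_periods_def norm_mult norm_multiplier)
  define p where "p = (\<lambda>x::real \<times> real. of_real (fst x) * \<omega>1 + of_real (snd x) * \<omega>2)"
  have "continuous_on ({0..1} \<times> {0..1}) (\<lambda>x. norm (F (p x)))"
    unfolding p_def
    by (intro continuous_on_norm continuous_on_compose2[OF smooth_continuous[OF sections_smooth[OF F], of UNIV]])
       (auto intro!: continuous_intros)
  moreover have "compact ({0..1::real} \<times> {0..1::real})"
    by (intro compact_Times compact_Icc)
  moreover have "{0..1::real} \<times> {0..1::real} \<noteq> {}" by auto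
  ultimately obtain x0 where x0: "x0 \<in> {0..1} \<times> {0..1}"
    "\<forall>x\<in>{0..1} \<times> {0..1}. norm (F (p x)) \<le> norm (F (p x0))"
    using continuous_attains_sup by (metis (no_types, lifting))
  have "norm (F z) \<le> norm (F (p x0))" for z
  proof -
    define s where "s = Im (cnj z * \<omega>2) / Im (cnj \<omega>1 * \<omega>2)"
    define t where "t = Im (cnj \<omega>1 * z) / Im (cnj \<omega>1 * \<omega>2)"
    have z: "z = of_real s * \<omega>1 + of_real t * \<omega>2"
      unfolding s_def t_def by (rule real_coordinates) (use oriented in simp)
    have "z = p (frac s, frac t) + (of_int \<lfloor>s\<rfloor> * \<omega>1 + of_int \<lfloor>t\<rfloor> * \<omega>2)"
      unfolding z p_def frac_def by (simp add: algebra_simps)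
    moreover have "of_int \<lfloor>s\<rfloor> * \<omega>1 + of_int \<lfloor>t\<rfloor> * \<omega>2 \<in> lattice"
      by (auto simp: lattice_def)
    ultimately have "norm (F z) = norm (F (p (frac s, frac t)))"
      using per by metis
    also have "\<dots> \<le> norm (F (p x0))"
      using x0(2) by (simp add: frac_ge_0 less_imp_le frac_lt_1)
    finally show ?thesis .
  qed
  then show ?thesis by (rule that)
qed

lemma section_bounded: "F \<in> sections \<Longrightarrow> bounded (range F)"
  by (metis boundedI image_iff section_norm_attains_max)

text \<open>At a maximum of \<open>|F|\<^sup>2\<close> the Laplacian is at most \<open>0\<close>, whereas by the Weitzenboeck formula it is a sum of squares
minus \<open>2 \<kappa> |F|\<^sup>2\<close>. This replaces the positivity of \<open>A* A\<close> in the Hilbert space of sections.\<close>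

lemma hamiltonian_no_negative_eigenvalue:
  assumes F: "F \<in> sections" and eig: "\<And>z. hamiltonian F z = of_real \<kappa> * F z" and neg: "\<kappa> < 0"
  shows "F z = 0"
proof -
  obtain z0 where z0: "\<And>z. norm (F z) \<le> norm (F z0)"
    using section_norm_attains_max[OF F] by blast
  define u where "u = (\<lambda>z. F z * cnj (F z))"
  have u: "u z = of_real ((norm (F z))\<^sup>2)" for z
    unfolding u_def by (rule complex_norm_square[symmetric])
  have "smooth u"
    unfolding u_def using F by (intro smooth_intros sections_smooth)
  then have "Re (d_z (d_zbar u) z0) \<le> 0"
    by (rule d_z_d_zbar_nonpos_at_max) (simp add: u z0 power_mono)
  moreover have "Re (d_z (d_zbar u) z0) =
    (cmod (raise F z0))\<^sup>2 + (cmod (lower F z0))\<^sup>2 - 2 * (\<kappa> * (norm (F z0))\<^sup>2)"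
  proof -
    have "hamiltonian F z0 * cnj (F z0) = of_real (\<kappa> * (norm (F z0))\<^sup>2)"
      unfolding eig of_real_mult complex_norm_square by simp
    then have "Re (hamiltonian F z0 * cnj (F z0)) = \<kappa> * (norm (F z0))\<^sup>2"
      by (simp only: Re_complex_of_real)
    then show ?thesis
      unfolding u_def d_z_d_zbar_norm_square[OF sections_smooth[OF F]] by simp
  qed
  ultimately have "(cmod (raise F z0))\<^sup>2 + (cmod (lower F z0))\<^sup>2 - 2 * (\<kappa> * (norm (F z0))\<^sup>2) \<le> 0"
    by simp
  then have "0 \<le> \<kappa> * (norm (F z0))\<^sup>2"
    by (smt (verit) zero_le_power2)
  then have "norm (F z0) = 0"
    using neg by (simp add: zero_le_mult_iff)
  then show ?thesis
    using z0[of z] by simp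
qed

lemma lower_landau_level:
  assumes "F \<in> landau_level (Suc k)"
  shows "lower F \<in> landau_level k"
proof -
  have F: "F \<in> sections" and eig: "\<And>z. hamiltonian F z = of_real (B * (2 * real (Suc k) + 1)) * F z"
    using assms by (auto simp: landau_level_def)
  have rl: "raise (lower F) = (\<lambda>z. of_real (2 * B * real (Suc k)) * F z)"
    by (rule ext) (simp add: raise_lower[OF sections_smooth[OF F]] eig algebra_simps)
  have "hamiltonian (lower F) z = of_real (B * (2 * real k + 1)) * lower F z" for z
  proof -
    have "hamiltonian (lower F) z = lower (raise (lower F)) z - of_real B * lower F z"
      using lower_raise[OF smooth_lower[OF sections_smooth[OF F]], of z] by simp
    also have "lower (raise (lower F)) z = of_real (2 * B * real (Suc k)) * lower F z"
      unfolding rl by (rule lower_scale[OF sections_smooth[OF F]])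
    finally show ?thesis by (simp add: algebra_simps)
  qed
  then show ?thesis
    using sections_lower[OF F] by (simp add: landau_level_def)
qed

lemma raise_landau_level:
  assumes "F \<in> landau_level k"
  shows "raise F \<in> landau_level (Suc k)"
proof -
  have F: "F \<in> sections" and eig: "\<And>z. hamiltonian F z = of_real (B * (2 * real k + 1)) * F z"
    using assms by (auto simp: landau_level_def)
  have lr: "lower (raise F) = (\<lambda>z. of_real (2 * B * real (Suc k)) * F z)"
    by (rule ext) (simp add: lower_raise[OF sections_smooth[OF F]] eig algebra_simps)
  have "hamiltonian (raise F) z = of_real (B * (2 * real (Suc k) + 1)) * raise F z" for z
  proof -
    have "hamiltonian (raise F) z = raise (lower (raise F)) z + of_real B * raise F z"
      using raise_lower[OF smooth_raise[OF sections_smooth[OF F]], of z] by simp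
    also have "raise (lower (raise F)) z = of_real (2 * B * real (Suc k)) * raise F z"
      unfolding lr by (rule raise_scale[OF sections_smooth[OF F]])
    finally show ?thesis by (simp add: algebra_simps)
  qed
  then show ?thesis
    using sections_raise[OF F] by (simp add: landau_level_def)
qed

lemma landau_level_scale:
  assumes "F \<in> landau_level k"
  shows "(\<lambda>z. a * F z) \<in> landau_level k"
proof -
  have F: "smooth F" using assms by (simp add: landau_level_def sections_def)
  have sm: "smooth (\<lambda>z. a * F z)" by (intro smooth_intros F)
  have d: "d_z (\<lambda>z. a * G z) = (\<lambda>z. a * d_z G z)" "d_zbar (\<lambda>z. a * G z) = (\<lambda>z. a * d_zbar G z)"
    if "smooth G" for G
    by (simp_all add: fun_eq_iff wirtinger_mult wirtinger_const smooth_intros that)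
  have "hamiltonian (\<lambda>z. a * F z) z = a * hamiltonian F z" for z
    unfolding hamiltonian_def by (simp add: d F smooth_intros algebra_simps)
  then show ?thesis
    using assms sm by (auto simp: landau_level_def sections_def quasi_periods_def subset_iff)
qed

text \<open>For \<open>F\<close> in level \<open>0\<close>, the section \<open>lower F\<close> is annihilated by \<open>raise\<close>, so it is an eigenfunction with the negative
eigenvalue \<open>- B\<close>.\<close>

lemma lowest_landau_level:
  assumes "B > 0"
  shows "landau_level 0 = {F \<in> sections. \<forall>z. lower F z = 0}"
proof (intro equalityI subsetI)
  fix F assume "F \<in> landau_level 0"
  then have F: "F \<in> sections" and eig: "\<And>z. hamiltonian F z = of_real B * F z"
    by (auto simp: landau_level_def)
  have "raise (lower F) = (\<lambda>z. 0)"
    by (rule ext) (simp add: raise_lower[OF sections_smooth[OF F]] eig)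
  then have "lower (raise (lower F)) z = 0" for z
    by (simp add: lower_def wirtinger_const)
  then have "hamiltonian (lower F) z = of_real (- B) * lower F z" for z
    using lower_raise[OF smooth_lower[OF sections_smooth[OF F]], of z] by (simp add: eq_neg_iff_add_eq_0)
  then have "lower F z = 0" for z
    using hamiltonian_no_negative_eigenvalue[OF sections_lower[OF F], of "- B" z] assms by simp
  with F show "F \<in> {F \<in> sections. \<forall>z. lower F z = 0}" by simp
next
  fix F assume "F \<in> {F \<in> sections. \<forall>z. lower F z = 0}"
  then have F: "F \<in> sections" and l: "lower F = (\<lambda>z. 0)" by auto
  have "raise (lower F) z = 0" for z
    by (simp add: l raise_def wirtinger_const)
  then have "hamiltonian F z = of_real B * F z" for z
    using raise_lower[OF sections_smooth[OF F], of z] by simp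
  with F show "F \<in> landau_level 0" by (simp add: landau_level_def)
qed

lemma landau_level_Suc_eq_raise_image:
  assumes "B > 0"
  shows "landau_level (Suc k) = raise ` landau_level k"
proof (intro equalityI subsetI)
  fix F assume F: "F \<in> landau_level (Suc k)"
  define a where "a = (of_real (2 * B * real (Suc k)) :: complex)"
  have a: "a \<noteq> 0" using assms by (simp add: a_def del: of_nat_Suc)
  have sF: "smooth F" using F by (simp add: landau_level_def sections_def)
  define G where "G = (\<lambda>z. inverse a * lower F z)"
  have "G \<in> landau_level k"
    unfolding G_def by (intro landau_level_scale lower_landau_level F)
  moreover have "raise G z = F z" for z
  proof -
    have "raise G z = inverse a * raise (lower F) z"
      unfolding G_def by (rule raise_scale[OF smooth_lower[OF sF]])
    also have "raise (lower F) z = a * F z"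
      using F by (simp add: raise_lower[OF sF] landau_level_def a_def algebra_simps)
    finally show ?thesis using a by simp
  qed
  then have "raise G = F" by (rule ext)
  ultimately show "F \<in> raise ` landau_level k" by blast
qed (use raise_landau_level in blast)

lemma raise_injective:
  assumes "B > 0" "F \<in> landau_level k" "\<And>z. raise F z = 0"
  shows "F z = 0"
proof -
  have sF: "smooth F" using assms by (simp add: landau_level_def sections_def)
  have "raise F = (\<lambda>z. 0)" using assms(3) by blast
  then have "lower (raise F) z = 0"
    by (simp add: lower_def wirtinger_const)
  then have "of_real (2 * B * (real k + 1)) * F z = 0"
    using assms(2) by (simp add: lower_raise[OF sF] landau_level_def algebra_simps)
  moreover have "2 * B * (real k + 1) > 0"
    using assms(1) by simp
  then have "complex_of_real (2 * B * (real k + 1)) \<noteq> 0"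
    unfolding of_real_eq_0_iff by linarith
  ultimately show ?thesis
    using mult_eq_0_iff by blast
qed

lemma landau_level_negative_field:
  assumes "B < 0" "F \<in> landau_level k"
  shows "F z = 0"
proof (rule hamiltonian_no_negative_eigenvalue[where F=F])
  show "B * (2 * real k + 1) < 0"
    using assms(1) by (intro mult_neg_pos) auto
qed (use assms(2) in \<open>auto simp: landau_level_def\<close>)

text \<open>Multiplication by the unimodular function \<open>E'\<close> trivialises the connection and turns \<open>F\<close> into a harmonic
function \<open>H\<close>. Its derivatives \<open>d_z H\<close> and \<open>cnj (d_zbar H)\<close> are entire and bounded, hence constant; being bounded
itself, \<open>H\<close> is constant.\<close>

lemma landau_level_zero_field:
  assumes B: "B = 0" and F: "F \<in> landau_level k"
  obtains a where "\<And>z. F z = a * exp (cnj c * z - c * cnj z)"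
proof -
  define E where "E = (\<lambda>z. exp (cnj c * z - c * cnj z))"
  define E' where "E' = (\<lambda>z. exp (c * cnj z - cnj c * z))"
  have sE': "smooth E'" and dE': "d_z E' z = - (cnj c * E' z)" "d_zbar E' z = c * E' z" for z
    unfolding E'_def by (simp_all add: wirtinger_simps smooth_intros)
  have EE': "E z * E' z = 1" for z
    by (simp add: E_def E'_def flip: exp_add)
  have nE': "norm (E' z) = 1" for z
    by (simp add: E'_def norm_exp_eq_Re)
  have B0: "complex_of_real B = 0" using B by simp
  have S: "S z = c" for z unfolding S_def B0 by simp
  have bdd: "bounded (range (\<lambda>z. G z * E' z))" if G: "G \<in> sections" for G
  proof -
    obtain M where "\<And>z. norm (G z) \<le> M"
      using section_bounded[OF G] by (auto simp: bounded_iff)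
    then show ?thesis
      by (auto simp: bounded_iff norm_mult nE')
  qed
  have Fs: "F \<in> sections" and ham: "\<And>z. hamiltonian F z = 0"
    using F by (auto simp: landau_level_def B0)
  note sF = sections_smooth[OF Fs]
  define H where "H = (\<lambda>z. F z * E' z)"
  have sH: "smooth H" unfolding H_def by (intro smooth_intros sF sE')
  have dH: "d_z H = (\<lambda>z. - (raise F z * E' z))" "d_zbar H = (\<lambda>z. lower F z * E' z)"
    by (simp_all add: fun_eq_iff H_def wirtinger_mult sF sE' dE' raise_def lower_def S algebra_simps)
  have "bounded (range (d_zbar H))"
    unfolding dH by (rule bdd[OF sections_lower[OF Fs]])
  have rl: "raise (lower F) z = 0" "lower (raise F) z = 0" for z
    using ham by (simp_all add: raise_lower[OF sF] lower_raise[OF sF] B0)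
  have dz: "d_z (d_zbar H) z = 0" for z
    unfolding dH using rl(1)[of z]
    by (simp add: wirtinger_mult smooth_intros sF sE' dE' raise_def S algebra_simps)
  have b1: "bounded (range (d_z H))"
    unfolding dH using bdd[OF sections_raise[OF Fs]] by (simp add: bounded_iff)
  have "d_zbar (d_z H) z = 0" for z
    using dz by (simp add: d_zbar_d_z[OF sH])
  then obtain p where p: "\<And>z. d_z H z = p"
    using bounded_d_zbar_zero_imp_constant[OF smooth_d_z[OF sH] _ b1] by metis
  have b2: "bounded (range (\<lambda>z. cnj (d_zbar H z)))"
    using \<open>bounded (range (d_zbar H))\<close> by (simp add: bounded_iff)
  have "d_zbar (\<lambda>z. cnj (d_zbar H z)) z = 0" for z
    by (simp add: wirtinger_cnj smooth_d_zbar[OF sH] dz)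
  then obtain q where q: "\<And>z. cnj (d_zbar H z) = q"
    using bounded_d_zbar_zero_imp_constant[OF smooth_cnj[OF smooth_d_zbar[OF sH]] _ b2] by metis
  define K where "K = (\<lambda>z. H z - p * z - cnj q * cnj z)"
  have sK: "smooth K" unfolding K_def by (intro smooth_intros sH)
  have dK: "d_z K z = 0" "d_zbar K z = 0" for z
    using p[of z] arg_cong[OF q[of z], of cnj]
    by (simp_all add: K_def wirtinger_simps smooth_intros sH)
  have "frechet_derivative K (at z) = (\<lambda>v. 0)" for z
  proof -
    let ?D = "frechet_derivative K (at z)"
    have lin: "linear ?D"
      using smooth_has_derivative[OF sK] has_derivative_bounded_linear bounded_linear.linear by blast
    have "?D 1 = 0" "?D \<i> = 0"
      using dK[of z] by (simp_all add: d_z_def d_zbar_def)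
    moreover have "?D v = ?D (Re v *\<^sub>R 1 + Im v *\<^sub>R \<i>)" for v
      by (rule arg_cong[of _ _ "?D"]) (simp add: complex_eq_iff)
    ultimately show ?thesis
      by (simp add: linear_add[OF lin] linear_scale[OF lin] fun_eq_iff)
  qed
  then have "(K has_derivative (\<lambda>v. 0)) (at z within UNIV)" for z
    using smooth_has_derivative[OF sK, of z] by simp
  then obtain a where a: "\<And>z. K z = a"
    using has_derivative_zero_constant[OF convex_UNIV, of K] by auto
  then have H: "H z = a + p * z + cnj q * cnj z" for z
    unfolding K_def by (metis (no_types, lifting) add.assoc add.commute diff_add_cancel)
  obtain M where M: "\<And>z. norm (H z) \<le> M"
    using bdd[OF Fs] by (auto simp: H_def bounded_iff)
  have lin0: "p * z + cnj q * cnj z = 0" for z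
  proof (rule ccontr)
    define y where "y = p * z + cnj q * cnj z"
    assume "\<not> ?thesis"
    then have y: "norm y > 0" by (simp add: y_def)
    obtain n :: nat where n: "(M + norm a) / norm y < real n"
      using reals_Archimedean2 by blast
    have "H (of_nat n * z) = a + of_nat n * y"
      unfolding H y_def by (simp add: algebra_simps)
    then have "real n * norm y \<le> M + norm a"
      using M[of "of_nat n * z"] norm_triangle_ineq4[of "a + of_nat n * y" a] by (simp add: norm_mult)
    with n y show False by (simp add: pos_divide_less_eq)
  qed
  have "F z = a * E z" for z
  proof -
    have "F z = H z * E z"
      using EE'[of z] by (simp add: H_def mult.assoc mult.commute[of "E' z"])
    then show ?thesis using H[of z] lin0[of z] by (simp add: add.assoc)
  qed
  then show ?thesis
    using that unfolding E_def by blast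
qed

end

section \<open>The lowest Landau level and theta functions\<close>

context magnetic_torus
begin

definition area :: real where
  "area = Im (cnj \<omega>1 * \<omega>2)"

lemma generators_in_lattice: "\<omega>1 \<in> lattice" "\<omega>2 \<in> lattice" "\<omega>1 + \<omega>2 \<in> lattice"
proof -
  have "of_int 1 * \<omega>1 + of_int 0 * \<omega>2 \<in> lattice" "of_int 0 * \<omega>1 + of_int 1 * \<omega>2 \<in> lattice"
    "of_int 1 * \<omega>1 + of_int 1 * \<omega>2 \<in> lattice"
    unfolding lattice_def by blast+
  then show "\<omega>1 \<in> lattice" "\<omega>2 \<in> lattice" "\<omega>1 + \<omega>2 \<in> lattice" by simp_all
qed

lemma cocycle_exponent_area: "\<omega>1 * cnj \<omega>2 - cnj \<omega>1 * \<omega>2 = - 2 * \<i> * of_real area"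
  by (simp add: complex_eq_iff area_def)

text \<open>Translating by \<open>\<omega>1 + \<omega>2\<close> at once or in two steps gives multipliers that differ by the constant factor of
\<open>multiplier_shift\<close>, which must be \<open>1\<close> as soon as \<open>F\<close> does not vanish everywhere.\<close>

lemma flux_quantized:
  assumes F: "F \<in> sections" and "F z \<noteq> 0"
  obtains n :: int where "B * area = pi * of_int n"
proof -
  have q: "\<omega>1 \<in> quasi_periods F" "\<omega>2 \<in> quasi_periods F" "\<omega>1 + \<omega>2 \<in> quasi_periods F"
    using F generators_in_lattice by (auto simp: sections_def)
  have "multiplier (\<omega>1 + \<omega>2) z * F z = F ((z + \<omega>1) + \<omega>2)"
    using q(3) by (simp add: quasi_periods_def add.assoc)
  also have "\<dots> = multiplier \<omega>2 (z + \<omega>1) * (multiplier \<omega>1 z * F z)"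
    using q(1,2) unfolding quasi_periods_def by simp
  finally have "exp (of_real B * (\<omega>1 * cnj \<omega>2 - cnj \<omega>1 * \<omega>2)) = 1"
    using assms(2) norm_multiplier[of _ z] by (simp add: multiplier_add multiplier_shift) (metis norm_zero zero_neq_one)
  then obtain n :: int where n: "Im (of_real B * (\<omega>1 * cnj \<omega>2 - cnj \<omega>1 * \<omega>2)) = of_int (2 * n) * pi"
    unfolding exp_eq_1 by blast
  have "Im (of_real B * (\<omega>1 * cnj \<omega>2 - cnj \<omega>1 * \<omega>2)) = - 2 * (B * area)"
    unfolding cocycle_exponent_area by simp
  with n have "B * area = pi * of_int (- n)" by simp
  then show ?thesis by (rule that)
qed

lemma quasi_periods_of_int_mult:
  assumes "\<gamma> \<in> quasi_periods F"
  shows "of_int m * \<gamma> \<in> quasi_periods F"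
proof (induction m rule: int_induct[where k=0])
  case base
  then show ?case by (simp add: quasi_periods_def)
next
  case (step1 i)
  have "of_int i * \<gamma> + \<gamma> \<in> quasi_periods F"
    by (rule quasi_periods_add[OF step1(2) assms]) (simp add: mult_ac)
  then show ?case by (simp add: algebra_simps)
next
  case (step2 i)
  have "of_int i * \<gamma> + - \<gamma> \<in> quasi_periods F"
    by (rule quasi_periods_add[OF step2(2) quasi_periods_minus[OF assms]]) (simp add: mult_ac)
  then show ?case by (simp add: algebra_simps)
qed

text \<open>When the flux is an integral multiple of \<open>\<pi>\<close>, the constant factor of \<open>multiplier_shift\<close> is \<open>1\<close> for any two
lattice vectors, so the quasi-periods in the lattice form a group.\<close>

lemma quasi_periods_from_generators:
  assumes q: "\<omega>1 \<in> quasi_periods F" "\<omega>2 \<in> quasi_periods F" and n: "B * area = pi * of_int n"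
  shows "lattice \<subseteq> quasi_periods F"
proof
  fix \<gamma> assume "\<gamma> \<in> lattice"
  then obtain k l where \<gamma>: "\<gamma> = of_int k * \<omega>1 + of_int l * \<omega>2" by (auto simp: lattice_def)
  have "of_real B * ((of_int k * \<omega>1) * cnj (of_int l * \<omega>2) - cnj (of_int k * \<omega>1) * (of_int l * \<omega>2))
    = of_int (k * l) * (of_real B * (\<omega>1 * cnj \<omega>2 - cnj \<omega>1 * \<omega>2))"
    by (simp add: algebra_simps)
  also have "\<dots> = of_int (k * l) * (- 2 * \<i> * of_real (B * area))"
    unfolding cocycle_exponent_area by simp
  also have "\<dots> = 2 * of_int (- (k * l * n)) * of_real pi * \<i>"
    unfolding n by simp
  finally have "exp (of_real B * ((of_int k * \<omega>1) * cnj (of_int l * \<omega>2) - cnj (of_int k * \<omega>1) * (of_int l * \<omega>2))) = 1"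
    using exp_integer_2pi[of "of_int (- (k * l * n))"] by (simp add: mult_ac)
  then show "\<gamma> \<in> quasi_periods F"
    unfolding \<gamma> by (intro quasi_periods_add quasi_periods_of_int_mult q)
qed

text \<open>The affine coordinate in which \<open>S\<close> is linear and the lattice is \<open>\<int> + (\<omega>2 / \<omega>1) \<int>\<close>.\<close>

definition coord :: "complex \<Rightarrow> complex" where
  "coord z = (z + c / of_real B) / \<omega>1"

text \<open>A solution of \<open>lower F = 0\<close>. The holomorphic factor \<open>exp (b w\<^sup>2)\<close> in it, with \<open>w = coord z\<close>, is chosen so that
the quotients of sections by \<open>gauss\<close> have period \<open>\<omega>1\<close>.\<close>

definition gauss :: "complex \<Rightarrow> complex" where
  "gauss z = exp (of_real (B * (norm \<omega>1)\<^sup>2) * (coord z * (coord z - cnj (coord z))))"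

definition of_theta :: "(complex \<Rightarrow> complex) \<Rightarrow> complex \<Rightarrow> complex" where
  "of_theta \<theta> z = gauss z * \<theta> (coord z)"

context
  fixes n :: int
  assumes Bpos: "B > 0" and flux: "B * area = pi * of_int n"
begin

lemma period_nonzero: "\<omega>1 \<noteq> 0"
  using oriented by auto

lemma flux_pos: "n > 0"
proof -
  have "pi * of_int n > 0"
    using flux Bpos oriented by (metis area_def mult_pos_pos)
  then show ?thesis by (simp add: zero_less_mult_iff)
qed

lemma S_coord: "S z = of_real B * \<omega>1 * coord z"
  using Bpos period_nonzero by (simp add: S_def coord_def field_simps)

lemma coord_inverse: "coord (\<omega>1 * w - c / of_real B) = w"
  using period_nonzero by (simp add: coord_def)

lemma coord_add: "coord (z + \<gamma>) = coord z + \<gamma> / \<omega>1"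
  by (simp add: coord_def add_divide_distrib)

lemma smooth_coord: "smooth coord" and d_zbar_coord: "d_zbar coord z = 0"
  and d_z_coord: "d_z coord z = 1 / \<omega>1"
proof -
  have coord: "coord = (\<lambda>z. inverse \<omega>1 * z + c / of_real B / \<omega>1)"
    by (simp add: fun_eq_iff coord_def add_divide_distrib field_simps)
  have lin: "smooth (\<lambda>z. a * z + b)" "d_zbar (\<lambda>z. a * z + b) z = 0" "d_z (\<lambda>z. a * z + b) z = a"
    for a b z by (simp_all add: smooth_intros wirtinger_simps)
  show "smooth coord" "d_zbar coord z = 0" "d_z coord z = 1 / \<omega>1"
    unfolding coord by (simp_all only: lin inverse_eq_divide)
qed

lemma smooth_gauss: "smooth gauss" and d_zbar_gauss: "d_zbar gauss z = - (S z * gauss z)"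
proof -
  show "smooth gauss"
    unfolding gauss_def[abs_def] by (intro smooth_intros smooth_coord)
  have "d_zbar gauss z = gauss z * (of_real (B * (norm \<omega>1)\<^sup>2) * (coord z * - cnj (1 / \<omega>1)))"
    unfolding gauss_def[abs_def]
    by (simp add: wirtinger_exp wirtinger_mult wirtinger_diff wirtinger_cnj wirtinger_const smooth_intros
        smooth_coord d_zbar_coord d_z_coord)
  also have "of_real (B * (norm \<omega>1)\<^sup>2) * (coord z * - cnj (1 / \<omega>1)) = - S z"
    unfolding S_coord of_real_mult complex_norm_square using period_nonzero by simp
  finally show "d_zbar gauss z = - (S z * gauss z)" by (simp add: mult.commute)
qed

lemma gauss_nonzero: "gauss z \<noteq> 0"
  by (simp add: gauss_def)

lemma gauss_shift_1: "gauss (z + \<omega>1) = multiplier \<omega>1 z * gauss z"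
proof -
  have "coord (z + \<omega>1) = coord z + 1"
    using period_nonzero by (simp add: coord_add)
  then show ?thesis
    unfolding gauss_def multiplier_def S_coord exp_add [symmetric] of_real_mult complex_norm_square
    by (intro arg_cong[of _ _ exp]) (simp add: algebra_simps)
qed

text \<open>Under translation by \<open>\<omega>2\<close> the Gaussian alone does not transform like a section; the missing factor is the one in
the theta law.\<close>

lemma gauss_shift_2:
  "gauss (z + \<omega>2) * exp (- of_real pi * \<i> * of_nat (nat (2 * n)) * (2 * coord z + \<omega>2 / \<omega>1)) = multiplier \<omega>2 z * gauss z"
proof -
  define t where "t = \<omega>2 / \<omega>1"
  define b where "b = complex_of_real (B * (norm \<omega>1)\<^sup>2)"
  have \<omega>2: "\<omega>2 = \<omega>1 * t" using period_nonzero by (simp add: t_def)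
  have b: "b = of_real B * (\<omega>1 * cnj \<omega>1)"
    unfolding b_def of_real_mult complex_norm_square ..
  have N: "of_nat (nat (2 * n)) = (2 * of_int n :: complex)"
    using flux_pos by simp
  have "b * (t - cnj t) = of_real B * - (\<omega>1 * cnj \<omega>2 - cnj \<omega>1 * \<omega>2)"
    unfolding b \<omega>2 by (simp add: algebra_simps)
  also have "\<dots> = 2 * \<i> * of_real (B * area)"
    unfolding cocycle_exponent_area by simp
  finally have bt: "b * (t - cnj t) = of_real pi * \<i> * (2 * of_int n)"
    unfolding flux by simp
  have "coord (z + \<omega>2) = coord z + t"
    by (simp add: coord_add t_def)
  moreover have "b * ((w + t) * ((w + t) - cnj (w + t))) - b * (t - cnj t) * (2 * w + t)
     = (of_real B * \<omega>1 * w * cnj \<omega>2 - cnj (of_real B * \<omega>1 * w) * \<omega>2) + b * (w * (w - cnj w))" for w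
    unfolding b \<omega>2 by (simp add: algebra_simps)
  ultimately show ?thesis
    unfolding gauss_def multiplier_def S_coord exp_add [symmetric] N t_def [symmetric] b_def [symmetric]
    by (intro arg_cong[of _ _ exp]) (simp add: bt [symmetric])
qed

lemma of_theta_in_lowest_level:
  assumes \<theta>: "\<theta> \<in> theta_space (nat (2 * n)) (\<omega>2 / \<omega>1)"
  shows "of_theta \<theta> \<in> landau_level 0"
proof -
  have hol: "\<theta> holomorphic_on UNIV" and per: "\<And>w. \<theta> (w + 1) = \<theta> w"
    and qp: "\<And>w. \<theta> (w + \<omega>2 / \<omega>1) = exp (- of_real pi * \<i> * of_nat (nat (2 * n)) * (2 * w + \<omega>2 / \<omega>1)) * \<theta> w"
    using \<theta> by (auto simp: theta_space_def)
  have sm: "smooth (\<lambda>z. \<theta> (coord z))"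
    by (rule smooth_holomorphic_compose[OF hol smooth_coord])
  have smooth: "smooth (of_theta \<theta>)"
    unfolding of_theta_def[abs_def] by (intro smooth_intros smooth_gauss sm)
  have "lower (of_theta \<theta>) z = 0" for z
    unfolding lower_def of_theta_def[abs_def]
    by (simp add: wirtinger_mult smooth_gauss sm d_zbar_gauss
        wirtinger_holomorphic_compose[OF hol smooth_coord] d_zbar_coord)
  moreover have "\<omega>1 \<in> quasi_periods (of_theta \<theta>)"
    using period_nonzero
    by (simp add: quasi_periods_def of_theta_def gauss_shift_1 coord_add per)
  moreover have "\<omega>2 \<in> quasi_periods (of_theta \<theta>)"
    unfolding quasi_periods_def of_theta_def
    by (simp add: coord_add qp gauss_shift_2 [symmetric])
  ultimately show ?thesis
    using smooth quasi_periods_from_generators[OF _ _ flux]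
    by (simp add: lowest_landau_level[OF Bpos] sections_def)
qed

text \<open>Dividing a solution of \<open>lower F = 0\<close> by \<open>gauss\<close> leaves a function with vanishing \<open>d_zbar\<close>, and the laws of the two
generators become the two theta laws.\<close>

lemma lowest_level_eq_of_theta_image:
  "landau_level 0 = of_theta ` theta_space (nat (2 * n)) (\<omega>2 / \<omega>1)"
proof (intro equalityI subsetI)
  fix F assume "F \<in> landau_level 0"
  then have F: "F \<in> sections" and low: "\<And>z. lower F z = 0"
    by (auto simp: lowest_landau_level[OF Bpos])
  have sF: "smooth F" using F by (rule sections_smooth)
  \<comment> \<open>The reciprocal of \<open>gauss\<close>, written as an exponential so that it is visibly smooth.\<close>
  define gauss' where "gauss' = (\<lambda>z. exp (- (of_real (B * (norm \<omega>1)\<^sup>2) * (coord z * (coord z - cnj (coord z))))))"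
  have gg: "gauss z * gauss' z = 1" for z
    by (simp add: gauss_def gauss'_def flip: exp_add)
  have sg': "smooth gauss'"
    unfolding gauss'_def by (intro smooth_intros smooth_coord)
  have dg': "d_zbar gauss' z = S z * gauss' z" for z
  proof -
    have "(\<lambda>z. gauss z * gauss' z) = (\<lambda>z. 1)" using gg by (rule ext)
    then have "d_zbar (\<lambda>z. gauss z * gauss' z) z = 0"
      by (simp add: wirtinger_const)
    then have "gauss z * d_zbar gauss' z = gauss z * (S z * gauss' z)"
      by (simp add: wirtinger_mult smooth_gauss sg' d_zbar_gauss algebra_simps)
    then show ?thesis using gauss_nonzero by simp
  qed
  define h where "h = (\<lambda>z. F z * gauss' z)"
  have "h holomorphic_on UNIV"
  proof (rule d_zbar_zero_imp_holomorphic)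
    show "smooth h" unfolding h_def by (intro smooth_intros sF sg')
    show "d_zbar h z = 0" for z
    proof -
      have "d_zbar h z = lower F z * gauss' z"
        unfolding h_def lower_def by (simp add: wirtinger_mult sF sg' dg' algebra_simps)
      then show ?thesis by (simp add: low)
    qed
  qed
  define \<theta> where "\<theta> = (\<lambda>w. h (\<omega>1 * w - c / of_real B))"
  have hol: "\<theta> holomorphic_on UNIV"
  proof -
    have "(h \<circ> (\<lambda>w. \<omega>1 * w - c / of_real B)) holomorphic_on UNIV"
      by (rule holomorphic_on_compose_gen[OF _ \<open>h holomorphic_on UNIV\<close>]) (intro holomorphic_intros subset_UNIV)+
    then show ?thesis by (simp add: \<theta>_def o_def)
  qed
  have \<theta>_coord: "\<theta> (coord z) = h z" for z
    using period_nonzero by (simp add: \<theta>_def coord_def)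
  have F_eq: "F = of_theta \<theta>"
  proof
    fix z show "F z = of_theta \<theta> z"
      unfolding of_theta_def \<theta>_coord h_def using gg[of z] by (simp add: mult_ac)
  qed
  have q: "\<And>z. F (z + \<omega>1) = multiplier \<omega>1 z * F z" "\<And>z. F (z + \<omega>2) = multiplier \<omega>2 z * F z"
    using F generators_in_lattice by (auto simp: sections_def quasi_periods_def)
  have "\<theta> (w + 1) = \<theta> w" for w
  proof -
    define z where "z = \<omega>1 * w - c / of_real B"
    have "gauss (z + \<omega>1) * \<theta> (coord z + 1) = multiplier \<omega>1 z * (gauss z * \<theta> (coord z))"
      using q(1)[of z] period_nonzero unfolding F_eq of_theta_def by (simp add: coord_add)
    then have "gauss (z + \<omega>1) * \<theta> (coord z + 1) = gauss (z + \<omega>1) * \<theta> (coord z)"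
      by (simp add: gauss_shift_1)
    then show ?thesis
      using gauss_nonzero by (simp add: z_def coord_inverse)
  qed
  moreover have "\<theta> (w + \<omega>2 / \<omega>1) = exp (- of_real pi * \<i> * of_nat (nat (2 * n)) * (2 * w + \<omega>2 / \<omega>1)) * \<theta> w" for w
  proof -
    define z where "z = \<omega>1 * w - c / of_real B"
    have "gauss (z + \<omega>2) * \<theta> (coord z + \<omega>2 / \<omega>1) = (multiplier \<omega>2 z * gauss z) * \<theta> (coord z)"
      using q(2)[of z] unfolding F_eq of_theta_def by (simp add: coord_add)
    then have "gauss (z + \<omega>2) * \<theta> (coord z + \<omega>2 / \<omega>1) =
      gauss (z + \<omega>2) * (exp (- of_real pi * \<i> * of_nat (nat (2 * n)) * (2 * coord z + \<omega>2 / \<omega>1)) * \<theta> (coord z))"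
      unfolding gauss_shift_2 [symmetric] by (simp only: mult.assoc)
    then show ?thesis
      using gauss_nonzero by (simp add: z_def coord_inverse)
  qed
  ultimately have "\<theta> \<in> theta_space (nat (2 * n)) (\<omega>2 / \<omega>1)"
    using hol unfolding theta_space_def by blast
  with F_eq show "F \<in> of_theta ` theta_space (nat (2 * n)) (\<omega>2 / \<omega>1)" by blast
qed (use of_theta_in_lowest_level in blast)

lemma modulus_upper_half_plane: "Im (\<omega>2 / \<omega>1) > 0"
proof -
  have "\<omega>2 / \<omega>1 = (cnj \<omega>1 * \<omega>2) / of_real ((norm \<omega>1)\<^sup>2)"
    unfolding complex_norm_square using period_nonzero by simp
  then have "Im (\<omega>2 / \<omega>1) = Im (cnj \<omega>1 * \<omega>2) / (norm \<omega>1)\<^sup>2"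
    by (simp only: Im_divide_of_real)
  then show ?thesis
    using oriented period_nonzero by simp
qed

lemma landau_level_basis: "\<exists>f. is_basis (landau_level k) (nat (2 * n)) f"
proof (induction k)
  case 0
  obtain f where f: "\<And>j. j < nat (2 * n) \<Longrightarrow> f j \<in> theta_space (nat (2 * n)) (\<omega>2 / \<omega>1)"
    "\<And>\<theta>. \<theta> \<in> theta_space (nat (2 * n)) (\<omega>2 / \<omega>1) \<Longrightarrow> \<exists>u. \<theta> = (\<lambda>w. \<Sum>j<nat (2 * n). u j * f j w)"
    "\<And>u. (\<And>w. (\<Sum>j<nat (2 * n). u j * f j w) = 0) \<Longrightarrow> \<forall>j<nat (2 * n). u j = 0"
    using theta_space_basis[OF _ modulus_upper_half_plane, of "nat (2 * n)"] flux_pos by auto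
  have "theta_space (nat (2 * n)) (\<omega>2 / \<omega>1) = {\<lambda>z. \<Sum>j<nat (2 * n). u j * f j z | u. True}"
    using f(1,2) theta_space_linear_combination[of "nat (2 * n)" f] by blast
  then have "is_basis (theta_space (nat (2 * n)) (\<omega>2 / \<omega>1)) (nat (2 * n)) f"
    using f(3) unfolding is_basis_def by blast
  then have "is_basis (landau_level 0) (nat (2 * n)) (\<lambda>j. of_theta (f j))"
    unfolding lowest_level_eq_of_theta_image
  proof (rule is_basis_transfer)
    show "of_theta (\<lambda>z. \<Sum>j<nat (2 * n). u j * f j z) = (\<lambda>z. \<Sum>j<nat (2 * n). u j * of_theta (f j) z)" for u
      by (simp add: fun_eq_iff of_theta_def sum_distrib_left mult_ac)
    fix \<theta> :: "complex \<Rightarrow> complex" assume "\<forall>z. of_theta \<theta> z = 0"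
    then have "\<theta> (coord z) = 0" for z
      using gauss_nonzero by (simp add: of_theta_def)
    then show "\<forall>w. \<theta> w = 0" by (metis coord_inverse)
  qed
  then show ?case by blast
next
  case (Suc k)
  then obtain f where f: "is_basis (landau_level k) (nat (2 * n)) f" by blast
  have sf: "smooth (f j)" if "j < nat (2 * n)" for j
    using is_basis_mem[OF f that] by (simp add: landau_level_def sections_def)
  have lin: "smooth (\<lambda>z. \<Sum>j<m. u j * f j z) \<and>
      raise (\<lambda>z. \<Sum>j<m. u j * f j z) = (\<lambda>z. \<Sum>j<m. u j * raise (f j) z)" if "m \<le> nat (2 * n)" for u and m :: nat
    using that
  proof (induction m)
    case 0
    then show ?case by (simp add: smooth_intros fun_eq_iff raise_def wirtinger_const)
  next
    case (Suc m)
    then have IH: "smooth (\<lambda>z. \<Sum>j<m. u j * f j z)"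
      "raise (\<lambda>z. \<Sum>j<m. u j * f j z) = (\<lambda>z. \<Sum>j<m. u j * raise (f j) z)" and sm: "smooth (f m)"
      using sf by auto
    have "raise (\<lambda>z. (\<Sum>j<m. u j * f j z) + u m * f m z) z = raise (\<lambda>z. \<Sum>j<m. u j * f j z) z + u m * raise (f m) z" for z
      by (simp only: raise_add[OF IH(1) smooth_mult[OF smooth_const sm]] raise_scale[OF sm])
    then show ?case
      using IH sm by (simp add: smooth_intros)
  qed
  have "is_basis (raise ` landau_level k) (nat (2 * n)) (\<lambda>j. raise (f j))"
    by (rule is_basis_transfer[OF f]) (use lin raise_injective[OF Bpos] in auto)
  then show ?case
    unfolding landau_level_Suc_eq_raise_image[OF Bpos] by blast
qed

end

lemma zero_section: "(\<lambda>z. 0) \<in> landau_level k"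
proof -
  have "d_zbar (\<lambda>z. 0) = (\<lambda>z. 0)"
    by (rule ext) (rule wirtinger_const)
  then show ?thesis
    by (simp add: landau_level_def sections_def quasi_periods_def smooth_intros hamiltonian_def wirtinger_const)
qed

lemma fin_dim_zero: "fin_dim_space {\<lambda>z. 0}"
  unfolding fin_dim_space_def by (intro exI[of _ "{}"]) (simp add: zero_fun_def)

text \<open>The three signs of \<open>B\<close> need different arguments for finite dimension. The area enters because a nonzero section
exists only when the flux is quantised.\<close>

theorem landau_level_dimension:
  shows "fin_dim_space (landau_level k)"
    and "B > 0 \<Longrightarrow> sections \<noteq> {\<lambda>z. 0} \<Longrightarrow> real (cfun.dim (landau_level k)) = 2 * B / pi * area"
proof -
  have main: "fin_dim_space (landau_level k) \<and> real (cfun.dim (landau_level k)) = 2 * B / pi * area"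
    if Bpos: "B > 0" and F: "F \<in> sections" "F z \<noteq> 0" for F z
  proof -
    obtain n where n: "B * area = pi * of_int n"
      using flux_quantized[OF F] by blast
    obtain f where f: "is_basis (landau_level k) (nat (2 * n)) f"
      using landau_level_basis[OF Bpos n] by blast
    have "real (nat (2 * n)) = 2 * of_int n"
      using flux_pos[OF Bpos n] by simp
    also have "\<dots> = 2 * B / pi * area"
      using n by (simp add: field_simps)
    finally show ?thesis
      using is_basis_imp_dim[OF f] by simp
  qed
  have zero: "landau_level k = {\<lambda>z. 0}" if "\<And>F z. F \<in> landau_level k \<Longrightarrow> F z = 0"
    using that zero_section by (auto simp: fun_eq_iff)
  show "fin_dim_space (landau_level k)"
  proof (cases "B > 0 \<and> (\<exists>F z. F \<in> sections \<and> F z \<noteq> 0)")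
    case True
    then show ?thesis using main by blast
  next
    case False
    then consider "\<And>F z. F \<in> landau_level k \<Longrightarrow> F z = 0" | "B = 0"
      using landau_level_negative_field by (auto simp: landau_level_def) (metis linorder_neqE_linordered_idom)
    then show ?thesis
    proof cases
      case 1
      then have "landau_level k = {\<lambda>z. 0}" by (rule zero)
      then show ?thesis using fin_dim_zero by simp
    next
      case 2
      show ?thesis
      proof (cases "\<exists>F z. F \<in> landau_level k \<and> F z \<noteq> 0")
        case False
        then have "landau_level k = {\<lambda>z. 0}" by (intro zero) blast
        then show ?thesis using fin_dim_zero by simp
      next
        case True
        then obtain F z0 where F: "F \<in> landau_level k" "F z0 \<noteq> 0" by blast
        obtain a where a: "\<And>z. F z = a * exp (cnj c * z - c * cnj z)"
          using landau_level_zero_field[OF 2 F(1)] by blast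
        have a0: "a \<noteq> 0" using a[of z0] F(2) by auto
        have "landau_level k = cfun.span {F}"
        proof (intro equalityI subsetI)
          fix G assume "G \<in> landau_level k"
          then obtain b where b: "\<And>z. G z = b * exp (cnj c * z - c * cnj z)"
            using landau_level_zero_field[OF 2] by blast
          have "G = fun_scale (b / a) F"
            using a0 by (simp add: fun_eq_iff fun_scale_def a b)
          then show "G \<in> cfun.span {F}"
            unfolding cfun.span_singleton by (rule range_eqI)
        next
          fix G assume "G \<in> cfun.span {F}"
          then obtain b where "G = fun_scale b F"
            by (auto simp: cfun.span_singleton)
          then show "G \<in> landau_level k"
            using landau_level_scale[OF F(1)] by (simp add: fun_scale_def)
        qed
        then show ?thesis
          unfolding fin_dim_space_def by (intro exI[of _ "{F}"]) simp
      qed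
    qed
  qed
  show "real (cfun.dim (landau_level k)) = 2 * B / pi * area" if Bpos: "B > 0" and ne: "sections \<noteq> {\<lambda>z. 0}"
  proof -
    have "(\<lambda>z. 0) \<in> sections"
      using zero_section[of 0] by (simp add: landau_level_def)
    then obtain F where "F \<in> sections" "F \<noteq> (\<lambda>z. 0)" using ne by blast
    then obtain z where "F \<in> sections" "F z \<noteq> 0" by auto
    then show ?thesis using main[OF Bpos] by blast
  qed
qed

end

section \<open>Equivariant pairs and the dimension formula\<close>

text \<open>The linear part of \<open>\<rho>\<close> is a character on translations. Conjugation by the rotation \<open>-1\<close> maps a translation to its
inverse but fixes the character, since the circle is commutative; so the character has order two, and it is trivial
because every translation has a square root.\<close>

lemma equivariant_pair_translation:
  assumes "equivariant_pair \<rho> \<tau>"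
  shows "\<rho> (1, b) = (1, \<tau> b - \<tau> 0)" "\<tau> (z + b) = \<tau> z + (\<tau> b - \<tau> 0)"
proof -
  have hom: "\<rho> \<in> hom motion_group motion_group" and eq: "\<And>g z. g \<in> carrier motion_group \<Longrightarrow> \<tau> (motion_act g z) = motion_act (\<rho> g) (\<tau> z)"
    using assms by (auto simp: equivariant_pair_def)
  have mult: "fst (\<rho> (a * a', a * d + b)) = fst (\<rho> (a, b)) * fst (\<rho> (a', d))"
    if "cmod a = 1" "cmod a' = 1" for a a' b d
    using hom_mult[OF hom, of "(a, b)" "(a', d)"] that
    by (simp add: motion_group_def split: prod.splits)
  have unit: "cmod (fst (\<rho> (a, b))) = 1" if "cmod a = 1" for a b
  proof -
    have "\<rho> \<in> carrier motion_group \<rightarrow> carrier motion_group"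
      using hom by (simp add: hom_def)
    moreover have "(a, b) \<in> carrier motion_group"
      using that by (simp add: motion_group_def)
    ultimately have "\<rho> (a, b) \<in> carrier motion_group"
      by (rule funcset_mem)
    then show ?thesis
      by (simp add: motion_group_def split_beta)
  qed
  define rot where "rot b = fst (\<rho> (1, b))" for b
  have rot_add: "rot (b + d) = rot b * rot d" for b d
    using mult[of 1 1 d b] by (simp add: rot_def add.commute)
  have rot0: "rot 0 = 1"
    using rot_add[of 0 0] unit[of 1 0] by (auto simp: rot_def)
  \<comment> \<open>The conjugation is by the half turn, whose square is the identity.\<close>
  define s where "s = fst (\<rho> (- 1, 0))"
  have s2: "s * s = 1"
    using mult[of "-1" "-1" 0 0] rot0 by (simp add: s_def rot_def)
  have rot_neg: "rot (- b) = rot b" for b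
  proof -
    have "rot (- b) = fst (\<rho> (- 1, - b)) * s"
      using mult[of "-1" "-1" 0 "- b"] by (simp add: rot_def s_def)
    also have "fst (\<rho> (- 1, - b)) = s * rot b"
      using mult[of "-1" 1 b 0] by (simp add: rot_def s_def)
    finally show ?thesis
      using s2 by (simp add: mult_ac)
  qed
  have "rot b = 1" for b
  proof -
    have "rot (b / 2 + b / 2) = rot (b / 2) * rot (- (b / 2))"
      unfolding rot_add rot_neg ..
    also have "\<dots> = 1"
      unfolding rot_add [symmetric] by (simp add: rot0)
    finally show ?thesis by simp
  qed
  then have \<rho>b: "\<rho> (1, b) = (1, snd (\<rho> (1, b)))" for b
    by (simp add: rot_def prod_eq_iff)
  have tr: "\<tau> (z + b) = \<tau> z + snd (\<rho> (1, b))" for z b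
  proof -
    have "\<tau> (motion_act (1, b) z) = motion_act (\<rho> (1, b)) (\<tau> z)"
      by (rule eq) (simp add: motion_group_def)
    then show ?thesis
      using arg_cong[OF \<rho>b[of b], of fst] by (simp add: motion_act_def add.commute)
  qed
  have "snd (\<rho> (1, b)) = \<tau> b - \<tau> 0" for b
    using tr[of 0 b] by simp
  with \<rho>b tr show "\<rho> (1, b) = (1, \<tau> b - \<tau> 0)" "\<tau> (z + b) = \<tau> z + (\<tau> b - \<tau> 0)"
    by metis+
qed

text \<open>By equivariance under translations the derivative of \<open>\<tau>\<close> is the same at every point.\<close>

lemma equivariant_map_affine:
  assumes "equivariant_pair \<rho> \<tau>"
  obtains p q where "\<And>z. \<tau> z = \<tau> 0 + p * z + q * cnj z"
proof -
  have sm: "smooth \<tau>" using assms by (simp add: equivariant_pair_def)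
  define D where "D = frechet_derivative \<tau> (at 0)"
  have D: "(\<tau> has_derivative D) (at 0)"
    unfolding D_def by (rule smooth_has_derivative[OF sm])
  then have lin: "linear D"
    using has_derivative_bounded_linear bounded_linear.linear by blast
  have der: "(\<tau> has_derivative D) (at z)" for z
  proof -
    have "((\<lambda>x. \<tau> (x - z)) has_derivative D) (at z)"
    proof (rule has_derivative_compose[where f="\<lambda>x. x - z" and g=\<tau> and f'="\<lambda>v. v"])
      show "((\<lambda>x. x - z) has_derivative (\<lambda>v. v)) (at z)"
        by (auto intro!: derivative_eq_intros)
      show "(\<tau> has_derivative D) (at (z - z))"
        using D by simp
    qed
    then have "((\<lambda>x. \<tau> (x - z) + (\<tau> z - \<tau> 0)) has_derivative (\<lambda>v. D v + 0)) (at z)"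
      by (intro has_derivative_add has_derivative_const)
    moreover have "\<tau> (x - z) + (\<tau> z - \<tau> 0) = \<tau> x" for x
      using equivariant_pair_translation(2)[OF assms, of "x - z" z] by simp
    ultimately show ?thesis by simp
  qed
  have "((\<lambda>x. \<tau> x - D x) has_derivative (\<lambda>v. 0)) (at z within UNIV)" for z
    using has_derivative_diff[OF der[of z] bounded_linear_imp_has_derivative[OF has_derivative_bounded_linear[OF D]]]
    by simp
  then obtain a where a: "\<And>z. \<tau> z - D z = a"
    using has_derivative_zero_constant[OF convex_UNIV, of "\<lambda>x. \<tau> x - D x"] by auto
  define p q where "p = (D 1 - \<i> * D \<i>) / 2" and "q = (D 1 + \<i> * D \<i>) / 2"
  have Dpq: "D z = p * z + q * cnj z" for z
  proof -
    have "D z = D (Re z *\<^sub>R 1 + Im z *\<^sub>R \<i>)"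
      by (rule arg_cong[of _ _ D]) (simp add: complex_eq_iff)
    also have "\<dots> = Re z *\<^sub>R D 1 + Im z *\<^sub>R D \<i>"
      by (simp only: linear_add[OF lin] linear_scale[OF lin])
    finally have "D z = of_real (Re z) * D 1 + of_real (Im z) * D \<i>"
      by (simp add: scaleR_conv_of_real)
    moreover have "p * (x + \<i> * y) + q * (x - \<i> * y) = x * D 1 + y * D \<i>" for x y
      by (simp add: p_def q_def field_simps)
    moreover have "z = of_real (Re z) + \<i> * of_real (Im z)" "cnj z = of_real (Re z) - \<i> * of_real (Im z)"
      by (simp_all add: complex_eq_iff)
    ultimately show ?thesis by metis
  qed
  have "\<tau> z = \<tau> 0 + p * z + q * cnj z" for z
  proof -
    have "\<tau> z = \<tau> 0 + D z"
      using a[of z] a[of 0] linear_0[OF lin] by (simp add: algebra_simps)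
    then show ?thesis by (simp add: Dpq)
  qed
  then show ?thesis by (rule that)
qed

lemma j_factor_translation:
  "j_factor \<alpha> (1, b) z = exp (- of_real \<alpha> * (z * cnj b - cnj z * b))"
proof -
  have "inv\<^bsub>motion_group\<^esub> (1, b) = (1, - b)"
    by (rule group.inv_equality[OF group_motion_group]) (simp_all add: motion_group_def)
  then have "j_factor \<alpha> (1, b) z = exp (of_real \<alpha> * (2 * \<i> * of_real (Im (- (z * cnj b)))))"
    by (simp add: j_factor_def motion_act_def herm_def mult_ac)
  also have "2 * \<i> * of_real (Im (- (z * cnj b))) = - (z * cnj b - cnj z * b)"
    by (simp add: complex_eq_iff)
  finally show ?thesis
    by (simp only: mult_minus_left mult_minus_right)
qed

context
  fixes \<rho> :: "complex \<times> complex \<Rightarrow> complex \<times> complex" and \<tau> :: "complex \<Rightarrow> complex" and p q :: complex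
    and \<nu> \<mu> :: real
  assumes pair: "equivariant_pair \<rho> \<tau>" and affine: "\<And>z. \<tau> z = \<tau> 0 + p * z + q * cnj z"
begin

definition field_strength :: real where
  "field_strength = \<nu> + \<mu> * ((cmod p)\<^sup>2 - (cmod q)\<^sup>2)"

definition offset :: complex where
  "offset = of_real \<mu> * (\<tau> 0 * cnj p - cnj (\<tau> 0) * q)"

lemma of_real_field_strength:
  "complex_of_real field_strength = of_real \<nu> + of_real \<mu> * (p * cnj p - q * cnj q)"
  by (simp only: field_strength_def of_real_add of_real_mult of_real_diff complex_norm_square)

lemma wirtinger_tau:
  "d_z \<tau> z = p" "d_zbar \<tau> z = q" "d_zbar (\<lambda>w. cnj (\<tau> w)) z = cnj p"
proof -
  have \<tau>: "\<tau> = (\<lambda>z. \<tau> 0 + p * z + q * cnj z)"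
    using affine by blast
  have sm: "smooth \<tau>"
    using pair by (simp add: equivariant_pair_def)
  have "d_z (\<lambda>z. \<tau> 0 + p * z + q * cnj z) z = p" "d_zbar (\<lambda>z. \<tau> 0 + p * z + q * cnj z) z = q"
    by (simp_all add: wirtinger_simps smooth_intros)
  then show *: "d_z \<tau> z = p" "d_zbar \<tau> z = q"
    using \<tau> by simp_all
  show "d_zbar (\<lambda>w. cnj (\<tau> w)) z = cnj p"
    by (simp add: wirtinger_cnj sm *)
qed

lemma B_fun_eq: "B_fun \<tau> \<nu> \<mu> z = field_strength"
  by (simp add: B_fun_def field_strength_def wirtinger_tau)

lemma S_fun_eq: "S_fun \<tau> \<nu> \<mu> z = magnetic_field.S field_strength offset z"
  unfolding S_fun_def magnetic_field.S_def of_real_field_strength offset_def wirtinger_tau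
  by (subst (1 2) affine) (simp add: algebra_simps)

lemma Laplace_tau: "Laplace \<tau> z = 0" "Laplace (\<lambda>w. cnj (\<tau> w)) z = 0"
proof -
  have "d_zbar \<tau> = (\<lambda>z. q)" "d_zbar (\<lambda>w. cnj (\<tau> w)) = (\<lambda>z. cnj p)"
    by (simp_all add: fun_eq_iff wirtinger_tau)
  then show "Laplace \<tau> z = 0" "Laplace (\<lambda>w. cnj (\<tau> w)) z = 0"
    by (simp_all add: Laplace_def wirtinger_const)
qed

lemma magnetic_op_eq:
  "magnetic_op \<tau> \<nu> \<mu> F z = magnetic_field.hamiltonian field_strength offset F z"
  by (simp add: magnetic_op_def magnetic_field.hamiltonian_def Laplace_tau S_fun_eq)

text \<open>The translation part of \<open>\<rho> (1, \<gamma>)\<close> is the linear part of \<open>\<tau>\<close> at \<open>\<gamma>\<close>, and this real linear map multiplies the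
area form by \<open>|p|\<^sup>2 - |q|\<^sup>2\<close>; the constant \<open>\<tau> 0\<close> produces the offset.\<close>

lemma automorphy_factor_eq:
  "j_factor (- \<nu>) (1, \<gamma>) z * j_factor (- \<mu>) (\<rho> (1, \<gamma>)) (\<tau> z)
    = magnetic_field.multiplier field_strength offset \<gamma> z"
proof -
  have \<gamma>: "\<rho> (1, \<gamma>) = (1, p * \<gamma> + q * cnj \<gamma>)"
    using equivariant_pair_translation(1)[OF pair, of \<gamma>] affine[of \<gamma>] by simp
  show ?thesis
    unfolding \<gamma> j_factor_translation magnetic_field.multiplier_def magnetic_field.S_def
      of_real_field_strength offset_def exp_add [symmetric]
    by (subst (1 2) affine, intro arg_cong[of _ _ exp])
       (simp add: algebra_simps)
qed

end

theorem proposition4p2: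
  fixes \<nu> \<mu> :: real
    and \<Gamma> :: "complex set"
    and \<rho> :: "complex \<times> complex \<Rightarrow> complex \<times> complex"
    and \<tau> :: "complex \<Rightarrow> complex"
  assumes "\<nu> > 0" and "\<mu> > 0"
    and "uniform_lattice \<Gamma>"
    and "equivariant_pair \<rho> \<tau>"
  shows "\<forall>k. fin_dim_space (mixed_eigenspace \<Gamma> \<rho> \<tau> \<nu> \<mu> k) \<and>
           (\<forall>z. B_fun \<tau> \<nu> \<mu> z > 0 \<and> mixed_forms \<Gamma> \<rho> \<tau> \<nu> \<mu> \<noteq> {0} \<longrightarrow>
              real (cfun.dim (mixed_eigenspace \<Gamma> \<rho> \<tau> \<nu> \<mu> k)) =
                2 * B_fun \<tau> \<nu> \<mu> z / pi * lattice_area \<Gamma>)"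
proof -
  obtain a b where ab: "Im (cnj a * b) > 0" and \<Gamma>: "\<Gamma> = {of_int m * a + of_int n * b | m n. True}"
    and area: "lattice_area \<Gamma> = Im (cnj a * b)"
    using lattice_oriented_basis[OF assms(3)] by blast
  obtain p q where affine: "\<And>z. \<tau> z = \<tau> 0 + p * z + q * cnj z"
    using equivariant_map_affine[OF assms(4)] by blast
  interpret torus: magnetic_torus "field_strength p q \<nu> \<mu>" "offset \<tau> p q \<mu>" a b
    by unfold_locales (rule ab)
  have lattice_eq: "torus.lattice = \<Gamma>"
    by (simp add: \<Gamma> torus.lattice_def)
  have sections: "mixed_forms \<Gamma> \<rho> \<tau> \<nu> \<mu> = torus.sections"
    unfolding mixed_forms_def torus.sections_def torus.quasi_periods_def lattice_eq
      automorphy_factor_eq[OF assms(4) affine] by blast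
  have level: "mixed_eigenspace \<Gamma> \<rho> \<tau> \<nu> \<mu> k = torus.landau_level k" for k
    unfolding mixed_eigenspace_def torus.landau_level_def sections
      magnetic_op_eq[OF assms(4) affine] B_fun_eq[OF assms(4) affine] ..
  have zero: "{0} = {\<lambda>z::complex. 0::complex}"
    by (simp add: zero_fun_def)
  show ?thesis
    unfolding level sections B_fun_eq[OF assms(4) affine] area zero
    using torus.landau_level_dimension unfolding torus.area_def by blast
qed

end
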